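(* Fix constants $c_5>0$, $\delta\in(0,1)$. There exist constants $c_0,C_2>0$ such that the following holds for all sufficiently large $n$. Let $B_1,\dots,B_m\in\mathbb{R}^{n\times n}$ be i.i.d. random matrices satisfying, for some $K\le n^2$, $\|B_i\|\le K$ almost surely and $\|\mathbb{E}[\mathcal B_i^*\mathcal B_i]-\mathcal I\|\le c_5/n$. If $m>c_0rK^2\log^7n$, then with probability at least $1-1/n^2$: (i) for all $X\in\mathbb{R}^{n\times n}$ of rank at most $r$, $\big|\frac1m\|\mathcal B(X)\|_2^2-\|X\|_{\mathrm F}^2\big|\le\delta\|X\|_{\mathrm F}^2$; (ii) for every convex set $\mathcal K\subseteq\mathbb{R}^{n\times n}$, every $\epsilon_2\ge0$, every $\Sigma\in\mathcal K$ of rank at most $r$ and every $y\in\mathbb{R}^m$ with $\|y-\mathcal B(\Sigma)\|_2\le\epsilon_2$, any minimizer $\hat\Sigma$ of $\min_M\|M\|_*$ subject to $\|y-\mathcal B(M)\|_2\le\epsilon_2$, $M\in\mathcal K$, satisfies $\|\hat\Sigma-\Sigma\|_{\mathrm F}\le C_2\epsilon_2/\sqrt m$.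
   Context: $\mathcal B_i(X)=\langle B_i,X\rangle=\operatorname{Tr}(B_i^\top X)$, $\mathcal B(X)=(\mathcal B_i(X))_{i=1}^m$, and $\mathcal B_i^*\mathcal B_i$ is the linear operator $X\mapsto\langle B_i,X\rangle B_i$ on $\mathbb{R}^{n\times n}$; $\mathcal I$ is the identity operator, and operator norms are with respect to the Frobenius norm. $\|B_i\|$ is the spectral norm. *)

theory Defs
  imports "HOL-Probability.Probability" "Jordan_Normal_Form.DL_Rank" "Jordan_Normal_Form.Char_Poly"
begin

text \<open>n-by-n real matrices are represented as functions nat => nat => real;
only the entries with indices below n are relevant.\<close>

definition sqmats :: "nat \<Rightarrow> (nat \<Rightarrow> nat \<Rightarrow> real) set" where
  "sqmats n = {X. \<forall>i j. \<not> (i < n \<and> j < n) \<longrightarrow> X i j = 0}"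

definition to_mat :: "nat \<Rightarrow> (nat \<Rightarrow> nat \<Rightarrow> real) \<Rightarrow> real Matrix.mat" where
  "to_mat n X = Matrix.mat n n (\<lambda>(i,j). X i j)"

definition mrank :: "nat \<Rightarrow> (nat \<Rightarrow> nat \<Rightarrow> real) \<Rightarrow> nat" where
  "mrank n X = vec_space.rank n (to_mat n X)"

definition frob :: "nat \<Rightarrow> (nat \<Rightarrow> nat \<Rightarrow> real) \<Rightarrow> real" where
  "frob n X = sqrt (\<Sum>i<n. \<Sum>j<n. (X i j)\<^sup>2)"

definition minner :: "nat \<Rightarrow> (nat \<Rightarrow> nat \<Rightarrow> real) \<Rightarrow> (nat \<Rightarrow> nat \<Rightarrow> real) \<Rightarrow> real" where
  "minner n A X = (\<Sum>i<n. \<Sum>j<n. A i j * X i j)"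

definition vnorm :: "nat \<Rightarrow> (nat \<Rightarrow> real) \<Rightarrow> real" where
  "vnorm k x = sqrt (\<Sum>i<k. (x i)\<^sup>2)"

definition spec_norm :: "nat \<Rightarrow> (nat \<Rightarrow> nat \<Rightarrow> real) \<Rightarrow> real" where
  "spec_norm n B = Sup {vnorm n (\<lambda>i. \<Sum>j<n. B i j * x j) | x. vnorm n x \<le> 1}"

text \<open>Nuclear norm: sum of the singular values (with multiplicity), i.e. of the square
roots of the eigenvalues of X^T X counted with algebraic multiplicity.\<close>
definition nuc_norm :: "nat \<Rightarrow> (nat \<Rightarrow> nat \<Rightarrow> real) \<Rightarrow> real" where
  "nuc_norm n X = (let p = char_poly (Matrix.transpose_mat (to_mat n X) * to_mat n X) in
     (\<Sum>t\<in>{x. poly p x = 0}. real (Polynomial.order t p) * sqrt t))"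

definition matsp :: "nat \<Rightarrow> (nat \<Rightarrow> nat \<Rightarrow> real) measure" where
  "matsp n = PiM {..<n} (\<lambda>_. PiM {..<n} (\<lambda>_. borel))"

definition meas :: "nat \<Rightarrow> (nat \<Rightarrow> nat \<Rightarrow> nat \<Rightarrow> real) \<Rightarrow> (nat \<Rightarrow> nat \<Rightarrow> real) \<Rightarrow> nat \<Rightarrow> real" where
  "meas n Bs X = (\<lambda>l. minner n (Bs l) X)"

definition EBB_minus_I :: "nat \<Rightarrow> (nat \<Rightarrow> nat \<Rightarrow> real) measure \<Rightarrow> (nat \<Rightarrow> nat \<Rightarrow> real) \<Rightarrow> (nat \<Rightarrow> nat \<Rightarrow> real)" where
  "EBB_minus_I n \<mu> X = (\<lambda>i j. if i < n \<and> j < n then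
      (\<integral>B. minner n B X * B i j \<partial>\<mu>) - X i j else 0)"

definition op_norm_F :: "nat \<Rightarrow> ((nat \<Rightarrow> nat \<Rightarrow> real) \<Rightarrow> (nat \<Rightarrow> nat \<Rightarrow> real)) \<Rightarrow> real" where
  "op_norm_F n L = Sup {frob n (L X) | X. X \<in> sqmats n \<and> frob n X \<le> 1}"

definition mconvex :: "(nat \<Rightarrow> nat \<Rightarrow> real) set \<Rightarrow> bool" where
  "mconvex S \<longleftrightarrow> (\<forall>X\<in>S. \<forall>Y\<in>S. \<forall>t::real. 0 \<le> t \<and> t \<le> 1 \<longrightarrow>
      (\<lambda>i j. t * X i j + (1 - t) * Y i j) \<in> S)"

end

theory Submission
  imports Defs
begin

text \<open>
  Both claims follow from one uniform bound: with high probability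
  \<open>\<bar>\<parallel>\<B>(X)\<parallel>\<^sup>2 / m - \<parallel>X\<parallel>\<^sub>F\<^sup>2\<bar> \<le> \<delta> \<parallel>X\<parallel>\<^sub>F\<^sup>2\<close> for every \<open>X\<close> whose nuclear norm is at most
  \<open>3 \<surd>r\<close> times its Frobenius norm. Matrices of rank at most \<open>r\<close> are of this kind, and so is the error
  of any nuclear norm minimiser, because a direction in which the nuclear norm does not increase at
  a matrix of rank \<open>r\<close> has nuclear norm at most \<open>3 \<surd>r\<close> times its Frobenius norm.

  For fixed measurements of spectral norm at most \<open>K\<close>, the nuclear ball of radius \<open>s\<close> is covered, up
  to error \<open>\<epsilon>\<close> in every measurement, by \<open>(2 m + 1)\<^sup>T\<close> points with \<open>T = O(K\<^sup>2 s\<^sup>2 ln n / \<epsilon>\<^sup>2)\<close>. This comes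
  from the mistake bound of an online algorithm (the matrix \<open>p\<close>-norm perceptron with \<open>p\<close> of order
  \<open>ln n\<close>), which identifies \<open>X\<close> by its list of mistakes; it replaces the usual duality of entropy
  numbers. Chaining over dyadic scales with Hoeffding's inequality bounds the process with random
  signs, relative to the largest empirical second moment. A ghost sample and random swaps transfer
  this to the centred process, and the self-referential second moment is removed by a descent over
  deviation levels.
\<close>

subsection \<open>Orthonormal families and the spectral theorem\<close>

text \<open>Two features of the cover drive the estimate. Its logarithmic size at error
  \<open>b / 2 ^ j\<close> is of order \<open>4 ^ j\<close>, which cancels the gain
  \<open>1 / 4 ^ j\<close> in the squared increments of a chain, so all scales cost the same and
  \<open>J = O(ln n)\<close> scales cost a factor \<open>J\<close>. With the exponent
  \<open>k\<close> and with \<open>ln (2 m + 1)\<close> this makes four logarithms as long as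
  \<open>m\<close> is polynomial in \<open>n\<close>.

  The obstacle is that the sign estimate is linear in \<open>q\<close>, where \<open>q\<close>
  squared bounds the empirical second moment of all matrices at once, and that moment is what has to
  be controlled. The factor \<theta> in front of \<open>q\<close> is small, and \<open>q\<close> is
  at most linear in the deviations of the two samples; so a deviation on one sample is bounded by a
  small multiple of that on the other, plus a small constant.

  Suprema over uncountably many matrices are avoided for the sake of measurability: the process has
  a countable index type, and a dense sequence suffices by continuity.\<close>

definition ip :: "nat \<Rightarrow> (nat \<Rightarrow> real) \<Rightarrow> (nat \<Rightarrow> real) \<Rightarrow> real" where
  "ip n x y = (\<Sum>i<n. x i * y i)"

definition mv :: "nat \<Rightarrow> (nat \<Rightarrow> nat \<Rightarrow> real) \<Rightarrow> (nat \<Rightarrow> real) \<Rightarrow> nat \<Rightarrow> real" where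
  "mv n A x = (\<lambda>i. \<Sum>j<n. A i j * x j)"

lemma ip_commute: "ip n x y = ip n y x"
  by (simp add: ip_def mult.commute)

lemma ip_add_left: "ip n (\<lambda>i. x i + y i) z = ip n x z + ip n y z"
  by (simp add: ip_def algebra_simps sum.distrib)

lemma ip_diff_left: "ip n (\<lambda>i. x i - y i) z = ip n x z - ip n y z"
  by (simp add: ip_def algebra_simps sum_subtractf)

lemma ip_scale_left: "ip n (\<lambda>i. c * x i) z = c * ip n x z"
  by (simp add: ip_def sum_distrib_left mult.assoc)

lemma ip_sum_left: "ip n (\<lambda>i. \<Sum>k\<in>S. f k i) z = (\<Sum>k\<in>S. ip n (f k) z)"
  unfolding ip_def sum_distrib_right by (rule sum.swap)

lemma ip_add_right: "ip n z (\<lambda>i. x i + y i) = ip n z x + ip n z y"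
  by (simp add: ip_def algebra_simps sum.distrib)

lemma ip_diff_right: "ip n z (\<lambda>i. x i - y i) = ip n z x - ip n z y"
  by (simp add: ip_def algebra_simps sum_subtractf)

lemma ip_scale_right: "ip n z (\<lambda>i. c * x i) = c * ip n z x"
  by (simp add: ip_def sum_distrib_left algebra_simps)

lemma ip_sum_right: "ip n z (\<lambda>i. \<Sum>k\<in>S. f k i) = (\<Sum>k\<in>S. ip n z (f k))"
  unfolding ip_def sum_distrib_left by (rule sum.swap)

lemmas ip_linear = ip_add_left ip_diff_left ip_scale_left ip_sum_left
  ip_add_right ip_diff_right ip_scale_right ip_sum_right

lemma ip_cong: "(\<And>i. i < n \<Longrightarrow> x i = x' i) \<Longrightarrow> (\<And>i. i < n \<Longrightarrow> y i = y' i) \<Longrightarrow> ip n x y = ip n x' y'"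
  by (simp add: ip_def)

lemma ip_self_nonneg [simp]: "0 \<le> ip n x x"
  by (simp add: ip_def sum_nonneg)

lemma ip_self_eq_0: "ip n x x = 0 \<longleftrightarrow> (\<forall>i<n. x i = 0)"
  by (auto simp: ip_def sum_nonneg_eq_0_iff)

lemma vnorm_ip: "vnorm n x = sqrt (ip n x x)"
  by (simp add: vnorm_def ip_def power2_eq_square)

lemma vnorm_power2: "(vnorm n x)\<^sup>2 = ip n x x"
  by (simp add: vnorm_ip)

lemma vnorm_nonneg [simp]: "0 \<le> vnorm n x"
  by (simp add: vnorm_ip)

lemma ip_Cauchy_Schwarz: "\<bar>ip n x y\<bar> \<le> vnorm n x * vnorm n y"
proof -
  have "(ip n x y)\<^sup>2 \<le> (\<Sum>i<n. (x i)\<^sup>2) * (\<Sum>i<n. (y i)\<^sup>2)"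
    unfolding ip_def by (rule Cauchy_Schwarz_ineq_sum)
  then have "sqrt ((ip n x y)\<^sup>2) \<le> sqrt ((\<Sum>i<n. (x i)\<^sup>2) * (\<Sum>i<n. (y i)\<^sup>2))"
    by (rule real_sqrt_le_mono)
  then show ?thesis by (simp add: vnorm_def real_sqrt_mult)
qed

lemma ip_mv_symmetric:
  assumes "\<And>i j. i < n \<Longrightarrow> j < n \<Longrightarrow> A i j = A j i"
  shows "ip n x (mv n A y) = ip n (mv n A x) y"
proof -
  have "ip n x (mv n A y) = (\<Sum>i<n. \<Sum>j<n. x i * A i j * y j)"
    by (simp add: ip_def mv_def sum_distrib_left mult.assoc)
  also have "\<dots> = (\<Sum>j<n. \<Sum>i<n. x i * A i j * y j)" by (rule sum.swap)
  also have "\<dots> = (\<Sum>j<n. \<Sum>i<n. A j i * x i * y j)"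
    by (intro sum.cong refl) (auto simp: assms mult.commute)
  finally show ?thesis by (simp add: ip_def mv_def sum_distrib_right)
qed

lemma mv_add: "mv n A (\<lambda>i. x i + y i) = (\<lambda>i. mv n A x i + mv n A y i)"
  by (simp add: mv_def algebra_simps sum.distrib)

lemma mv_scale: "mv n A (\<lambda>i. c * x i) = (\<lambda>i. c * mv n A x i)"
  by (simp add: mv_def sum_distrib_left algebra_simps)

section \<open>Orthonormal families: Bessel defects and completeness\<close>

definition orthonormal_on :: "nat \<Rightarrow> nat set \<Rightarrow> (nat \<Rightarrow> nat \<Rightarrow> real) \<Rightarrow> bool" where
  "orthonormal_on n S e \<longleftrightarrow> (\<forall>k\<in>S. \<forall>l\<in>S. ip n (e k) (e l) = (if k = l then 1 else 0))"

lemma Bessel_expand: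
  assumes "orthonormal_on n S e" "finite S"
  shows "ip n (\<lambda>i. x i - (\<Sum>k\<in>S. ip n (e k) x * e k i)) (\<lambda>i. x i - (\<Sum>k\<in>S. ip n (e k) x * e k i))
     = ip n x x - (\<Sum>k\<in>S. (ip n (e k) x)\<^sup>2)"
proof -
  have "(\<Sum>k\<in>S. ip n (e k) x * (\<Sum>l\<in>S. ip n (e l) x * ip n (e k) (e l))) = (\<Sum>k\<in>S. (ip n (e k) x)\<^sup>2)"
  proof (rule sum.cong[OF refl])
    fix k assume k: "k \<in> S"
    have "(\<Sum>l\<in>S. ip n (e l) x * ip n (e k) (e l)) = (\<Sum>l\<in>S. if l = k then ip n (e l) x else 0)"
      using assms k by (intro sum.cong) (auto simp: orthonormal_on_def)
    also have "\<dots> = ip n (e k) x" using k assms by simp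
    finally show "ip n (e k) x * (\<Sum>l\<in>S. ip n (e l) x * ip n (e k) (e l)) = (ip n (e k) x)\<^sup>2"
      by (simp add: power2_eq_square)
  qed
  moreover have "ip n (\<lambda>i. x i - (\<Sum>k\<in>S. ip n (e k) x * e k i)) (\<lambda>i. x i - (\<Sum>k\<in>S. ip n (e k) x * e k i))
     = ip n x x - (\<Sum>k\<in>S. (ip n (e k) x)\<^sup>2) - ((\<Sum>k\<in>S. (ip n (e k) x)\<^sup>2)
       - (\<Sum>k\<in>S. ip n (e k) x * (\<Sum>l\<in>S. ip n (e l) x * ip n (e k) (e l))))"
    unfolding ip_linear by (simp add: ip_commute[of n x "e _"] power2_eq_square sum_subtractf right_diff_distrib)
  ultimately show ?thesis by simp
qed

lemma Bessel:
  assumes "orthonormal_on n S e" "finite S"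
  shows "(\<Sum>k\<in>S. (ip n (e k) x)\<^sup>2) \<le> ip n x x"
  using ip_self_nonneg[of n "\<lambda>i. x i - (\<Sum>k\<in>S. ip n (e k) x * e k i)"]
  unfolding Bessel_expand[OF assms] by simp

definition std :: "nat \<Rightarrow> nat \<Rightarrow> real" where
  "std i = (\<lambda>j. if j = i then 1 else 0)"

lemma ip_std: "i < n \<Longrightarrow> ip n x (std i) = x i"
  by (simp add: ip_def std_def if_distrib cong: if_cong)

text \<open>The summand is the squared distance of the unit vector \<open>std i\<close> from the
  span (\<open>Bessel_std\<close>), so the sum is the trace of the projection onto the complement.
  It replaces dimension theory: a zero sum gives completeness, a positive one a vector outside the
  span.\<close>

lemma sum_Bessel_defects:
  assumes "orthonormal_on n S e" "finite S"
  shows "(\<Sum>i<n. 1 - (\<Sum>k\<in>S. (e k i)\<^sup>2)) = real n - real (card S)"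
proof -
  have "(\<Sum>i<n. \<Sum>k\<in>S. (e k i)\<^sup>2) = (\<Sum>k\<in>S. ip n (e k) (e k))"
    unfolding ip_def power2_eq_square by (rule sum.swap)
  also have "\<dots> = real (card S)" using assms by (simp add: orthonormal_on_def)
  finally show ?thesis by (simp add: sum_subtractf)
qed

lemma Bessel_std:
  assumes "orthonormal_on n S e" "finite S" "i < n"
  shows "ip n (\<lambda>j. std i j - (\<Sum>k\<in>S. e k i * e k j)) (\<lambda>j. std i j - (\<Sum>k\<in>S. e k i * e k j))
     = 1 - (\<Sum>k\<in>S. (e k i)\<^sup>2)"
  using Bessel_expand[OF assms(1,2), of "std i"] ip_std[OF assms(3)] by (simp add: std_def)

text \<open>For \<open>n\<close> vectors the nonnegative Bessel defects add up to 0, so every unit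
  vector equals its own expansion.\<close>

lemma orthonormal_complete:
  assumes "orthonormal_on n {..<n} e" "i < n" "j < n"
  shows "(\<Sum>k<n. e k i * e k j) = (if i = j then 1 else 0)"
proof -
  have nn: "0 \<le> 1 - (\<Sum>k<n. (e k i)\<^sup>2)" if "i < n" for i
    by (simp only: Bessel_std[OF assms(1) finite_lessThan that, symmetric] ip_self_nonneg)
  have "(\<Sum>i<n. 1 - (\<Sum>k<n. (e k i)\<^sup>2)) = 0"
    using sum_Bessel_defects[OF assms(1)] by simp
  then have "1 - (\<Sum>k<n. (e k i)\<^sup>2) = 0"
    using nn assms(2) by (subst (asm) sum_nonneg_eq_0_iff) auto
  then have "ip n (\<lambda>j. std i j - (\<Sum>k<n. e k i * e k j)) (\<lambda>j. std i j - (\<Sum>k<n. e k i * e k j)) = 0"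
    using Bessel_std[OF assms(1) finite_lessThan assms(2)] by simp
  then show ?thesis using assms(3) unfolding ip_self_eq_0 by (auto simp: std_def)
qed

lemma Parseval:
  assumes "orthonormal_on n {..<n} e"
  shows "(\<Sum>k<n. ip n (e k) x * ip n (e k) y) = ip n x y"
proof -
  have "(\<Sum>k<n. ip n (e k) x * ip n (e k) y) = (\<Sum>k<n. \<Sum>i<n. \<Sum>j<n. e k i * e k j * (x i * y j))"
    by (simp add: ip_def sum_product algebra_simps)
  also have "\<dots> = (\<Sum>i<n. \<Sum>k<n. \<Sum>j<n. e k i * e k j * (x i * y j))" by (rule sum.swap)
  also have "\<dots> = (\<Sum>i<n. \<Sum>j<n. \<Sum>k<n. e k i * e k j * (x i * y j))" by (intro sum.cong refl sum.swap)
  also have "\<dots> = (\<Sum>i<n. \<Sum>j<n. if j = i then x i * y j else 0)"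
    by (intro sum.cong refl) (auto simp: sum_distrib_right[symmetric] orthonormal_complete[OF assms])
  also have "\<dots> = ip n x y" by (simp add: ip_def)
  finally show ?thesis .
qed

text \<open>Fewer than \<open>n\<close> vectors leave a positive total defect, hence some
  \<open>std i\<close> outside the span; its residual is normalised. Zeros beyond \<open>n\<close>
  place the vector in the compact set over which \<open>exists_next_eigenvector\<close>
  maximises.\<close>

lemma exists_unit_orthogonal:
  assumes "orthonormal_on n {..<k} e" "k < n"
  shows "\<exists>x. ip n x x = 1 \<and> (\<forall>l<k. ip n (e l) x = 0) \<and> (\<forall>i\<ge>n. x i = 0)"
proof -
  have "\<exists>i<n. 0 < 1 - (\<Sum>l<k. (e l i)\<^sup>2)"
  proof (rule ccontr)
    assume "\<not> ?thesis"
    then have "\<forall>i<n. 1 - (\<Sum>l<k. (e l i)\<^sup>2) \<le> 0" by (meson not_less)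
    then have "(\<Sum>i<n. 1 - (\<Sum>l<k. (e l i)\<^sup>2)) \<le> 0" by (intro sum_nonpos) auto
    then show False using sum_Bessel_defects[OF assms(1)] assms(2) by simp
  qed
  then obtain i where i: "i < n" and pos: "0 < 1 - (\<Sum>l<k. (e l i)\<^sup>2)" by blast
  define z where "z = (\<lambda>j. std i j - (\<Sum>l<k. e l i * e l j))"
  define c where "c = 1 - (\<Sum>l<k. (e l i)\<^sup>2)"
  have zz: "ip n z z = c" unfolding z_def c_def by (rule Bessel_std[OF assms(1) finite_lessThan i])
  have zo: "ip n (e l) z = 0" if "l < k" for l
  proof -
    have "ip n (e l) z = e l i - (\<Sum>m<k. e m i * ip n (e l) (e m))"
      unfolding z_def by (simp add: ip_linear ip_std[OF i])
    also have "(\<Sum>m<k. e m i * ip n (e l) (e m)) = (\<Sum>m<k. if m = l then e m i else 0)"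
      using assms(1) that by (intro sum.cong) (auto simp: orthonormal_on_def)
    finally show ?thesis using that by simp
  qed
  define x where "x = (\<lambda>j. if j < n then 1 / sqrt c * z j else 0)"
  have xe: "ip n y x = 1 / sqrt c * ip n y z" for y
    unfolding ip_scale_right[symmetric] by (rule ip_cong) (auto simp: x_def)
  have "ip n x x = 1"
    using pos xe[of x] xe[of z] zz by (simp add: ip_commute[of n x z] c_def[symmetric])
  moreover have "\<forall>l<k. ip n (e l) x = 0" by (simp add: xe zo)
  ultimately show ?thesis by (intro exI[of _ x]) (simp add: x_def)
qed

section \<open>Spectral theorem for symmetric matrices\<close>

lemma quadratic_nonpos_imp_zero:
  fixes a b :: real
  assumes "\<And>t. 2 * t * a + t\<^sup>2 * b \<le> 0"
  shows "a = 0"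
proof (rule ccontr)
  assume a: "a \<noteq> 0"
  \<comment> \<open>Near 0 the linear term wins; \<open>t = a / c\<close> is close enough, because
    \<open>2 * c + b > 0\<close>.\<close>
  define c where "c = \<bar>b\<bar> + 1"
  have c: "c > 0" by (simp add: c_def)
  have "2 * (a / c) * a + (a / c)\<^sup>2 * b \<le> 0" by (rule assms)
  moreover have "2 * (a / c) * a + (a / c)\<^sup>2 * b = a\<^sup>2 / c\<^sup>2 * (2 * c + b)"
    using c by (simp add: field_simps power2_eq_square)
  moreover have "a\<^sup>2 / c\<^sup>2 * (2 * c + b) > 0"
    using a by (intro mult_pos_pos) (auto simp: c_def)
  ultimately show False by linarith
qed

lemma continuous_on_ip [continuous_intros]:
  fixes f g :: "'a::topological_space \<Rightarrow> nat \<Rightarrow> real"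
  assumes "\<And>i. i < n \<Longrightarrow> continuous_on T (\<lambda>x. f x i)" "\<And>i. i < n \<Longrightarrow> continuous_on T (\<lambda>x. g x i)"
  shows "continuous_on T (\<lambda>x. ip n (f x) (g x))"
  unfolding ip_def by (intro continuous_intros) (use assms in auto)

text \<open>The quadratic form attains its maximum over the unit vectors orthogonal to the earlier
  eigenvectors, and the first variation at a maximiser is the eigenvector equation.\<close>

lemma exists_next_eigenvector:
  assumes sym: "\<And>i j. i < n \<Longrightarrow> j < n \<Longrightarrow> A i j = A j i"
    and on: "orthonormal_on n {..<k} e" and k: "k < n"
    and ev: "\<And>l i. l < k \<Longrightarrow> i < n \<Longrightarrow> mv n A (e l) i = \<mu> l * e l i"
  shows "\<exists>x \<nu>. ip n x x = 1 \<and> (\<forall>l<k. ip n (e l) x = 0) \<and> (\<forall>i<n. mv n A x i = \<nu> * x i)"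
proof -
  define C where "C = {x. ip n x x = 1 \<and> (\<forall>l<k. ip n (e l) x = 0) \<and> (\<forall>i\<ge>n. x i = 0)}"
  have cl: "closed C"
  proof -
    have "C = {x. ip n x x = 1} \<inter> (\<Inter>l\<in>{..<k}. {x. ip n (e l) x = 0}) \<inter> (\<Inter>i\<in>{n..}. {x. x i = 0})"
      by (auto simp: C_def)
    moreover have "closed \<dots>"
      by (intro closed_Int closed_INT ballI closed_Collect_eq continuous_intros continuous_on_product_coordinates)
    ultimately show ?thesis by simp
  qed
  \<comment> \<open>Vectors are functions on all of \<open>nat\<close>, so compactness comes from
    Tychonoff's theorem for the cube that contains the closed set \<open>C\<close>.\<close>
  have "compactin (product_topology (\<lambda>_. euclidean) UNIV) (PiE UNIV (\<lambda>_::nat. {-1..1::real}))"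
    by (simp add: compactin_PiE)
  then have "compact (PiE UNIV (\<lambda>_::nat. {-1..1::real}))"
    by (simp add: euclidean_product_topology)
  moreover have "C \<subseteq> PiE UNIV (\<lambda>_::nat. {-1..1::real})"
  proof
    fix x assume x: "x \<in> C"
    have "\<bar>x i\<bar> \<le> 1" for i
    proof (cases "i < n")
      case True
      have "(x i)\<^sup>2 \<le> ip n x x"
        unfolding ip_def power2_eq_square using True by (intro member_le_sum) auto
      then show ?thesis using x by (simp add: C_def abs_square_le_1)
    qed (use x in \<open>auto simp: C_def\<close>)
    then show "x \<in> PiE UNIV (\<lambda>_::nat. {-1..1::real})" by (auto simp: abs_le_iff minus_le_iff)
  qed
  ultimately have "compact C" using cl compact_Int_closed[of "PiE UNIV (\<lambda>_::nat. {-1..1::real})" C] by (simp add: inf.absorb2)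
  moreover have "C \<noteq> {}" using exists_unit_orthogonal[OF on k] by (auto simp: C_def)
  moreover have "continuous_on C (\<lambda>x. ip n x (mv n A x))"
    unfolding mv_def by (intro continuous_intros continuous_on_subset[OF continuous_on_product_coordinates]) auto
  ultimately obtain x where x: "x \<in> C" and max: "\<And>y. y \<in> C \<Longrightarrow> ip n y (mv n A y) \<le> ip n x (mv n A x)"
    using continuous_attains_sup[of C "\<lambda>x. ip n x (mv n A x)"] by blast
  define \<nu> where "\<nu> = ip n x (mv n A x)"
  have x1: "ip n x x = 1" and xo: "\<And>l. l < k \<Longrightarrow> ip n (e l) x = 0" using x by (auto simp: C_def)
  \<comment> \<open>The homogeneous form of maximality, which admits perturbations
    \<open>x + t y\<close> without renormalising them.\<close>
  have hom: "ip n y (mv n A y) \<le> \<nu> * ip n y y" if yo: "\<And>l. l < k \<Longrightarrow> ip n (e l) y = 0" for y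
  proof (cases "ip n y y = 0")
    case True
    then have "ip n y (mv n A y) = 0" unfolding ip_self_eq_0 by (simp add: ip_def)
    then show ?thesis using True by simp
  next
    case False
    define c where "c = sqrt (ip n y y)"
    have c: "c > 0" using False ip_self_nonneg[of n y] by (simp add: c_def order.strict_iff_order)
    define y' where "y' = (\<lambda>i. if i < n then 1 / c * y i else 0)"
    have e1: "ip n z y' = 1 / c * ip n z y" for z
      unfolding ip_scale_right[symmetric] by (rule ip_cong) (auto simp: y'_def)
    have e2: "mv n A y' = (\<lambda>i. 1 / c * mv n A y i)"
      unfolding mv_scale[symmetric] by (auto simp: y'_def mv_def)
    have "ip n y' y' = 1" using e1[of y'] e1[of y] c
      by (simp add: ip_commute[of n y' y]) (simp add: c_def)
    then have "y' \<in> C" using yo by (auto simp: C_def e1) (simp add: y'_def)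
    then have "ip n y' (mv n A y') \<le> \<nu>" using max by (simp add: \<nu>_def)
    also have "ip n y' (mv n A y') = ip n y (mv n A y) / c\<^sup>2"
      unfolding e2 ip_scale_right ip_commute[of n y' "mv n A y"] e1 by (simp add: ip_commute[of n y] power2_eq_square)
    finally show ?thesis using c by (simp add: field_simps c_def)
  qed
  \<comment> \<open>By symmetry the eigen-residual is again orthogonal to the earlier eigenvectors,
    so it is an admissible direction; the variation along it is twice its own squared norm and has
    to vanish.\<close>
  define y where "y = (\<lambda>i. mv n A x i - \<nu> * x i)"
  have yo: "ip n (e l) y = 0" if "l < k" for l
  proof -
    have "ip n (e l) (mv n A x) = ip n (mv n A (e l)) x" by (rule ip_mv_symmetric[OF sym])
    also have "\<dots> = ip n (\<lambda>i. \<mu> l * e l i) x" by (rule ip_cong) (auto simp: ev that)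
    also have "\<dots> = 0" using xo[OF that] by (simp add: ip_scale_left)
    finally show ?thesis using xo[OF that] by (simp add: y_def ip_linear)
  qed
  have "2 * t * ip n y y + t\<^sup>2 * (ip n y (mv n A y) - \<nu> * ip n y y) \<le> 0" for t
  proof -
    have "ip n (\<lambda>i. x i + t * y i) (mv n A (\<lambda>i. x i + t * y i))
        \<le> \<nu> * ip n (\<lambda>i. x i + t * y i) (\<lambda>i. x i + t * y i)"
      by (rule hom) (simp add: ip_linear xo yo)
    moreover have "ip n x (mv n A y) = ip n y (mv n A x)"
      using ip_mv_symmetric[of n A x y, OF sym] by (simp add: ip_commute[of n y])
    moreover have "ip n y (mv n A x) = ip n y y + \<nu> * ip n x y"
      by (subst (3) y_def) (simp add: ip_linear ip_commute[of n x y])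
    ultimately show ?thesis
      using x1 unfolding mv_add mv_scale ip_linear \<nu>_def[symmetric] ip_commute[of n y x]
      by (simp add: power2_eq_square algebra_simps)
  qed
  then have "ip n y y = 0" by (rule quadratic_nonpos_imp_zero)
  then have "\<forall>i<n. mv n A x i = \<nu> * x i" unfolding ip_self_eq_0 by (simp add: y_def)
  then show ?thesis using x1 xo by blast
qed

theorem symmetric_eigenbasis:
  assumes sym: "\<And>i j. i < n \<Longrightarrow> j < n \<Longrightarrow> A i j = A j i"
  obtains e \<mu> where "orthonormal_on n {..<n} e"
    "\<And>l i. l < n \<Longrightarrow> i < n \<Longrightarrow> mv n A (e l) i = \<mu> l * e l i"
    "\<And>i j. i < n \<Longrightarrow> j < n \<Longrightarrow> A i j = (\<Sum>l<n. \<mu> l * e l i * e l j)"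
proof -
  have "\<exists>e \<mu>. orthonormal_on n {..<k} e \<and> (\<forall>l<k. \<forall>i<n. mv n A (e l) i = \<mu> l * e l i)" if "k \<le> n" for k
    using that
  proof (induction k)
    case 0
    show ?case by (simp add: orthonormal_on_def)
  next
    case (Suc k)
    then obtain e \<mu> where e: "orthonormal_on n {..<k} e" "\<forall>l<k. \<forall>i<n. mv n A (e l) i = \<mu> l * e l i"
      by auto
    obtain x \<nu> where x: "ip n x x = 1" "\<forall>l<k. ip n (e l) x = 0" "\<forall>i<n. mv n A x i = \<nu> * x i"
      using exists_next_eigenvector[of n A k e \<mu>, OF sym e(1)] e(2) Suc.prems by auto
    have "orthonormal_on n {..<Suc k} (e(k := x))"
      using e(1) x by (auto simp: orthonormal_on_def less_Suc_eq ip_commute[of n x "e _"])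
    moreover have "\<forall>l<Suc k. \<forall>i<n. mv n A ((e(k := x)) l) i = (\<mu>(k := \<nu>)) l * (e(k := x)) l i"
      using e(2) x(3) by (auto simp: less_Suc_eq)
    ultimately show ?case by blast
  qed
  from this[of n] obtain e \<mu> where e: "orthonormal_on n {..<n} e"
    "\<forall>l<n. \<forall>i<n. mv n A (e l) i = \<mu> l * e l i" by auto
  have "A i j = (\<Sum>l<n. \<mu> l * e l i * e l j)" if i: "i < n" and j: "j < n" for i j
  proof -
    have "(\<Sum>l<n. \<mu> l * e l i * e l j) = (\<Sum>l<n. mv n A (e l) i * e l j)" using e(2) i by simp
    also have "\<dots> = (\<Sum>m<n. A i m * (\<Sum>l<n. e l m * e l j))"
      unfolding mv_def sum_distrib_left sum_distrib_right mult.assoc by (rule sum.swap)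
    also have "\<dots> = (\<Sum>m<n. if m = j then A i m else 0)"
      using orthonormal_complete[OF e(1) _ j] by (intro sum.cong) auto
    finally show ?thesis using j by simp
  qed
  then show ?thesis using that e by blast
qed

subsection \<open>Singular values and the nuclear norm\<close>

text \<open>A spectral norm bound as a bilinear estimate. It passes to transposes, multiples and
  dilations without any supremum.\<close>

definition op_le :: "nat \<Rightarrow> real \<Rightarrow> (nat \<Rightarrow> nat \<Rightarrow> real) \<Rightarrow> bool" where
  "op_le n c A \<longleftrightarrow> (\<forall>x y. ip n x (mv n A y) \<le> c * vnorm n x * vnorm n y)"

lemma op_leD: "op_le n c A \<Longrightarrow> ip n x (mv n A y) \<le> c * vnorm n x * vnorm n y"
  by (simp add: op_le_def)

lemma op_le_vnorm_mv:
  assumes "op_le n c A" "0 \<le> c"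
  shows "vnorm n (mv n A y) \<le> c * vnorm n y"
proof (cases "vnorm n (mv n A y) = 0")
  case False
  have "vnorm n (mv n A y) * vnorm n (mv n A y) \<le> c * vnorm n y * vnorm n (mv n A y)"
    using op_leD[OF assms(1), of "mv n A y" y] vnorm_power2[of n "mv n A y"]
    by (simp add: power2_eq_square mult.commute mult.left_commute)
  moreover have "vnorm n (mv n A y) > 0" using False vnorm_nonneg[of n "mv n A y"] by linarith
  ultimately show ?thesis by simp
qed (use assms in simp)

lemma mv_diff: "mv n A (\<lambda>i. x i - y i) = (\<lambda>i. mv n A x i - mv n A y i)"
  by (simp add: mv_def algebra_simps sum_subtractf)

lemma mv_sum: "mv n A (\<lambda>i. \<Sum>k\<in>S. f k i) = (\<lambda>i. \<Sum>k\<in>S. mv n A (f k) i)"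
  unfolding mv_def sum_distrib_left by (intro ext, subst sum.swap) (rule refl)

lemma ip_mv_transpose: "ip n x (mv n A y) = ip n (mv n (\<lambda>i j. A j i) x) y"
proof -
  have "ip n x (mv n A y) = (\<Sum>i<n. \<Sum>j<n. x i * A i j * y j)"
    by (simp add: ip_def mv_def sum_distrib_left mult.assoc)
  also have "\<dots> = (\<Sum>j<n. \<Sum>i<n. x i * A i j * y j)" by (rule sum.swap)
  also have "\<dots> = ip n (mv n (\<lambda>i j. A j i) x) y"
    by (simp add: ip_def mv_def sum_distrib_right mult.commute[of "x _" "A _ _"])
  finally show ?thesis .
qed

lemma op_le_transpose:
  assumes "op_le n c A"
  shows "op_le n c (\<lambda>i j. A j i)"
  unfolding op_le_def
proof (intro allI)
  fix x y
  have "ip n x (mv n (\<lambda>i j. A j i) y) = ip n y (mv n A x)"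
    unfolding ip_mv_transpose[of n y] by (rule ip_commute)
  then show "ip n x (mv n (\<lambda>i j. A j i) y) \<le> c * vnorm n x * vnorm n y"
    using op_leD[OF assms, of y x] by (simp add: mult.commute mult.left_commute)
qed

section \<open>Trace inner product and Frobenius norm\<close>

lemma minner_ip: "minner n A X = (\<Sum>i<n. ip n (A i) (X i))"
  by (simp add: minner_def ip_def)

lemma minner_add_left: "minner n (\<lambda>i j. A i j + B i j) X = minner n A X + minner n B X"
  by (simp add: minner_def algebra_simps sum.distrib)

lemma minner_add_right: "minner n X (\<lambda>i j. A i j + B i j) = minner n X A + minner n X B"
  by (simp add: minner_def algebra_simps sum.distrib)

lemma minner_diff_left: "minner n (\<lambda>i j. A i j - B i j) X = minner n A X - minner n B X"
  by (simp add: minner_def algebra_simps sum_subtractf)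

lemma minner_diff_right: "minner n X (\<lambda>i j. A i j - B i j) = minner n X A - minner n X B"
  by (simp add: minner_def algebra_simps sum_subtractf)

lemma minner_scale_left: "minner n (\<lambda>i j. c * A i j) X = c * minner n A X"
  by (simp add: minner_def sum_distrib_left mult.assoc)

lemma minner_scale_right: "minner n X (\<lambda>i j. c * A i j) = c * minner n X A"
  by (simp add: minner_def sum_distrib_left algebra_simps)

lemma frob_power2: "(frob n X)\<^sup>2 = minner n X X"
  by (simp add: frob_def minner_def power2_eq_square sum_nonneg)

lemma frob_nonneg [simp]: "0 \<le> frob n X"
  by (simp add: frob_def sum_nonneg)

lemma frob_scale: "frob n (\<lambda>i j. c * X i j) = \<bar>c\<bar> * frob n X"
proof (rule power2_eq_imp_eq)
  show "(frob n (\<lambda>i j. c * X i j))\<^sup>2 = (\<bar>c\<bar> * frob n X)\<^sup>2"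
    unfolding power_mult_distrib frob_power2 minner_scale_left minner_scale_right
    by (simp add: power2_eq_square)
qed simp_all

lemma minner_Cauchy_Schwarz: "\<bar>minner n A X\<bar> \<le> frob n A * frob n X"
proof -
  have "(\<Sum>(i, j)\<in>{..<n} \<times> {..<n}. A i j * X i j)\<^sup>2
      \<le> (\<Sum>(i, j)\<in>{..<n} \<times> {..<n}. (A i j)\<^sup>2) * (\<Sum>(i, j)\<in>{..<n} \<times> {..<n}. (X i j)\<^sup>2)"
    using Cauchy_Schwarz_ineq_sum[of "\<lambda>p. A (fst p) (snd p)" "\<lambda>p. X (fst p) (snd p)" "{..<n} \<times> {..<n}"]
    by (simp add: case_prod_unfold)
  then have "(minner n A X)\<^sup>2 \<le> (frob n A * frob n X)\<^sup>2"
    unfolding power_mult_distrib frob_power2 by (simp add: minner_def power2_eq_square sum.cartesian_product)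
  then show ?thesis using abs_le_square_iff[of "minner n A X" "frob n A * frob n X"] by simp
qed

lemma minner_rank_one_sum:
  assumes "\<And>i j. i < n \<Longrightarrow> j < n \<Longrightarrow> X i j = (\<Sum>k\<in>S. s k * u k i * v k j)"
  shows "minner n W X = (\<Sum>k\<in>S. s k * ip n (u k) (mv n W (v k)))"
proof -
  have "minner n W X = (\<Sum>i<n. \<Sum>j<n. \<Sum>k\<in>S. s k * (u k i * (W i j * v k j)))"
    unfolding minner_def by (intro sum.cong refl) (simp add: assms sum_distrib_left algebra_simps)
  also have "\<dots> = (\<Sum>i<n. \<Sum>k\<in>S. \<Sum>j<n. s k * (u k i * (W i j * v k j)))"
    by (intro sum.cong refl sum.swap)
  also have "\<dots> = (\<Sum>k\<in>S. \<Sum>i<n. \<Sum>j<n. s k * (u k i * (W i j * v k j)))" by (rule sum.swap)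
  finally show ?thesis by (simp add: ip_def mv_def sum_distrib_left)
qed

lemma frob_sum_orthonormal:
  assumes "orthonormal_on n S v" "finite S"
  shows "(frob n (\<lambda>i j. \<Sum>k\<in>S. z k i * v k j))\<^sup>2 = (\<Sum>k\<in>S. ip n (z k) (z k))"
proof -
  let ?X = "\<lambda>i j. \<Sum>k\<in>S. z k i * v k j"
  have mv: "mv n ?X (v k) i = z k i" if "k \<in> S" for k i
  proof -
    have "mv n ?X (v k) i = (\<Sum>l\<in>S. z l i * ip n (v l) (v k))"
      unfolding mv_def ip_def sum_distrib_left sum_distrib_right mult.assoc by (rule sum.swap)
    also have "\<dots> = (\<Sum>l\<in>S. if l = k then z l i else 0)"
      using assms that by (intro sum.cong) (auto simp: orthonormal_on_def)
    finally show ?thesis using that assms by simp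
  qed
  have "minner n ?X ?X = (\<Sum>k\<in>S. 1 * ip n (z k) (mv n ?X (v k)))"
    by (rule minner_rank_one_sum) simp
  also have "\<dots> = (\<Sum>k\<in>S. ip n (z k) (z k))" by (intro sum.cong refl) (simp add: mv cong: ip_cong)
  finally show ?thesis by (simp add: frob_power2)
qed

lemma frob_transpose: "frob n (\<lambda>i j. X j i) = frob n X"
  unfolding frob_def by (subst sum.swap) (rule refl)

section \<open>Eigenvalue multiplicities and rank\<close>

lemma order_prod_linear:
  fixes \<mu> :: "'a \<Rightarrow> real"
  assumes "finite K"
  shows "Polynomial.order t (\<Prod>k\<in>K. [:- \<mu> k, 1:]) = card {k\<in>K. \<mu> k = t}"
  using assms
proof (induction K rule: finite_induct)
  case (insert k K)
  have 1: "Polynomial.order t [:- \<mu> k, 1:] = (if \<mu> k = t then 1 else 0)"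
  proof (cases "\<mu> k = t")
    case True
    then show ?thesis using order_power_n_n[of t 1] by simp
  next
    case False
    then show ?thesis by (simp add: order_0I)
  qed
  have "{k' \<in> insert k K. \<mu> k' = t} = (if \<mu> k = t then insert k {k'\<in>K. \<mu> k' = t} else {k'\<in>K. \<mu> k' = t})"
    by auto
  moreover have "Polynomial.order t ([:- \<mu> k, 1:] * (\<Prod>k\<in>K. [:- \<mu> k, 1:]))
      = Polynomial.order t [:- \<mu> k, 1:] + Polynomial.order t (\<Prod>k\<in>K. [:- \<mu> k, 1:])"
    by (rule order_mult) (use insert.hyps in \<open>simp add: prod_zero_iff del: mult_pCons_left\<close>)
  ultimately show ?case
    using insert 1 by simp
qed simp

text \<open>Turns a sum over distinct roots weighted by multiplicity, the form used in
  \<open>nuc_norm\<close>, into a sum over a list of eigenvalues.\<close>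

lemma sum_order_prod_linear:
  fixes \<mu> :: "'a \<Rightarrow> real"
  assumes "finite K" and p: "p = (\<Prod>k\<in>K. [:- \<mu> k, 1:])"
  shows "(\<Sum>t\<in>{x. poly p x = 0}. real (Polynomial.order t p) * f t) = (\<Sum>k\<in>K. f (\<mu> k))"
proof -
  have "{x. poly p x = 0} = \<mu> ` K" using assms(1) by (auto simp: p poly_prod)
  moreover have "(\<Sum>k\<in>K. f (\<mu> k)) = (\<Sum>t\<in>\<mu> ` K. \<Sum>k\<in>{k\<in>K. \<mu> k = t}. f (\<mu> k))"
    by (rule sum.image_gen[OF assms(1)])
  moreover have "\<dots> = (\<Sum>t\<in>\<mu> ` K. real (Polynomial.order t p) * f t)"
    unfolding p order_prod_linear[OF assms(1)] by (intro sum.cong refl) simp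
  ultimately show ?thesis by (simp only:)
qed

text \<open>The vectors \<open>e\<close> are the columns of an orthogonal matrix \<open>P\<close>
  with \<open>M = P * D * transpose_mat P\<close>, and similar matrices share their characteristic
  polynomial.\<close>

lemma char_poly_orthonormal_eigenbasis:
  assumes on: "orthonormal_on n {..<n} e" and M: "M \<in> carrier_mat n n"
    and A: "\<And>i j. i < n \<Longrightarrow> j < n \<Longrightarrow> M $$ (i, j) = (\<Sum>l<n. \<mu> l * e l i * e l j)"
  shows "char_poly M = (\<Prod>l<n. [:- \<mu> l, 1 :: real:])"
proof -
  define P where "P = Matrix.mat n n (\<lambda>(i, k). e k i)"
  define D where "D = Matrix.mat n n (\<lambda>(i, k). if i = k then \<mu> i else 0)"
  have PD: "P * D = Matrix.mat n n (\<lambda>(i, k). e k i * \<mu> k)"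
    by (rule eq_matI) (auto simp: P_def D_def scalar_prod_def if_distrib atLeast0LessThan cong: if_cong)
  have "similar_mat M D"
  proof (rule similar_matI[where P = P and Q = "transpose_mat P"])
    show "{M, D, P, transpose_mat P} \<subseteq> carrier_mat n n" using M by (auto simp: P_def D_def)
    show "P * transpose_mat P = 1\<^sub>m n"
      by (rule eq_matI) (auto simp: P_def scalar_prod_def atLeast0LessThan orthonormal_complete[OF on])
    show "transpose_mat P * P = 1\<^sub>m n"
      using on by (intro eq_matI) (auto simp: P_def scalar_prod_def atLeast0LessThan orthonormal_on_def ip_def)
    show "M = P * D * transpose_mat P"
      unfolding PD using M
      by (intro eq_matI) (auto simp: P_def scalar_prod_def atLeast0LessThan A mult.commute mult.left_commute)
  qed
  then have "char_poly M = char_poly D" by (rule char_poly_similar)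
  also have "\<dots> = (\<Prod>a\<leftarrow>diag_mat D. [:- a, 1:])"
    by (rule char_poly_upper_triangular[of _ n]) (auto simp: D_def)
  also have "diag_mat D = map \<mu> [0..<n]"
    by (auto simp: diag_mat_def D_def intro: nth_equalityI)
  finally show ?thesis
    by (simp add: comp_def interv_sum_list_conv_sum_set_nat prod.distinct_set_conv_list[symmetric] atLeast0LessThan)
qed

text \<open>Orthonormal vectors are independent, and these lie in the column space. The dimension of
  that space is read off from a maximal independent set among the columns and the given vectors,
  chosen to contain all of the latter.\<close>

lemma orthonormal_in_column_space_card_le:
  assumes on: "orthonormal_on n S u" and finS: "finite S"
    and col: "\<And>k i. k \<in> S \<Longrightarrow> i < n \<Longrightarrow> u k i = mv n X (w k) i"
  shows "card S \<le> mrank n X"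
proof -
  interpret vec_space "TYPE(real)" n .
  define A where "A = to_mat n X"
  have A: "A \<in> carrier_mat n n" by (simp add: A_def to_mat_def)
  have cols: "set (cols A) \<subseteq> carrier_vec n" using cols_dim A by blast
  define z where "z k = vec n (u k)" for k
  have zsp: "z k \<in> span (set (cols A))" if "k \<in> S" for k
  proof -
    have "z k = A *\<^sub>v vec n (w k)"
      using col[OF that] by (intro eq_vecI) (auto simp: z_def A_def to_mat_def mv_def scalar_prod_def atLeast0LessThan)
    also have "\<dots> = lincomb_list (w k) (cols A)"
      using A cols by (subst lincomb_list_as_mat_mult) (auto simp: mat_of_cols_cols)
    also have "\<dots> = lincomb (mk_coeff (cols A) (w k)) (set (cols A))"
      using cols by (rule lincomb_list_as_lincomb)
    finally show ?thesis by (auto simp: span_def)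
  qed
  have dot: "(\<Sum>i<n. z k $ i * z l $ i) = (if k = l then 1 else 0)" if "k \<in> S" "l \<in> S" for k l
    using on that by (simp add: z_def orthonormal_on_def ip_def)
  have inj: "inj_on z S"
  proof (rule inj_onI)
    fix k l assume "k \<in> S" "l \<in> S" "z k = z l"
    then show "k = l" using dot[of k l] dot[of l l] by (auto split: if_splits)
  qed
  have zc: "z ` S \<subseteq> carrier_vec n" by (auto simp: z_def)
  have li: "lin_indpt (z ` S)"
  proof
    assume "lin_dep (z ` S)"
    then obtain a y where a: "lincomb a (z ` S) = 0\<^sub>v n" "y \<in> z ` S" "a y \<noteq> 0"
      using finite_lin_dep[of "z ` S"] finite_imageI[OF finS] zc by auto
    then obtain l where l: "l \<in> S" "y = z l" by auto
    have 0: "(\<Sum>k\<in>S. a (z k) * z k $ i) = 0" if "i < n" for i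
    proof -
      have "lincomb a (z ` S) $ i = (\<Sum>x\<in>z ` S. a x * x $ i)" by (rule lincomb_index[OF that zc])
      then show ?thesis using a(1) that by (simp add: sum.reindex[OF inj])
    qed
    \<comment> \<open>Pairing the vanishing combination with \<open>z l\<close> isolates the
      coefficient of \<open>z l\<close>.\<close>
    have "0 = (\<Sum>i<n. (\<Sum>k\<in>S. a (z k) * z k $ i) * z l $ i)" using 0 by simp
    also have "\<dots> = (\<Sum>k\<in>S. a (z k) * (\<Sum>i<n. z k $ i * z l $ i))"
      unfolding sum_distrib_left sum_distrib_right mult.assoc by (rule sum.swap)
    also have "\<dots> = (\<Sum>k\<in>S. if k = l then a (z k) else 0)"
      by (intro sum.cong refl) (simp add: dot l)
    also have "\<dots> = a y" using l finS by simp
    finally show False using a by simp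
  qed
  let ?T = "set (cols A) \<union> z ` S"
  have Tc: "?T \<subseteq> carrier_vec n" and finT: "finite ?T" using cols zc finS by auto
  obtain B where B: "finite B" "maximal B (\<lambda>T. T \<subseteq> ?T \<and> lin_indpt T)" "z ` S \<subseteq> B"
    using maximal_exists_superset[of ?T "\<lambda>T. T \<subseteq> ?T \<and> lin_indpt T" "z ` S"] finT li by auto
  have "span ?T = span (set (cols A))"
  proof (rule antisym)
    have "?T \<subseteq> span (set (cols A))" using zsp in_own_span[of "set (cols A)"] cols by auto
    then show "span ?T \<subseteq> span (set (cols A))"
      by (rule span_is_subset) (use cols in \<open>auto intro: span_is_submodule\<close>)
  qed (rule span_is_monotone, blast)
  then have "rank A = card B" using dim_span[of ?T B] Tc finT B by (simp add: rank_def)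
  moreover have "card S = card (z ` S)" by (simp add: card_image inj)
  moreover have "card (z ` S) \<le> card B" using B by (intro card_mono) auto
  ultimately show ?thesis by (simp add: mrank_def A_def)
qed

text \<open>Only positive singular values are indexed: \<open>u k\<close> arises by division by
  \<open>s k\<close> and carries no information for other \<open>k\<close>.\<close>

definition svd_of :: "nat \<Rightarrow> (nat \<Rightarrow> nat \<Rightarrow> real) \<Rightarrow> (nat \<Rightarrow> real) \<Rightarrow> (nat \<Rightarrow> nat \<Rightarrow> real) \<Rightarrow> (nat \<Rightarrow> nat \<Rightarrow> real) \<Rightarrow> bool" where
  "svd_of n X s u v \<longleftrightarrow> (let S = {k. k < n \<and> 0 < s k} in
     orthonormal_on n S v \<and> orthonormal_on n S u \<and>
     (\<forall>i<n. \<forall>j<n. X i j = (\<Sum>k\<in>S. s k * u k i * v k j)) \<and>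
     nuc_norm n X = (\<Sum>k\<in>S. s k) \<and> (frob n X)\<^sup>2 = (\<Sum>k\<in>S. (s k)\<^sup>2) \<and> card S \<le> mrank n X)"

lemma svd_ofD:
  assumes "svd_of n X s u v"
  shows "orthonormal_on n {k. k < n \<and> 0 < s k} v" "orthonormal_on n {k. k < n \<and> 0 < s k} u"
    "\<And>i j. i < n \<Longrightarrow> j < n \<Longrightarrow> X i j = (\<Sum>k | k < n \<and> 0 < s k. s k * u k i * v k j)"
    "nuc_norm n X = (\<Sum>k | k < n \<and> 0 < s k. s k)"
    "(frob n X)\<^sup>2 = (\<Sum>k | k < n \<and> 0 < s k. (s k)\<^sup>2)"
    "card {k. k < n \<and> 0 < s k} \<le> mrank n X"
  using assms by (auto simp: svd_of_def Let_def)

lemma orthonormal_on_mono: "orthonormal_on n T e \<Longrightarrow> S \<subseteq> T \<Longrightarrow> orthonormal_on n S e"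
  unfolding orthonormal_on_def by blast

text \<open>The \<open>v k\<close> diagonalise the Gram matrix of \<open>X\<close>, and
  \<open>u k\<close> is \<open>X\<close> applied to \<open>v k\<close>, divided by
  \<open>s k\<close>. Since \<open>nuc_norm\<close> uses the characteristic polynomial of that Gram
  matrix, its summands are the roots of the same eigenvalues. Each \<open>u k\<close> lies in the
  column space of \<open>X\<close>, which bounds their number by the rank.\<close>

theorem singular_value_decomposition:
  "\<exists>s u v. svd_of n X s u v"
proof -
  define A where "A = (\<lambda>i j. \<Sum>a<n. X a i * X a j)"
  have sym: "A i j = A j i" for i j by (simp add: A_def mult.commute)
  obtain v \<mu> where on: "orthonormal_on n {..<n} v"
    and ev: "\<And>l i. l < n \<Longrightarrow> i < n \<Longrightarrow> mv n A (v l) i = \<mu> l * v l i"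
    and A: "\<And>i j. i < n \<Longrightarrow> j < n \<Longrightarrow> A i j = (\<Sum>l<n. \<mu> l * v l i * v l j)"
    using symmetric_eigenbasis[of n A] sym by blast
  have XX: "ip n (mv n X x) (mv n X y) = ip n x (mv n A y)" for x y
  proof -
    have "ip n (mv n X x) (mv n X y) = (\<Sum>a<n. \<Sum>i<n. \<Sum>j<n. x i * (X a i * X a j * y j))"
      by (simp add: ip_def mv_def sum_product algebra_simps)
    also have "\<dots> = (\<Sum>i<n. \<Sum>a<n. \<Sum>j<n. x i * (X a i * X a j * y j))" by (rule sum.swap)
    also have "\<dots> = (\<Sum>i<n. \<Sum>j<n. \<Sum>a<n. x i * (X a i * X a j * y j))" by (intro sum.cong refl sum.swap)
    also have "\<dots> = ip n x (mv n A y)" by (simp add: ip_def mv_def A_def sum_distrib_left sum_distrib_right)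
    finally show ?thesis .
  qed
  have XXv: "ip n (mv n X (v k)) (mv n X (v l)) = (if k = l then \<mu> k else 0)" if "k < n" "l < n" for k l
  proof -
    have "ip n (v k) (mv n A (v l)) = ip n (v k) (\<lambda>i. \<mu> l * v l i)"
      by (rule ip_cong) (auto simp: ev that)
    then show ?thesis using on that by (simp add: XX ip_scale_right orthonormal_on_def)
  qed
  have mu: "0 \<le> \<mu> k" if "k < n" for k using XXv[OF that that] ip_self_nonneg[of n "mv n X (v k)"] by simp
  define s where "s k = sqrt (\<mu> k)" for k
  define u where "u k = (\<lambda>i. 1 / s k * mv n X (v k) i)" for k
  have s0: "0 \<le> s k" if "k < n" for k using mu[OF that] by (simp add: s_def)
  have spos: "0 < s k \<longleftrightarrow> 0 < \<mu> k" for k by (simp add: s_def)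
  have ss: "s k * s k = \<mu> k" if "k < n" for k using mu[OF that] by (simp add: s_def)
  let ?S = "{k. k < n \<and> 0 < s k}"
  have onu: "orthonormal_on n ?S u"
    unfolding orthonormal_on_def u_def ip_scale_left ip_scale_right
  proof (intro ballI)
    fix k l assume k: "k \<in> ?S" and l: "l \<in> ?S"
    have "1 / s k * (1 / s k * \<mu> k) = 1" using k by (simp flip: ss)
    then show "1 / s k * (1 / s l * ip n (mv n X (v k)) (mv n X (v l))) = (if k = l then 1 else 0)"
      using k l by (auto simp: XXv)
  qed
  have X: "X i j = (\<Sum>k\<in>?S. s k * u k i * v k j)" if "i < n" "j < n" for i j
  proof -
    have "X i j = (\<Sum>m<n. X i m * (\<Sum>k<n. v k m * v k j))"
      using that by (simp add: orthonormal_complete[OF on] if_distrib cong: if_cong)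
    also have "\<dots> = (\<Sum>k<n. mv n X (v k) i * v k j)"
      unfolding mv_def sum_distrib_left sum_distrib_right mult.assoc by (rule sum.swap)
    also have "\<dots> = (\<Sum>k\<in>?S. mv n X (v k) i * v k j)"
    proof (rule sum.mono_neutral_right)
      show "\<forall>k\<in>{..<n} - ?S. mv n X (v k) i * v k j = 0"
      proof
        \<comment> \<open>The squared norm of \<open>X\<close> applied to \<open>v k\<close> is
          \<open>\<mu> k = 0\<close>, so the terms outside \<open>?S\<close> vanish.\<close>
        fix k assume k: "k \<in> {..<n} - ?S"
        then have "\<mu> k = 0" using mu[of k] spos[of k] by auto
        then have "ip n (mv n X (v k)) (mv n X (v k)) = 0" using XXv[of k k] k by simp
        then show "mv n X (v k) i * v k j = 0" using that unfolding ip_self_eq_0 by simp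
      qed
    qed auto
    also have "\<dots> = (\<Sum>k\<in>?S. s k * u k i * v k j)" by (intro sum.cong) (auto simp: u_def)
    finally show ?thesis .
  qed
  have nuc: "nuc_norm n X = (\<Sum>k\<in>?S. s k)"
  proof -
    let ?M = "transpose_mat (to_mat n X) * to_mat n X"
    have "char_poly ?M = (\<Prod>l<n. [:- \<mu> l, 1 :: real:])"
      by (rule char_poly_orthonormal_eigenbasis[OF on])
        (auto simp: to_mat_def scalar_prod_def atLeast0LessThan A[symmetric] A_def)
    then have "nuc_norm n X = (\<Sum>l<n. s l)"
      unfolding nuc_norm_def Let_def s_def by (intro sum_order_prod_linear) auto
    also have "\<dots> = (\<Sum>k\<in>?S. s k)"
      using s0 by (intro sum.mono_neutral_right) (auto simp: less_le)
    finally show ?thesis .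
  qed
  have fr: "(frob n X)\<^sup>2 = (\<Sum>k\<in>?S. (s k)\<^sup>2)"
  proof -
    have "minner n X X = (\<Sum>k\<in>?S. s k * ip n (u k) (mv n X (v k)))" by (rule minner_rank_one_sum) (rule X)
    also have "\<dots> = (\<Sum>k\<in>?S. (s k)\<^sup>2)"
    proof (intro sum.cong refl)
      fix k assume k: "k \<in> ?S"
      have "ip n (u k) (mv n X (v k)) = 1 / s k * \<mu> k"
        unfolding u_def ip_scale_left using k by (simp add: XXv)
      then show "s k * ip n (u k) (mv n X (v k)) = (s k)\<^sup>2"
        using k by (simp add: power2_eq_square ss)
    qed
    finally show ?thesis by (simp add: frob_power2)
  qed
  have "card ?S \<le> mrank n X"
    by (rule orthonormal_in_column_space_card_le[OF onu, where w = "\<lambda>k i. 1 / s k * v k i"])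
      (simp, simp only: u_def mv_scale)
  moreover have "orthonormal_on n ?S v" by (rule orthonormal_on_mono[OF on]) auto
  ultimately show ?thesis using onu X nuc fr unfolding svd_of_def Let_def by blast
qed

section \<open>Duality of spectral and nuclear norm\<close>

lemma orthonormal_vnorm: "orthonormal_on n S e \<Longrightarrow> k \<in> S \<Longrightarrow> vnorm n (e k) = 1"
  by (simp add: orthonormal_on_def vnorm_ip)

text \<open>\<open>W\<close> is tested on the singular pairs of \<open>X\<close>. Together with
  \<open>nuc_norm_attained\<close> this makes the nuclear norm a maximum of linear functionals, so
  the characteristic polynomial in its definition no longer has to be touched.\<close>

lemma minner_le_nuc_norm:
  assumes "op_le n c W"
  shows "minner n W X \<le> c * nuc_norm n X"
proof -
  obtain s u v where "svd_of n X s u v" using singular_value_decomposition by blast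
  note svd = svd_ofD[OF this]
  have "minner n W X = (\<Sum>k | k < n \<and> 0 < s k. s k * ip n (u k) (mv n W (v k)))"
    by (rule minner_rank_one_sum) (rule svd)
  also have "\<dots> \<le> (\<Sum>k | k < n \<and> 0 < s k. s k * c)"
  proof (rule sum_mono)
    fix k assume k: "k \<in> {k. k < n \<and> 0 < s k}"
    have "ip n (u k) (mv n W (v k)) \<le> c"
      using op_leD[OF assms, of "u k" "v k"] orthonormal_vnorm[OF svd(2) k] orthonormal_vnorm[OF svd(1) k] by simp
    then show "s k * ip n (u k) (mv n W (v k)) \<le> s k * c" using k by (intro mult_left_mono) auto
  qed
  finally show ?thesis by (simp add: svd(4) sum_distrib_left mult.commute)
qed

lemma abs_sum_ip_mult_le: "\<bar>\<Sum>k\<in>S. ip n (u k) x * ip n (v k) y\<bar>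
    \<le> sqrt (\<Sum>k\<in>S. (ip n (u k) x)\<^sup>2) * sqrt (\<Sum>k\<in>S. (ip n (v k) y)\<^sup>2)"
  using real_sqrt_le_mono[OF Cauchy_Schwarz_ineq_sum[of "\<lambda>k. ip n (u k) x" "\<lambda>k. ip n (v k) y" S]]
  by (simp add: real_sqrt_mult)

lemma ip_mv_rank_one_sum:
  "ip n x (mv n (\<lambda>i j. \<Sum>k\<in>S. u k i * v k j) y) = (\<Sum>k\<in>S. ip n x (u k) * ip n (v k) y)"
proof -
  have "mv n (\<lambda>i j. \<Sum>k\<in>S. u k i * v k j) y = (\<lambda>i. \<Sum>k\<in>S. ip n (v k) y * u k i)"
    unfolding mv_def ip_def sum_distrib_right sum_distrib_left
    by (intro ext, subst sum.swap) (simp add: algebra_simps)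
  then show ?thesis by (simp only: ip_sum_right ip_scale_right) (simp add: mult.commute)
qed

text \<open>The dual certificate is the sum of the \<open>u k\<close> times the transposed
  \<open>v k\<close>: Bessel's inequality makes it a contraction, and it pairs with \<open>X\<close>
  to the sum of the singular values.\<close>

lemma nuc_norm_attained:
  obtains W where "op_le n 1 W" "minner n W X = nuc_norm n X"
proof -
  obtain s u v where "svd_of n X s u v" using singular_value_decomposition by blast
  note svd = svd_ofD[OF this]
  let ?S = "{k. k < n \<and> 0 < s k}"
  let ?W = "\<lambda>i j. \<Sum>k\<in>?S. u k i * v k j"
  note onv = svd(1)
  have "op_le n 1 ?W"
    unfolding op_le_def
  proof (intro allI)
    fix x y
    have "ip n x (mv n ?W y) \<le> sqrt (\<Sum>k\<in>?S. (ip n (u k) x)\<^sup>2) * sqrt (\<Sum>k\<in>?S. (ip n (v k) y)\<^sup>2)"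
      unfolding ip_mv_rank_one_sum
      using abs_sum_ip_mult_le[of n u x v y ?S] by (simp add: ip_commute[of n x "u _"])
    also have "\<dots> \<le> sqrt (ip n x x) * sqrt (ip n y y)"
      by (intro mult_mono real_sqrt_le_mono Bessel svd(2) onv) (auto intro: sum_nonneg)
    finally show "ip n x (mv n ?W y) \<le> 1 * vnorm n x * vnorm n y" by (simp add: vnorm_ip)
  qed
  moreover have "minner n ?W X = nuc_norm n X"
  proof -
    have "minner n ?W X = (\<Sum>k\<in>?S. s k * ip n (u k) (mv n ?W (v k)))" by (rule minner_rank_one_sum) (rule svd)
    also have "\<dots> = (\<Sum>k\<in>?S. s k)"
    proof (intro sum.cong refl)
      fix k assume k: "k \<in> ?S"
      have "ip n (u k) (mv n ?W (v k)) = (\<Sum>l\<in>?S. if l = k then 1 else 0)"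
        unfolding ip_mv_rank_one_sum using svd(2) onv k by (intro sum.cong) (auto simp: orthonormal_on_def)
      then show "s k * ip n (u k) (mv n ?W (v k)) = s k" using k by simp
    qed
    finally show ?thesis by (simp add: svd(4))
  qed
  ultimately show ?thesis using that by blast
qed

lemma nuc_norm_nonneg: "0 \<le> nuc_norm n X"
proof -
  obtain s u v where "svd_of n X s u v" using singular_value_decomposition by blast
  note svd = svd_ofD[OF this]
  show ?thesis unfolding svd by (rule sum_nonneg) auto
qed

lemma nuc_norm_scale:
  assumes "0 \<le> c"
  shows "nuc_norm n (\<lambda>i j. c * X i j) = c * nuc_norm n X"
proof (rule antisym)
  obtain W where W: "op_le n 1 W" "minner n W (\<lambda>i j. c * X i j) = nuc_norm n (\<lambda>i j. c * X i j)"
    by (rule nuc_norm_attained)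
  have "c * minner n W X \<le> c * nuc_norm n X"
    using minner_le_nuc_norm[OF W(1), of X] assms by (intro mult_left_mono) auto
  then show "nuc_norm n (\<lambda>i j. c * X i j) \<le> c * nuc_norm n X" using W(2) by (simp add: minner_scale_right)
next
  obtain W where W: "op_le n 1 W" "minner n W X = nuc_norm n X"
    by (rule nuc_norm_attained)
  show "c * nuc_norm n X \<le> nuc_norm n (\<lambda>i j. c * X i j)"
    using minner_le_nuc_norm[OF W(1), of "\<lambda>i j. c * X i j"] W(2) by (simp add: minner_scale_right)
qed

lemma nuc_norm_le_rank:
  assumes "mrank n X \<le> r"
  shows "nuc_norm n X \<le> sqrt (real r) * frob n X"
proof -
  obtain s u v where "svd_of n X s u v" using singular_value_decomposition by blast
  note svd = svd_ofD[OF this]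
  let ?S = "{k. k < n \<and> 0 < s k}"
  have "(nuc_norm n X)\<^sup>2 \<le> (\<Sum>k\<in>?S. 1\<^sup>2) * (\<Sum>k\<in>?S. (s k)\<^sup>2)"
    using Cauchy_Schwarz_ineq_sum[of "\<lambda>_. 1" s ?S] by (simp add: svd(4))
  also have "\<dots> \<le> real r * (frob n X)\<^sup>2"
    using svd(6) assms unfolding svd(5)[symmetric] by (intro mult_right_mono) auto
  finally have "(nuc_norm n X)\<^sup>2 \<le> (sqrt (real r) * frob n X)\<^sup>2" by (simp add: power_mult_distrib)
  then show ?thesis by (rule power2_le_imp_le) simp
qed


section \<open>Directions in which the nuclear norm does not increase\<close>

lemma ip_residual_le:
  assumes "orthonormal_on n S e" "finite S"
  shows "vnorm n (\<lambda>i. x i - (\<Sum>k\<in>S. ip n (e k) x * e k i)) \<le> vnorm n x"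
  unfolding vnorm_ip Bessel_expand[OF assms] by (simp add: sum_nonneg)

lemma mult_add_le_sqrt:
  fixes a b c d :: real
  assumes "0 \<le> a" "0 \<le> b" "0 \<le> c" "0 \<le> d"
  shows "a * c + b * d \<le> sqrt (a\<^sup>2 + b\<^sup>2) * sqrt (c\<^sup>2 + d\<^sup>2)"
proof (rule power2_le_imp_le)
  have "2 * (a * d) * (b * c) \<le> (a * d)\<^sup>2 + (b * c)\<^sup>2" by (rule sum_squares_bound)
  then show "(a * c + b * d)\<^sup>2 \<le> (sqrt (a\<^sup>2 + b\<^sup>2) * sqrt (c\<^sup>2 + d\<^sup>2))\<^sup>2"
    by (simp add: power_mult_distrib) (simp add: power2_eq_square algebra_simps)
qed simp

text \<open>With \<open>P\<close>, \<open>R\<close> the projections onto the left and right singular spaces of \<open>X\<close>, testing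
  \<open>X + H\<close> against the contraction \<open>U V\<^sup>T + (I - P) W (I - R)\<close> bounds \<open>\<langle>(I - P) W (I - R), H\<rangle>\<close>;
  what remains of \<open>W\<close> has Frobenius norm at most \<open>2 \<surd>r\<close>.\<close>

lemma nuc_norm_descent_direction:
  assumes rank: "mrank n X \<le> r"
    and le: "nuc_norm n (\<lambda>i j. X i j + H i j) \<le> nuc_norm n X"
  shows "nuc_norm n H \<le> 3 * sqrt (real r) * frob n H"
proof -
  obtain s u v where "svd_of n X s u v" using singular_value_decomposition by blast
  note svd = svd_ofD[OF this]
  define S where "S = {k. k < n \<and> 0 < s k}"
  have finS: "finite S" by (simp add: S_def)
  have onu: "orthonormal_on n S u" and onv: "orthonormal_on n S v" using svd(1,2) by (auto simp: S_def)
  have cardS: "real (card S) \<le> real r" using svd(6) rank by (simp add: S_def)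
  obtain W where W: "op_le n 1 W" and WH: "minner n W H = nuc_norm n H" by (rule nuc_norm_attained)
  have Wt: "op_le n 1 (\<lambda>i j. W j i)" by (rule op_le_transpose[OF W])
  define wt where "wt k = mv n (\<lambda>i j. W j i) (u k)" for k
  define z where "z l = (\<lambda>i. mv n W (v l) i - (\<Sum>k\<in>S. ip n (u k) (mv n W (v l)) * u k i))" for l
  \<comment> \<open>In terms of the projections, \<open>E1 = P W\<close> and
    \<open>E2 = (I - P) W R\<close>, which leaves \<open>W' = (I - P) W (I - R)\<close>. Both
    removed parts are sums of at most \<open>r\<close> rank one terms with one orthonormal factor
    and one of norm at most 1.\<close>
  define E1 where "E1 = (\<lambda>i j. \<Sum>k\<in>S. u k i * wt k j)"
  define E2 where "E2 = (\<lambda>i j. \<Sum>l\<in>S. z l i * v l j)"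
  define W0 where "W0 = (\<lambda>i j. \<Sum>k\<in>S. u k i * v k j)"
  define W' where "W' = (\<lambda>i j. W i j - E1 i j - E2 i j)"
  define pu where "pu x = (\<lambda>i. x i - (\<Sum>k\<in>S. ip n (u k) x * u k i))" for x
  define pv where "pv x = (\<lambda>i. x i - (\<Sum>k\<in>S. ip n (v k) x * v k i))" for x
  have sq: "(frob n F)\<^sup>2 \<le> real r \<Longrightarrow> frob n F \<le> sqrt (real r)" for F
    by (simp add: real_le_rsqrt)
  have small: "ip n w w \<le> 1" if "vnorm n w \<le> 1" for w
    using that by (simp add: vnorm_ip)
  have f0: "frob n W0 \<le> sqrt (real r)"
    unfolding W0_def using cardS onu
    by (intro sq) (simp add: frob_sum_orthonormal[OF onv finS] orthonormal_on_def)
  have f1: "frob n E1 \<le> sqrt (real r)"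
  proof (rule sq)
    have "(frob n E1)\<^sup>2 = (frob n (\<lambda>i j. \<Sum>k\<in>S. wt k i * u k j))\<^sup>2"
      unfolding E1_def by (subst frob_transpose[symmetric]) (simp add: mult.commute)
    also have "\<dots> = (\<Sum>k\<in>S. ip n (wt k) (wt k))" by (rule frob_sum_orthonormal[OF onu finS])
    also have "\<dots> \<le> (\<Sum>k\<in>S. 1)"
    proof (intro sum_mono small)
      fix k assume "k \<in> S"
      then show "vnorm n (wt k) \<le> 1"
        using op_le_vnorm_mv[OF Wt, of "u k"] orthonormal_vnorm[OF onu] by (simp add: wt_def)
    qed
    finally show "(frob n E1)\<^sup>2 \<le> real r" using cardS by simp
  qed
  have f2: "frob n E2 \<le> sqrt (real r)"
  proof (rule sq)
    have "(frob n E2)\<^sup>2 = (\<Sum>k\<in>S. ip n (z k) (z k))" unfolding E2_def by (rule frob_sum_orthonormal[OF onv finS])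
    also have "\<dots> \<le> (\<Sum>k\<in>S. 1)"
    proof (intro sum_mono small)
      fix k assume k: "k \<in> S"
      have "vnorm n (z k) \<le> vnorm n (mv n W (v k))" unfolding z_def by (rule ip_residual_le[OF onu finS])
      also have "\<dots> \<le> 1" using op_le_vnorm_mv[OF W, of "v k"] orthonormal_vnorm[OF onv k] by simp
      finally show "vnorm n (z k) \<le> 1" .
    qed
    finally show "(frob n E2)\<^sup>2 \<le> real r" using cardS by simp
  qed
  have bil: "ip n x (mv n W' y) = ip n (pu x) (mv n W (pv y))" for x y
  proof -
    have mvW': "mv n W' y = (\<lambda>i. mv n W y i - mv n E1 y i - mv n E2 y i)"
      by (simp add: W'_def mv_def algebra_simps sum_subtractf)
    have "ip n x (mv n W' y) = ip n x (mv n W y) - ip n x (mv n E1 y) - ip n x (mv n E2 y)"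
      unfolding mvW' ip_diff_right ..
    also have "ip n x (mv n E1 y) = (\<Sum>k\<in>S. ip n (u k) x * ip n (u k) (mv n W y))"
      unfolding E1_def ip_mv_rank_one_sum wt_def ip_mv_transpose[symmetric] by (simp add: ip_commute[of n x "u _"])
    also have "ip n x (mv n E2 y) = (\<Sum>l\<in>S. (ip n x (mv n W (v l))
        - (\<Sum>k\<in>S. ip n (u k) (mv n W (v l)) * ip n (u k) x)) * ip n (v l) y)"
      unfolding E2_def ip_mv_rank_one_sum z_def ip_linear by (simp add: ip_commute[of n x "u _"])
    also have "ip n x (mv n W y) - (\<Sum>k\<in>S. ip n (u k) x * ip n (u k) (mv n W y))
        - (\<Sum>l\<in>S. (ip n x (mv n W (v l)) - (\<Sum>k\<in>S. ip n (u k) (mv n W (v l)) * ip n (u k) x)) * ip n (v l) y)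
        = ip n (pu x) (mv n W (pv y))"
    proof -
      have "mv n W (pv y) = (\<lambda>i. mv n W y i - (\<Sum>l\<in>S. ip n (v l) y * mv n W (v l) i))"
        unfolding pv_def mv_diff mv_sum mv_scale ..
      moreover have p: "ip n (pu x) w = ip n x w - (\<Sum>k\<in>S. ip n (u k) x * ip n (u k) w)" for w
        unfolding pu_def ip_linear ..
      ultimately have "ip n (pu x) (mv n W (pv y)) = ip n (pu x) (mv n W y)
          - (\<Sum>l\<in>S. ip n (v l) y * ip n (pu x) (mv n W (v l)))"
        by (simp only: ip_diff_right ip_sum_right ip_scale_right)
      then show ?thesis unfolding p by (simp add: mult.commute)
    qed
    finally show ?thesis .
  qed
  \<comment> \<open>\<open>W0\<close> acts between the singular spaces and \<open>W'\<close> between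
    their complements. The two bilinear bounds combine by the Cauchy-Schwarz inequality in the
    plane, and the squared norms of the two projections of a vector add up to that of the
    vector.\<close>
  have contr: "op_le n 1 (\<lambda>i j. W0 i j + W' i j)"
    unfolding op_le_def
  proof (intro allI)
    fix x y
    define a where "a = sqrt (\<Sum>k\<in>S. (ip n (u k) x)\<^sup>2)"
    define c where "c = sqrt (\<Sum>k\<in>S. (ip n (v k) y)\<^sup>2)"
    have "mv n (\<lambda>i j. W0 i j + W' i j) y = (\<lambda>i. mv n W0 y i + mv n W' y i)"
      by (simp add: mv_def algebra_simps sum.distrib)
    then have "ip n x (mv n (\<lambda>i j. W0 i j + W' i j) y) = ip n x (mv n W0 y) + ip n x (mv n W' y)"
      by (simp only: ip_add_right)
    also have "ip n x (mv n W0 y) \<le> a * c"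
      unfolding W0_def ip_mv_rank_one_sum a_def c_def
      using abs_sum_ip_mult_le[of n u x v y S] by (simp add: ip_commute[of n x "u _"])
    also have "ip n x (mv n W' y) \<le> vnorm n (pu x) * vnorm n (pv y)"
      unfolding bil using op_leD[OF W, of "pu x" "pv y"] by simp
    also have "a * c + vnorm n (pu x) * vnorm n (pv y)
        \<le> sqrt (a\<^sup>2 + (vnorm n (pu x))\<^sup>2) * sqrt (c\<^sup>2 + (vnorm n (pv y))\<^sup>2)"
      by (rule mult_add_le_sqrt) (auto simp: a_def c_def intro: sum_nonneg)
    also have "a\<^sup>2 + (vnorm n (pu x))\<^sup>2 = ip n x x"
      unfolding vnorm_power2 pu_def Bessel_expand[OF onu finS] a_def by (simp add: sum_nonneg)
    also have "c\<^sup>2 + (vnorm n (pv y))\<^sup>2 = ip n y y"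
      unfolding vnorm_power2 pv_def Bessel_expand[OF onv finS] c_def by (simp add: sum_nonneg)
    finally show "ip n x (mv n (\<lambda>i j. W0 i j + W' i j) y) \<le> 1 * vnorm n x * vnorm n y"
      by (simp add: vnorm_ip)
  qed
  have onD: "(\<Sum>l\<in>S. c l * ip n (e l) (e k)) = c k" if "orthonormal_on n S e" "k \<in> S" for e k c
  proof -
    have "(\<Sum>l\<in>S. c l * ip n (e l) (e k)) = (\<Sum>l\<in>S. if l = k then c l else 0)"
      using that by (intro sum.cong) (auto simp: orthonormal_on_def)
    then show ?thesis using that finS by simp
  qed
  have W0X: "minner n W0 X = nuc_norm n X"
  proof -
    have "minner n W0 X = (\<Sum>k\<in>S. s k * ip n (u k) (mv n W0 (v k)))"
      by (rule minner_rank_one_sum) (unfold S_def, rule svd)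
    also have "\<dots> = (\<Sum>k\<in>S. s k)"
    proof (intro sum.cong refl)
      fix k assume k: "k \<in> S"
      have "ip n (u k) (mv n W0 (v k)) = ip n (u k) (u k)"
        unfolding W0_def ip_mv_rank_one_sum by (rule onD[OF onv k])
      then show "s k * ip n (u k) (mv n W0 (v k)) = s k" using onu k by (simp add: orthonormal_on_def)
    qed
    finally show ?thesis by (simp add: svd(4) S_def)
  qed
  have W'X: "minner n W' X = 0"
  proof -
    have "minner n W' X = (\<Sum>k\<in>S. s k * ip n (u k) (mv n W' (v k)))"
      by (rule minner_rank_one_sum) (unfold S_def, rule svd)
    also have "\<dots> = (\<Sum>k\<in>S. s k * 0)"
    proof (intro sum.cong refl)
      fix k assume k: "k \<in> S"
      have "pu (u k) i = 0" for i
      proof -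
        have "(\<Sum>l\<in>S. ip n (u l) (u k) * u l i) = u k i"
          using onD[OF onu k, of "\<lambda>l. u l i"] by (simp add: mult.commute)
        then show ?thesis by (simp add: pu_def)
      qed
      then show "s k * ip n (u k) (mv n W' (v k)) = s k * 0" unfolding bil by (simp add: ip_def)
    qed
    finally show ?thesis by simp
  qed
  \<comment> \<open>\<open>W0\<close> pairs with \<open>X\<close> to its nuclear norm and
    \<open>W'\<close> pairs with \<open>X\<close> to 0, so the hypothesis forces the pairing of
    \<open>W0 + W'\<close> with \<open>H\<close> to be nonpositive. The three terms
    \<open>W0\<close>, \<open>E1\<close>, \<open>E2\<close> then give the factor 3.\<close>
  have "minner n (\<lambda>i j. W0 i j + W' i j) (\<lambda>i j. X i j + H i j) \<le> nuc_norm n X"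
    using minner_le_nuc_norm[OF contr, of "\<lambda>i j. X i j + H i j"] le by simp
  then have "minner n W' H \<le> - minner n W0 H"
    unfolding minner_add_left minner_add_right W0X W'X by simp
  also have "\<dots> \<le> sqrt (real r) * frob n H"
    using minner_Cauchy_Schwarz[of n W0 H] mult_right_mono[OF f0, of "frob n H"] by simp
  finally have 1: "minner n W' H \<le> sqrt (real r) * frob n H" .
  have 2: "minner n E1 H \<le> sqrt (real r) * frob n H"
    using minner_Cauchy_Schwarz[of n E1 H] mult_right_mono[OF f1, of "frob n H"] by simp
  have 3: "minner n E2 H \<le> sqrt (real r) * frob n H"
    using minner_Cauchy_Schwarz[of n E2 H] mult_right_mono[OF f2, of "frob n H"] by simp
  have "minner n W' H = minner n W H - minner n E1 H - minner n E2 H"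
    unfolding W'_def minner_diff_left ..
  then show ?thesis using 1 2 3 WH by simp
qed

subsection \<open>Covering the nuclear ball\<close>

lemma symmetric_decomposition:
  assumes "\<And>i j. i < d \<Longrightarrow> j < d \<Longrightarrow> A i j = A j i"
  shows "\<exists>e \<mu>. orthonormal_on d {..<d} e \<and> (\<forall>i<d. \<forall>j<d. A i j = (\<Sum>l<d. \<mu> l * e l i * e l j))"
  by (rule symmetric_eigenbasis[of d A]) (use assms in \<open>blast+\<close>)

section \<open>Matrix powers, their traces and derivatives\<close>

definition mm :: "nat \<Rightarrow> (nat \<Rightarrow> nat \<Rightarrow> real) \<Rightarrow> (nat \<Rightarrow> nat \<Rightarrow> real) \<Rightarrow> nat \<Rightarrow> nat \<Rightarrow> real" where
  "mm d A B = (\<lambda>i j. \<Sum>k<d. A i k * B k j)"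

fun mpow :: "nat \<Rightarrow> (nat \<Rightarrow> nat \<Rightarrow> real) \<Rightarrow> nat \<Rightarrow> nat \<Rightarrow> nat \<Rightarrow> real" where
  "mpow d A 0 = (\<lambda>i j. if i = j then 1 else 0)"
| "mpow d A (Suc m) = mm d (mpow d A m) A"

definition tr :: "nat \<Rightarrow> (nat \<Rightarrow> nat \<Rightarrow> real) \<Rightarrow> real" where
  "tr d A = (\<Sum>i<d. A i i)"

lemma mm_assoc: "mm d (mm d A B) C = mm d A (mm d B C)"
proof (intro ext)
  fix i j
  show "mm d (mm d A B) C i j = mm d A (mm d B C) i j"
    unfolding mm_def sum_distrib_left sum_distrib_right mult.assoc by (rule sum.swap)
qed

lemma mm_cong:
  "(\<And>k. k < d \<Longrightarrow> A i k = A' i k) \<Longrightarrow> (\<And>k. k < d \<Longrightarrow> B k j = B' k j) \<Longrightarrow> mm d A B i j = mm d A' B' i j"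
  by (simp add: mm_def)

lemma mm_mpow_0_right: "j < d \<Longrightarrow> mm d X (mpow d A 0) i j = X i j"
  by (simp add: mm_def if_distrib cong: if_cong)

lemma mpow_add:
  assumes "i < d" "j < d"
  shows "mm d (mpow d A a) (mpow d A b) i j = mpow d A (a + b) i j"
  using assms(2)
proof (induction b arbitrary: j)
  case 0
  then show ?case by (simp only: mm_mpow_0_right add_0_right)
next
  case (Suc b)
  have "mm d (mpow d A a) (mpow d A (Suc b)) i j = mm d (mm d (mpow d A a) (mpow d A b)) A i j"
    by (simp add: mm_assoc)
  also have "\<dots> = mm d (mpow d A (a + b)) A i j" by (rule mm_cong) (auto simp: Suc.IH)
  finally show ?case by simp
qed

lemma tr_cyclic: "tr d (mm d (mm d X H) Y) = (\<Sum>i<d. \<Sum>j<d. H i j * mm d Y X j i)"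
proof -
  have "tr d (mm d (mm d X H) Y) = (\<Sum>a<d. \<Sum>j<d. \<Sum>i<d. H i j * (Y j a * X a i))"
    by (simp add: tr_def mm_def sum_distrib_left sum_distrib_right algebra_simps)
  also have "\<dots> = (\<Sum>j<d. \<Sum>a<d. \<Sum>i<d. H i j * (Y j a * X a i))" by (rule sum.swap)
  also have "\<dots> = (\<Sum>j<d. \<Sum>i<d. \<Sum>a<d. H i j * (Y j a * X a i))" by (intro sum.cong refl sum.swap)
  also have "\<dots> = (\<Sum>i<d. \<Sum>j<d. \<Sum>a<d. H i j * (Y j a * X a i))" by (rule sum.swap)
  finally show ?thesis by (simp add: mm_def sum_distrib_left)
qed

text \<open>The derivative of \<open>mpow d A m\<close> in direction \<open>H\<close>: since
  \<open>A\<close> and \<open>H\<close> need not commute, the product rule puts \<open>H\<close> in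
  turn at each position \<open>a\<close>. For \<open>m = 0\<close> the sum is empty, so the
  truncated \<open>m - 1\<close> does no harm.\<close>

definition dpow :: "nat \<Rightarrow> (nat \<Rightarrow> nat \<Rightarrow> real) \<Rightarrow> (nat \<Rightarrow> nat \<Rightarrow> real) \<Rightarrow> nat \<Rightarrow> nat \<Rightarrow> nat \<Rightarrow> real" where
  "dpow d A H m = (\<lambda>i j. \<Sum>a<m. mm d (mm d (mpow d A a) H) (mpow d A (m - 1 - a)) i j)"

lemma mpow_has_derivative:
  assumes "j < d"
  shows "((\<lambda>t. mpow d (\<lambda>i j. A i j + t * H i j) m i j) has_real_derivative
     dpow d (\<lambda>i j. A i j + t * H i j) H m i j) (at t)"
  using assms
proof (induction m arbitrary: j)
  case 0
  show ?case by (simp add: dpow_def)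
next
  case (Suc m)
  let ?A = "\<lambda>i j. A i j + t * H i j"
  have "dpow d ?A H (Suc m) i j = (\<Sum>k<d. dpow d ?A H m i k * ?A k j + mpow d ?A m i k * H k j)"
  proof -
    have "(\<Sum>k<d. dpow d ?A H m i k * ?A k j)
        = (\<Sum>a<m. mm d (mm d (mm d (mpow d ?A a) H) (mpow d ?A (m - 1 - a))) ?A i j)"
      unfolding dpow_def mm_def[of d _ ?A] sum_distrib_right by (rule sum.swap)
    also have "\<dots> = (\<Sum>a<m. mm d (mm d (mpow d ?A a) H) (mpow d ?A (m - a)) i j)"
    proof (intro sum.cong refl)
      fix a assume "a \<in> {..<m}"
      then have "m - a = Suc (m - 1 - a)" by auto
      then show "mm d (mm d (mm d (mpow d ?A a) H) (mpow d ?A (m - 1 - a))) ?A i j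
          = mm d (mm d (mpow d ?A a) H) (mpow d ?A (m - a)) i j" by (simp add: mm_assoc)
    qed
    finally have "(\<Sum>k<d. dpow d ?A H m i k * ?A k j + mpow d ?A m i k * H k j)
        = (\<Sum>a<m. mm d (mm d (mpow d ?A a) H) (mpow d ?A (m - a)) i j) + mm d (mpow d ?A m) H i j"
      by (simp add: sum.distrib mm_def)
    also have "mm d (mpow d ?A m) H i j = mm d (mm d (mpow d ?A m) H) (mpow d ?A (m - m)) i j"
      using mm_mpow_0_right[OF Suc.prems] by simp
    finally show ?thesis by (simp add: dpow_def)
  qed
  moreover have "((\<lambda>t. \<Sum>k<d. mpow d (\<lambda>i j. A i j + t * H i j) m i k * (A k j + t * H k j)) has_real_derivative
     (\<Sum>k<d. dpow d ?A H m i k * ?A k j + mpow d ?A m i k * H k j)) (at t)"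
    by (intro DERIV_sum) (auto intro!: derivative_eq_intros Suc.IH)
  ultimately show ?case by (simp add: mm_def)
qed

lemma mpow_eigenbasis:
  assumes on: "orthonormal_on d {..<d} e"
    and A: "\<And>i j. i < d \<Longrightarrow> j < d \<Longrightarrow> A i j = (\<Sum>l<d. \<mu> l * e l i * e l j)"
    and ij: "i < d" "j < d"
  shows "mpow d A m i j = (\<Sum>l<d. \<mu> l ^ m * e l i * e l j)"
  using ij(2)
proof (induction m arbitrary: j)
  case 0
  then show ?case using orthonormal_complete[OF on ij(1)] by simp
next
  case (Suc m)
  have "mpow d A (Suc m) i j = (\<Sum>k<d. \<Sum>l<d. (\<mu> l ^ m * e l i * e l k) * A k j)"
    by (simp add: mm_def Suc sum_distrib_right)
  also have "\<dots> = (\<Sum>l<d. \<Sum>k<d. (\<mu> l ^ m * e l i * e l k) * A k j)" by (rule sum.swap)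
  also have "\<dots> = (\<Sum>l<d. \<mu> l ^ m * e l i * (\<mu> l * e l j))"
  proof (intro sum.cong refl)
    fix l assume l: "l \<in> {..<d}"
    have "(\<Sum>k<d. e l k * A k j) = (\<Sum>k<d. \<Sum>q<d. \<mu> q * e q j * (e l k * e q k))"
      by (intro sum.cong refl) (simp add: A Suc.prems sum_distrib_left algebra_simps)
    also have "\<dots> = (\<Sum>q<d. \<Sum>k<d. \<mu> q * e q j * (e l k * e q k))" by (rule sum.swap)
    also have "\<dots> = (\<Sum>q<d. \<mu> q * e q j * ip d (e l) (e q))"
      by (simp add: ip_def sum_distrib_left)
    also have "\<dots> = (\<Sum>q<d. if q = l then \<mu> q * e q j else 0)"
      using on l by (intro sum.cong) (auto simp: orthonormal_on_def)
    finally have "(\<Sum>k<d. e l k * A k j) = \<mu> l * e l j" using l by simp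
    then show "(\<Sum>k<d. (\<mu> l ^ m * e l i * e l k) * A k j) = \<mu> l ^ m * e l i * (\<mu> l * e l j)"
      by (simp add: mult.assoc flip: sum_distrib_left)
  qed
  finally show ?case by (simp add: algebra_simps)
qed

lemma tr_mpow_eigenbasis:
  assumes "orthonormal_on d {..<d} e"
    and "\<And>i j. i < d \<Longrightarrow> j < d \<Longrightarrow> A i j = (\<Sum>l<d. \<mu> l * e l i * e l j)"
  shows "tr d (mpow d A m) = (\<Sum>l<d. \<mu> l ^ m)"
proof -
  have "tr d (mpow d A m) = (\<Sum>i<d. \<Sum>l<d. \<mu> l ^ m * (e l i * e l i))"
    unfolding tr_def by (intro sum.cong refl) (simp add: mpow_eigenbasis[OF assms] mult.assoc)
  also have "\<dots> = (\<Sum>l<d. \<mu> l ^ m * ip d (e l) (e l))"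
    unfolding ip_def sum_distrib_left by (rule sum.swap)
  finally show ?thesis using assms(1) by (simp add: orthonormal_on_def)
qed

section \<open>Second-order smoothness of Schatten norms\<close>

lemma mult_powers_le:
  fixes x y :: real
  assumes "a + b = 2 * q"
  shows "x ^ a * y ^ b + y ^ a * x ^ b \<le> x ^ (2 * q) + y ^ (2 * q)"
proof -
  \<comment> \<open>On nonnegative numbers the powers \<open>a\<close> and \<open>b\<close> are
    ordered alike, so the two differences have the same sign. The even total degree removes the
    absolute values at the end.\<close>
  have "(\<bar>x\<bar> ^ a - \<bar>y\<bar> ^ a) * (\<bar>x\<bar> ^ b - \<bar>y\<bar> ^ b) \<ge> 0"
  proof (cases "\<bar>x\<bar> \<le> \<bar>y\<bar>")
    case True
    then show ?thesis by (intro mult_nonpos_nonpos) (auto intro: power_mono)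
  next
    case False
    then show ?thesis by (intro mult_nonneg_nonneg) (auto intro: power_mono)
  qed
  then have "\<bar>x\<bar> ^ a * \<bar>y\<bar> ^ b + \<bar>y\<bar> ^ a * \<bar>x\<bar> ^ b \<le> \<bar>x\<bar> ^ (a + b) + \<bar>y\<bar> ^ (a + b)"
    by (simp add: algebra_simps power_add)
  moreover have "x ^ a * y ^ b \<le> \<bar>x\<bar> ^ a * \<bar>y\<bar> ^ b" "y ^ a * x ^ b \<le> \<bar>y\<bar> ^ a * \<bar>x\<bar> ^ b"
    using abs_ge_self[of "x ^ a * y ^ b"] abs_ge_self[of "y ^ a * x ^ b"] by (simp_all add: abs_mult power_abs)
  ultimately show ?thesis unfolding assms by (simp add: power_even_abs)
qed

text \<open>In an eigenbasis of \<open>A\<close> the trace on the left is the sum of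
  \<open>\<mu> l ^ a * \<mu> m ^ b * (g l m)\<^sup>2\<close>, where \<open>g\<close> is the
  symmetric matrix of \<open>H\<close>. After symmetrising, \<open>mult_powers_le\<close> moves all
  powers to a single index, and every row of \<open>g\<close> has squared length at most
  \<open>h\<^sup>2\<close>.\<close>

lemma tr_sandwich_le:
  assumes on: "orthonormal_on d {..<d} e"
    and A: "\<And>i j. i < d \<Longrightarrow> j < d \<Longrightarrow> A i j = (\<Sum>l<d. \<mu> l * e l i * e l j)"
    and sym: "\<And>i j. i < d \<Longrightarrow> j < d \<Longrightarrow> H i j = H j i"
    and op: "op_le d h H" and h: "0 \<le> h" and ab: "a + b = 2 * q"
  shows "(\<Sum>i<d. \<Sum>j<d. H i j * mm d (mm d (mpow d A a) H) (mpow d A b) j i) \<le> h\<^sup>2 * (\<Sum>l<d. \<mu> l ^ (2 * q))"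
proof -
  define g where "g l m = ip d (e l) (mv d H (e m))" for l m
  have gsym: "g l m = g m l" for l m
    unfolding g_def using ip_mv_symmetric[of d H "e l" "e m", OF sym] by (simp add: ip_commute)
  have ent: "mm d (mm d (mpow d A a) H) (mpow d A b) j i
      = (\<Sum>p\<in>{..<d} \<times> {..<d}. (\<mu> (fst p) ^ a * \<mu> (snd p) ^ b * g (fst p) (snd p)) * e (snd p) i * e (fst p) j)"
    if ij: "i < d" "j < d" for i j
  proof -
    have "mm d (mm d (mpow d A a) H) (mpow d A b) j i
      = (\<Sum>y<d. (\<Sum>x<d. (\<Sum>l<d. \<mu> l ^ a * e l j * e l x) * H x y) * (\<Sum>m<d. \<mu> m ^ b * e m y * e m i))"
      unfolding mm_def using ij by (intro sum.cong refl) (simp add: mpow_eigenbasis[of d e A \<mu>, OF on A])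
    also have "\<dots> = (\<Sum>y<d. \<Sum>x<d. \<Sum>l<d. \<Sum>m<d. (\<mu> l ^ a * \<mu> m ^ b * e l j * e m i) * (e l x * (H x y * e m y)))"
      by (simp add: sum_distrib_left sum_distrib_right algebra_simps)
    also have "\<dots> = (\<Sum>y<d. \<Sum>l<d. \<Sum>x<d. \<Sum>m<d. (\<mu> l ^ a * \<mu> m ^ b * e l j * e m i) * (e l x * (H x y * e m y)))"
      by (intro sum.cong refl sum.swap)
    also have "\<dots> = (\<Sum>l<d. \<Sum>y<d. \<Sum>x<d. \<Sum>m<d. (\<mu> l ^ a * \<mu> m ^ b * e l j * e m i) * (e l x * (H x y * e m y)))"
      by (rule sum.swap)
    also have "\<dots> = (\<Sum>l<d. \<Sum>y<d. \<Sum>m<d. \<Sum>x<d. (\<mu> l ^ a * \<mu> m ^ b * e l j * e m i) * (e l x * (H x y * e m y)))"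
      by (intro sum.cong refl sum.swap)
    also have "\<dots> = (\<Sum>l<d. \<Sum>m<d. \<Sum>y<d. \<Sum>x<d. (\<mu> l ^ a * \<mu> m ^ b * e l j * e m i) * (e l x * (H x y * e m y)))"
      by (intro sum.cong refl sum.swap)
    also have "\<dots> = (\<Sum>l<d. \<Sum>m<d. \<Sum>x<d. \<Sum>y<d. (\<mu> l ^ a * \<mu> m ^ b * e l j * e m i) * (e l x * (H x y * e m y)))"
      by (intro sum.cong refl sum.swap)
    also have "\<dots> = (\<Sum>l<d. \<Sum>m<d. (\<mu> l ^ a * \<mu> m ^ b * g l m) * e m i * e l j)"
      by (simp add: g_def ip_def mv_def sum_distrib_left sum_distrib_right algebra_simps)
    finally show ?thesis by (simp add: sum.cartesian_product case_prod_unfold)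
  qed
  have "(\<Sum>i<d. \<Sum>j<d. H i j * mm d (mm d (mpow d A a) H) (mpow d A b) j i)
      = minner d H (\<lambda>i j. mm d (mm d (mpow d A a) H) (mpow d A b) j i)" by (simp add: minner_def)
  also have "\<dots> = (\<Sum>p\<in>{..<d} \<times> {..<d}. (\<mu> (fst p) ^ a * \<mu> (snd p) ^ b * g (fst p) (snd p)) * ip d (e (snd p)) (mv d H (e (fst p))))"
    by (rule minner_rank_one_sum) (rule ent)
  also have "\<dots> = (\<Sum>l<d. \<Sum>m<d. \<mu> l ^ a * \<mu> m ^ b * (g l m)\<^sup>2)"
    by (simp add: sum.cartesian_product case_prod_unfold g_def[symmetric] gsym power2_eq_square mult.assoc)
  finally have eq: "(\<Sum>i<d. \<Sum>j<d. H i j * mm d (mm d (mpow d A a) H) (mpow d A b) j i)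
      = (\<Sum>l<d. \<Sum>m<d. \<mu> l ^ a * \<mu> m ^ b * (g l m)\<^sup>2)" (is "?L = ?R") .
  have "?R = (\<Sum>m<d. \<Sum>l<d. \<mu> l ^ a * \<mu> m ^ b * (g l m)\<^sup>2)" by (rule sum.swap)
  then have eq2: "?R = (\<Sum>l<d. \<Sum>m<d. \<mu> m ^ a * \<mu> l ^ b * (g l m)\<^sup>2)" by (simp add: gsym)
  have row: "(\<Sum>m<d. (g l m)\<^sup>2) \<le> h\<^sup>2" if "l < d" for l
  proof -
    have "g l m = ip d (e m) (mv d H (e l))" for m
      unfolding g_def by (rule gsym[unfolded g_def])
    then have "(\<Sum>m<d. (g l m)\<^sup>2) = (\<Sum>m<d. ip d (e m) (mv d H (e l)) * ip d (e m) (mv d H (e l)))"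
      by (simp add: power2_eq_square)
    also have "\<dots> = (vnorm d (mv d H (e l)))\<^sup>2" unfolding vnorm_power2 by (rule Parseval[OF on])
    also have "\<dots> \<le> h\<^sup>2"
      using op_le_vnorm_mv[OF op h, of "e l"] orthonormal_vnorm[OF on, of l] that by (intro power_mono) auto
    finally show ?thesis .
  qed
  have "2 * ?R = (\<Sum>l<d. \<Sum>m<d. (\<mu> l ^ a * \<mu> m ^ b + \<mu> m ^ a * \<mu> l ^ b) * (g l m)\<^sup>2)"
    using eq2 by (simp add: sum.distrib distrib_right)
  also have "\<dots> \<le> (\<Sum>l<d. \<Sum>m<d. (\<mu> l ^ (2 * q) + \<mu> m ^ (2 * q)) * (g l m)\<^sup>2)"
    by (intro sum_mono mult_right_mono mult_powers_le[OF ab]) auto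
  also have "\<dots> = (\<Sum>l<d. \<Sum>m<d. \<mu> l ^ (2 * q) * (g l m)\<^sup>2) + (\<Sum>l<d. \<Sum>m<d. \<mu> m ^ (2 * q) * (g l m)\<^sup>2)"
    by (simp add: sum.distrib distrib_right)
  also have "(\<Sum>l<d. \<Sum>m<d. \<mu> m ^ (2 * q) * (g l m)\<^sup>2) = (\<Sum>l<d. \<Sum>m<d. \<mu> l ^ (2 * q) * (g l m)\<^sup>2)"
    by (subst sum.swap) (simp add: gsym)
  finally have "?R \<le> (\<Sum>l<d. \<Sum>m<d. \<mu> l ^ (2 * q) * (g l m)\<^sup>2)" by linarith
  also have "\<dots> = (\<Sum>l<d. \<mu> l ^ (2 * q) * (\<Sum>m<d. (g l m)\<^sup>2))" by (simp only: sum_distrib_left)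
  also have "\<dots> \<le> (\<Sum>l<d. \<mu> l ^ (2 * q) * h\<^sup>2)"
    by (intro sum_mono mult_left_mono row) auto
  finally show ?thesis unfolding eq by (simp add: sum_distrib_left mult.commute)
qed

text \<open>The squared Schatten \<open>2 k\<close>-norm; \<open>\<kappa>\<close> keeps it differentiable at \<open>A = 0\<close>.\<close>

definition pot :: "nat \<Rightarrow> nat \<Rightarrow> real \<Rightarrow> (nat \<Rightarrow> nat \<Rightarrow> real) \<Rightarrow> real" where
  "pot d k \<kappa> A = (tr d (mpow d A (2 * k)) + \<kappa>) powr (1 / real k)"

text \<open>The derivative of \<open>pot\<close> at \<open>A\<close> in direction \<open>H\<close>;
  the factor 2 is \<open>2 * k\<close>, from the trace of a power, times the outer
  \<open>1 / k\<close>.\<close>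

definition pot_grad :: "nat \<Rightarrow> nat \<Rightarrow> real \<Rightarrow> (nat \<Rightarrow> nat \<Rightarrow> real) \<Rightarrow> (nat \<Rightarrow> nat \<Rightarrow> real) \<Rightarrow> real" where
  "pot_grad d k \<kappa> A H = 2 * (tr d (mpow d A (2 * k)) + \<kappa>) powr (1 / real k - 1)
     * (\<Sum>i<d. \<Sum>j<d. H i j * mpow d A (2 * k - 1) j i)"

lemma tr_mpow_even_nonneg:
  assumes sym: "\<And>i j. i < d \<Longrightarrow> j < d \<Longrightarrow> A i j = A j i"
  shows "0 \<le> tr d (mpow d A (2 * k))"
proof -
  obtain e \<mu> where e: "orthonormal_on d {..<d} e"
    "\<And>i j. i < d \<Longrightarrow> j < d \<Longrightarrow> A i j = (\<Sum>l<d. \<mu> l * e l i * e l j)"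
    using symmetric_decomposition[of d A] sym by blast
  have "tr d (mpow d A (2 * k)) = (\<Sum>l<d. \<mu> l ^ (2 * k))" by (rule tr_mpow_eigenbasis[OF e])
  then show ?thesis by (simp add: sum_nonneg)
qed

text \<open>The largest eigenvalue to the power \<open>2 * k\<close> is one summand of the trace;
  this is the comparison of the spectral norm with a Schatten norm.\<close>

lemma op_le_sqrt_pot:
  assumes sym: "\<And>i j. i < d \<Longrightarrow> j < d \<Longrightarrow> A i j = A j i" and k: "1 \<le> k" and \<kappa>: "0 < \<kappa>"
  shows "op_le d (sqrt (pot d k \<kappa> A)) A"
proof -
  obtain e \<mu> where on: "orthonormal_on d {..<d} e"
    and A: "\<And>i j. i < d \<Longrightarrow> j < d \<Longrightarrow> A i j = (\<Sum>l<d. \<mu> l * e l i * e l j)"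
    using symmetric_decomposition[of d A] sym by blast
  define F where "F = tr d (mpow d A (2 * k)) + \<kappa>"
  have F: "F > 0" using tr_mpow_even_nonneg[of d A k, OF sym] \<kappa> by (simp add: F_def)
  have potk: "pot d k \<kappa> A ^ k = F"
    using F k by (simp add: pot_def F_def[symmetric] powr_power)
  have mu: "\<bar>\<mu> l\<bar> \<le> sqrt (pot d k \<kappa> A)" if "l < d" for l
  proof -
    have "\<mu> l ^ (2 * k) \<le> (\<Sum>l<d. \<mu> l ^ (2 * k))" using that by (intro member_le_sum) auto
    also have "\<dots> \<le> F" using \<kappa> by (simp add: F_def tr_mpow_eigenbasis[of d e A \<mu>, OF on A])
    finally have "((\<mu> l)\<^sup>2) ^ k \<le> pot d k \<kappa> A ^ k" by (simp add: potk power_mult)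
    then have "(\<mu> l)\<^sup>2 \<le> pot d k \<kappa> A"
      using power_mono_iff[of "(\<mu> l)\<^sup>2" "pot d k \<kappa> A" k] k by (simp add: pot_def)
    then show ?thesis by (simp add: real_le_rsqrt)
  qed
  show ?thesis
    unfolding op_le_def
  proof (intro allI)
    fix x y
    have "ip d x (mv d A y) = ip d x (mv d (\<lambda>i j. \<Sum>l<d. (\<mu> l * e l i) * e l j) y)"
      by (rule ip_cong) (auto simp: mv_def A)
    also have "\<dots> = (\<Sum>l<d. \<mu> l * (ip d (e l) x * ip d (e l) y))"
      unfolding ip_mv_rank_one_sum ip_scale_right by (simp add: ip_commute[of d x] mult.assoc)
    also have "\<dots> \<le> (\<Sum>l<d. sqrt (pot d k \<kappa> A) * (\<bar>ip d (e l) x\<bar> * \<bar>ip d (e l) y\<bar>))"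
    proof (rule sum_mono)
      fix l assume "l \<in> {..<d}"
      then have "\<bar>\<mu> l\<bar> * (\<bar>ip d (e l) x\<bar> * \<bar>ip d (e l) y\<bar>) \<le> sqrt (pot d k \<kappa> A) * (\<bar>ip d (e l) x\<bar> * \<bar>ip d (e l) y\<bar>)"
        using mu by (intro mult_right_mono) auto
      then show "\<mu> l * (ip d (e l) x * ip d (e l) y) \<le> sqrt (pot d k \<kappa> A) * (\<bar>ip d (e l) x\<bar> * \<bar>ip d (e l) y\<bar>)"
        using abs_ge_self[of "\<mu> l * (ip d (e l) x * ip d (e l) y)"] by (simp add: abs_mult)
    qed
    also have "\<dots> = sqrt (pot d k \<kappa> A) * ip d (\<lambda>l. \<bar>ip d (e l) x\<bar>) (\<lambda>l. \<bar>ip d (e l) y\<bar>)"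
      by (simp add: ip_def[of d "\<lambda>l. \<bar>ip d (e l) x\<bar>"] sum_distrib_left)
    also have "\<dots> \<le> sqrt (pot d k \<kappa> A) * (vnorm d x * vnorm d y)"
    proof (rule mult_left_mono)
      have p: "vnorm d (\<lambda>l. \<bar>ip d (e l) x\<bar>) = vnorm d x" for x
        using Parseval[OF on, of x x] by (simp add: vnorm_ip ip_def[of d "\<lambda>l. \<bar>ip d (e l) x\<bar>"] abs_mult_self_eq)
      show "ip d (\<lambda>l. \<bar>ip d (e l) x\<bar>) (\<lambda>l. \<bar>ip d (e l) y\<bar>) \<le> vnorm d x * vnorm d y"
        using ip_Cauchy_Schwarz[of d "\<lambda>l. \<bar>ip d (e l) x\<bar>" "\<lambda>l. \<bar>ip d (e l) y\<bar>"] by (simp add: p)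
    qed (simp add: pot_def)
    finally show "ip d x (mv d A y) \<le> sqrt (pot d k \<kappa> A) * vnorm d x * vnorm d y" by (simp add: mult.assoc)
  qed
qed


text \<open>Lowers the degree of a power sum by one at the price of a free level \<open>Q\<close>.
  With \<open>Q ^ Suc k\<close> close to the mean of the terms only a factor 2 is lost, which stands
  in for the power mean inequality.\<close>

lemma power_pred_le:
  fixes y Q :: real
  assumes "0 \<le> y" "0 < Q"
  shows "y ^ k \<le> (y ^ Suc k + Q ^ Suc k) / Q"
proof -
  have "y ^ k * Q \<le> y ^ Suc k + Q ^ Suc k"
  proof (cases "y \<le> Q")
    case True
    then have "y ^ k * Q \<le> Q ^ k * Q" using assms by (intro mult_right_mono power_mono) auto
    then show ?thesis using zero_le_power[OF assms(1), of "Suc k"] by (simp add: mult.commute)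
  next
    case False
    then have "y ^ k * Q \<le> y ^ k * y" using assms by (intro mult_left_mono) auto
    moreover have "0 \<le> Q ^ Suc k" using assms by simp
    ultimately show ?thesis by (simp add: mult.commute)
  qed
  then show ?thesis using assms by (simp add: pos_le_divide_eq)
qed

text \<open>A Schatten exponent of the order of the logarithm of the dimension turns the dimension
  factor into an absolute constant.\<close>

lemma powr_one_div_le_3:
  assumes "0 < (x::real)" "ln x \<le> real k" "1 \<le> k"
  shows "x powr (1 / real k) \<le> 3"
proof -
  have "ln x / real k \<le> 1" using assms by (simp add: field_simps)
  then have "x powr (1 / real k) \<le> exp 1" using assms by (simp add: powr_def)
  also have "exp 1 \<le> (3::real)" using exp_le by simp
  finally show ?thesis .
qed

text \<open>Along \<open>A + t H\<close> the second derivative of \<open>f powr (1 / k)\<close> has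
  a term in the square of \<open>f1\<close>, whose coefficient is nonpositive, and a term in
  \<open>f2\<close>, which \<open>tr_sandwich_le\<close> controls. The latter is at most
  \<open>24 * k * h\<^sup>2\<close>, and two integrations halve the constant.\<close>

lemma pot_smooth:
  assumes symA: "\<And>i j. i < d \<Longrightarrow> j < d \<Longrightarrow> A i j = A j i"
    and symH: "\<And>i j. i < d \<Longrightarrow> j < d \<Longrightarrow> H i j = H j i"
    and op: "op_le d h H" and h: "0 \<le> h" and k: "1 \<le> k" and \<kappa>: "0 < \<kappa>"
    and d: "1 \<le> d" and dk: "ln (real d) \<le> real k"
  shows "pot d k \<kappa> (\<lambda>i j. A i j + H i j) \<le> pot d k \<kappa> A + pot_grad d k \<kappa> A H + 12 * real k * h\<^sup>2"
proof -
  define At where "At t = (\<lambda>i j. A i j + t * H i j)" for t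
  define f where "f t = tr d (mpow d (At t) (2 * k)) + \<kappa>" for t
  define f1 where "f1 t = 2 * real k * (\<Sum>i<d. \<Sum>j<d. H i j * mpow d (At t) (2 * k - 1) j i)" for t
  define f2 where "f2 t = 2 * real k * (\<Sum>i<d. \<Sum>j<d. H i j * dpow d (At t) H (2 * k - 1) j i)" for t
  have symt: "At t i j = At t j i" if "i < d" "j < d" for t i j using that symA symH by (simp add: At_def)
  have fpos: "f t > 0" for t using tr_mpow_even_nonneg[of d "At t" k] symt \<kappa> by (fastforce simp: f_def)
  have Df: "(f has_real_derivative f1 t) (at t)" for t
  proof -
    have "((\<lambda>t. (\<Sum>i<d. mpow d (At t) (2 * k) i i) + \<kappa>) has_real_derivative (\<Sum>i<d. dpow d (At t) H (2 * k) i i)) (at t)"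
      unfolding At_def by (auto intro!: derivative_eq_intros DERIV_sum mpow_has_derivative)
    moreover have "(\<Sum>i<d. dpow d (At t) H (2 * k) i i) = f1 t"
    proof -
      have "(\<Sum>i<d. dpow d (At t) H (2 * k) i i)
          = (\<Sum>a<2 * k. tr d (mm d (mm d (mpow d (At t) a) H) (mpow d (At t) (2 * k - 1 - a))))"
        unfolding dpow_def tr_def by (rule sum.swap)
      also have "\<dots> = (\<Sum>a<2 * k. \<Sum>i<d. \<Sum>j<d. H i j * mpow d (At t) (2 * k - 1) j i)"
      proof (intro sum.cong refl)
        fix a assume "a \<in> {..<2 * k}"
        then have "2 * k - 1 - a + a = 2 * k - 1" by auto
        then show "tr d (mm d (mm d (mpow d (At t) a) H) (mpow d (At t) (2 * k - 1 - a)))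
          = (\<Sum>i<d. \<Sum>j<d. H i j * mpow d (At t) (2 * k - 1) j i)"
          unfolding tr_cyclic by (intro sum.cong refl) (simp add: mpow_add)
      qed
      finally show ?thesis by (simp add: f1_def)
    qed
    ultimately show ?thesis unfolding f_def tr_def by simp
  qed
  have Df1: "(f1 has_real_derivative f2 t) (at t)" for t
    unfolding f1_def f2_def At_def
    by (intro DERIV_cmult DERIV_sum mpow_has_derivative) auto
  have f2le: "f2 t \<le> 2 * real k * (2 * real k - 1) * h\<^sup>2 * (2 * f t / (f t / real d) powr (1 / real k))" for t
  proof -
    obtain e \<mu> where on: "orthonormal_on d {..<d} e"
      and A: "\<And>i j. i < d \<Longrightarrow> j < d \<Longrightarrow> At t i j = (\<Sum>l<d. \<mu> l * e l i * e l j)"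
      using symmetric_decomposition[of d "At t"] symt by blast
    \<comment> \<open>Chosen so that \<open>d\<close> copies of \<open>Q ^ k\<close> add up to
      \<open>f t\<close>.\<close>
    define Q where "Q = (f t / real d) powr (1 / real k)"
    have Qk: "Q ^ k = f t / real d" and Q: "Q > 0"
      using fpos[of t] d k by (auto simp: Q_def powr_power)
    have trk: "tr d (mpow d (At t) (2 * k)) = (\<Sum>l<d. \<mu> l ^ (2 * k))" by (rule tr_mpow_eigenbasis[OF on A])
    have Sk: "Suc (k - 1) = k" using k by simp
    have "(\<Sum>l<d. \<mu> l ^ (2 * (k - 1))) \<le> (\<Sum>l<d. (\<mu> l ^ (2 * k) + Q ^ k) / Q)"
    proof (rule sum_mono)
      fix l
      show "\<mu> l ^ (2 * (k - 1)) \<le> (\<mu> l ^ (2 * k) + Q ^ k) / Q"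
        using power_pred_le[of "(\<mu> l)\<^sup>2" Q "k - 1"] Q unfolding Sk by (simp add: power_mult)
    qed
    also have "\<dots> = ((\<Sum>l<d. \<mu> l ^ (2 * k)) + f t) / Q"
      using d by (simp add: sum_divide_distrib[symmetric] sum.distrib Qk)
    also have "\<dots> \<le> 2 * f t / Q" using Q \<kappa> by (intro divide_right_mono) (auto simp: f_def trk)
    finally have low: "(\<Sum>l<d. \<mu> l ^ (2 * (k - 1))) \<le> 2 * f t / Q" .
    have "(\<Sum>i<d. \<Sum>j<d. H i j * dpow d (At t) H (2 * k - 1) j i)
        = (\<Sum>i<d. \<Sum>j<d. \<Sum>a<2 * k - 1. H i j * mm d (mm d (mpow d (At t) a) H) (mpow d (At t) (2 * k - 1 - 1 - a)) j i)"
      by (simp add: dpow_def sum_distrib_left)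
    also have "\<dots> = (\<Sum>i<d. \<Sum>a<2 * k - 1. \<Sum>j<d. H i j * mm d (mm d (mpow d (At t) a) H) (mpow d (At t) (2 * k - 1 - 1 - a)) j i)"
      by (intro sum.cong refl sum.swap)
    also have "\<dots> = (\<Sum>a<2 * k - 1. \<Sum>i<d. \<Sum>j<d. H i j * mm d (mm d (mpow d (At t) a) H) (mpow d (At t) (2 * k - 1 - 1 - a)) j i)"
      by (rule sum.swap)
    also have "\<dots> \<le> (\<Sum>a<2 * k - 1. h\<^sup>2 * (\<Sum>l<d. \<mu> l ^ (2 * (k - 1))))"
    proof (rule sum_mono)
      fix a assume "a \<in> {..<2 * k - 1}"
      then have ab: "a + (2 * k - 1 - 1 - a) = 2 * (k - 1)" by auto
      show "(\<Sum>i<d. \<Sum>j<d. H i j * mm d (mm d (mpow d (At t) a) H) (mpow d (At t) (2 * k - 1 - 1 - a)) j i)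
          \<le> h\<^sup>2 * (\<Sum>l<d. \<mu> l ^ (2 * (k - 1)))"
        by (rule tr_sandwich_le[OF on A symH op h ab])
    qed
    also have "\<dots> = (2 * real k - 1) * h\<^sup>2 * (\<Sum>l<d. \<mu> l ^ (2 * (k - 1)))"
      using k by (simp add: of_nat_diff)
    also have "\<dots> \<le> (2 * real k - 1) * h\<^sup>2 * (2 * f t / Q)"
      using k low by (intro mult_left_mono) auto
    finally have "2 * real k * (\<Sum>i<d. \<Sum>j<d. H i j * dpow d (At t) H (2 * k - 1) j i)
        \<le> 2 * real k * ((2 * real k - 1) * h\<^sup>2 * (2 * f t / Q))" by (intro mult_left_mono) auto
    then show ?thesis unfolding f2_def Q_def by (simp only: mult.assoc)
  qed
  define g where "g t = f t powr (1 / real k)" for t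
  define g1 where "g1 t = 1 / real k * f t powr (1 / real k - 1) * f1 t" for t
  define g2 where "g2 t = 1 / real k * ((1 / real k - 1) * f t powr (1 / real k - 1 - 1) * f1 t) * f1 t
      + 1 / real k * f t powr (1 / real k - 1) * f2 t" for t
  have Dp: "((\<lambda>t. f t powr c) has_real_derivative c * f t powr (c - 1) * f1 t) (at t)" for c t
    by (rule DERIV_chain2[where f = "\<lambda>x. x powr c" and g = f, OF has_real_derivative_powr[OF fpos] Df])
  have Dg: "(g has_real_derivative g1 t) (at t)" for t
    unfolding g_def g1_def by (rule Dp)
  have Dg1: "(g1 has_real_derivative g2 t) (at t)" for t
    unfolding g1_def g2_def by (rule derivative_eq_intros Dp Df1 refl | simp)+
  have g2le: "g2 t \<le> 24 * real k * h\<^sup>2" for t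
  proof -
    have "1 / real k * ((1 / real k - 1) * f t powr (1 / real k - 1 - 1) * f1 t) * f1 t
        = (1 / real k - 1) * (1 / real k * f t powr (1 / real k - 1 - 1) * (f1 t)\<^sup>2)"
      by (simp add: power2_eq_square)
    also have "\<dots> \<le> 0" using k by (intro mult_nonpos_nonneg) auto
    finally have "g2 t \<le> 1 / real k * f t powr (1 / real k - 1) * f2 t" by (simp add: g2_def)
    also have "\<dots> \<le> 1 / real k * f t powr (1 / real k - 1) *
        (2 * real k * (2 * real k - 1) * h\<^sup>2 * (2 * f t / (f t / real d) powr (1 / real k)))"
      by (intro mult_left_mono f2le) auto
    also have "\<dots> = 4 * (2 * real k - 1) * h\<^sup>2 * (f t powr (1 / real k - 1) * f t / (f t / real d) powr (1 / real k))"
    proof -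
      have "1 / c * a * (2 * c * b * e * (2 * F / q)) = 4 * b * e * (a * F / q)" if "c > 0" for a b c e F q :: real
        using that by simp
      then show ?thesis using k by simp
    qed
    also have "f t powr (1 / real k - 1) * f t = f t powr (1 / real k)"
      using fpos[of t] by (simp add: powr_diff)
    also have "f t powr (1 / real k) / (f t / real d) powr (1 / real k) = real d powr (1 / real k)"
      using fpos[of t] d by (simp add: powr_divide)
    also have "4 * (2 * real k - 1) * h\<^sup>2 * real d powr (1 / real k) \<le> 4 * (2 * real k) * h\<^sup>2 * 3"
      using d k dk by (intro mult_mono powr_one_div_le_3) auto
    finally show ?thesis by simp
  qed
  have g1le: "g1 t \<le> g1 0 + 24 * real k * h\<^sup>2 * t" if "0 \<le> t" for t
  proof -
    have "g1 t - 24 * real k * h\<^sup>2 * t \<le> g1 0 - 24 * real k * h\<^sup>2 * 0"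
    proof (rule DERIV_nonpos_imp_nonincreasing[OF that])
      fix x
      have "((\<lambda>t. g1 t - 24 * real k * h\<^sup>2 * t) has_real_derivative g2 x - 24 * real k * h\<^sup>2) (at x)"
        by (rule derivative_eq_intros Dg1 refl | simp)+
      then show "\<exists>y. ((\<lambda>t. g1 t - 24 * real k * h\<^sup>2 * t) has_real_derivative y) (at x) \<and> y \<le> 0"
        using g2le[of x] by (intro exI[of _ "g2 x - 24 * real k * h\<^sup>2"]) auto
    qed
    then show ?thesis by simp
  qed
  \<comment> \<open>Subtracting the first-order part and the quadratic bound leaves a function with
    nonpositive derivative on the unit interval.\<close>
  have "g 1 - g1 0 * 1 - 12 * real k * h\<^sup>2 * 1\<^sup>2 \<le> g 0 - g1 0 * 0 - 12 * real k * h\<^sup>2 * 0\<^sup>2"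
  proof (rule DERIV_nonpos_imp_nonincreasing[of 0 1 "\<lambda>t. g t - g1 0 * t - 12 * real k * h\<^sup>2 * t\<^sup>2"])
    fix x :: real assume x: "0 \<le> x" "x \<le> 1"
    have "((\<lambda>t. g t - g1 0 * t - 12 * real k * h\<^sup>2 * t\<^sup>2) has_real_derivative
        g1 x - g1 0 - 12 * real k * h\<^sup>2 * (2 * x)) (at x)"
      by (rule derivative_eq_intros Dg refl | simp)+
    then show "\<exists>y. ((\<lambda>t. g t - g1 0 * t - 12 * real k * h\<^sup>2 * t\<^sup>2) has_real_derivative y) (at x) \<and> y \<le> 0"
      using g1le[OF x(1)] by (intro exI[of _ "g1 x - g1 0 - 12 * real k * h\<^sup>2 * (2 * x)"]) auto
  qed simp
  moreover have "g 1 = pot d k \<kappa> (\<lambda>i j. A i j + H i j)" "g 0 = pot d k \<kappa> A" "g1 0 = pot_grad d k \<kappa> A H"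
    using k by (simp_all add: g_def g1_def f_def f1_def pot_def pot_grad_def At_def)
  ultimately show ?thesis by simp
qed


text \<open>The symmetric dilation with zero diagonal blocks and off-diagonal blocks \<open>B\<close>, \<open>B\<^sup>T\<close>.\<close>

definition dil :: "nat \<Rightarrow> (nat \<Rightarrow> nat \<Rightarrow> real) \<Rightarrow> nat \<Rightarrow> nat \<Rightarrow> real" where
  "dil n B = (\<lambda>i j. if i < n \<and> n \<le> j then B i (j - n) else if n \<le> i \<and> j < n then B j (i - n) else 0)"

lemma dil_symmetric: "dil n B i j = dil n B j i"
  by (simp add: dil_def)

lemma dil_add_scale: "dil n (\<lambda>i j. A i j + c * B i j) = (\<lambda>i j. dil n A i j + c * dil n B i j)"
  by (intro ext) (simp add: dil_def)

lemma sum_lessThan_double: "(\<Sum>i<2 * n. f i) = (\<Sum>i<n. f i) + (\<Sum>i<n. f (i + n) :: real)" for n :: nat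
proof -
  have "(\<Sum>i<2 * n. f i) = sum f {0..<n} + sum f {n..<n + n}"
    by (simp add: sum.atLeastLessThan_concat lessThan_atLeast0 mult_2)
  also have "sum f {n..<n + n} = (\<Sum>i<n. f (i + n))"
    using sum.shift_bounds_nat_ivl[of f 0 n n] by (simp add: lessThan_atLeast0)
  finally show ?thesis by (simp add: lessThan_atLeast0)
qed

lemma ip_double: "ip (2 * n) x y = ip n x y + ip n (\<lambda>i. x (i + n)) (\<lambda>i. y (i + n))"
  by (simp add: ip_def sum_lessThan_double)

lemma ip_mv_dil:
  "ip (2 * n) x (mv (2 * n) (dil n B) y)
    = ip n x (mv n B (\<lambda>j. y (j + n))) + ip n y (mv n B (\<lambda>i. x (i + n)))"
proof -
  have "ip (2 * n) x (mv (2 * n) (dil n B) y)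
      = ip n x (mv n B (\<lambda>j. y (j + n))) + ip n (\<lambda>i. x (i + n)) (mv n (\<lambda>i j. B j i) y)"
    unfolding ip_double by (intro arg_cong2[where f = "(+)"] ip_cong) (simp_all add: mv_def sum_lessThan_double dil_def)
  also have "ip n (\<lambda>i. x (i + n)) (mv n (\<lambda>i j. B j i) y) = ip n y (mv n B (\<lambda>i. x (i + n)))"
    unfolding ip_mv_transpose[of n y] by (rule ip_commute)
  finally show ?thesis .
qed

lemma op_le_dil:
  assumes "op_le n c B" "0 \<le> c"
  shows "op_le (2 * n) c (dil n B)"
  unfolding op_le_def
proof (intro allI)
  fix x y :: "nat \<Rightarrow> real"
  let ?x = "\<lambda>i. x (i + n)" and ?y = "\<lambda>i. y (i + n)"
  have nrm: "vnorm (2 * n) z = sqrt ((vnorm n z)\<^sup>2 + (vnorm n (\<lambda>i. z (i + n)))\<^sup>2)" for z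
    unfolding vnorm_power2 by (simp add: vnorm_ip ip_double)
  have "ip (2 * n) x (mv (2 * n) (dil n B) y) \<le> c * vnorm n x * vnorm n ?y + c * vnorm n y * vnorm n ?x"
    unfolding ip_mv_dil by (intro add_mono op_leD[OF assms(1)])
  also have "\<dots> = c * (vnorm n x * vnorm n ?y + vnorm n ?x * vnorm n y)" by (simp add: algebra_simps)
  also have "\<dots> \<le> c * (sqrt ((vnorm n x)\<^sup>2 + (vnorm n ?x)\<^sup>2) * sqrt ((vnorm n ?y)\<^sup>2 + (vnorm n y)\<^sup>2))"
    using assms(2) by (intro mult_left_mono mult_add_le_sqrt) auto
  finally show "ip (2 * n) x (mv (2 * n) (dil n B) y) \<le> c * vnorm (2 * n) x * vnorm (2 * n) y"
    unfolding nrm by (simp add: mult.assoc add.commute)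
qed

lemma op_le_of_dil:
  assumes "op_le (2 * n) c (dil n B)"
  shows "op_le n c B"
  unfolding op_le_def
proof (intro allI)
  fix x y :: "nat \<Rightarrow> real"
  \<comment> \<open>With \<open>x\<close> in the first block and \<open>y\<close> in the second, the
    other term of \<open>ip_mv_dil\<close> vanishes.\<close>
  define x' where "x' = (\<lambda>i. if i < n then x i else 0)"
  define y' where "y' = (\<lambda>i. if i < n then 0 else y (i - n))"
  have "ip n x' (mv n B (\<lambda>j. y' (j + n))) + ip n y' (mv n B (\<lambda>i. x' (i + n))) = ip n x (mv n B y)"
    by (simp add: ip_def x'_def y'_def)
  moreover have "vnorm (2 * n) x' = vnorm n x" "vnorm (2 * n) y' = vnorm n y"
    by (simp_all add: vnorm_ip ip_double) (simp_all add: ip_def x'_def y'_def)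
  ultimately show "ip n x (mv n B y) \<le> c * vnorm n x * vnorm n y"
    using op_leD[OF assms, of x' y'] by (simp add: ip_mv_dil)
qed

lemma op_le_scale:
  assumes "op_le n c A"
  shows "op_le n (\<bar>t\<bar> * c) (\<lambda>i j. t * A i j)"
  unfolding op_le_def
proof (intro allI)
  fix x y
  have mvt: "ip n x (mv n (\<lambda>i j. t * A i j) y) = t * ip n x (mv n A y)"
  proof -
    have "mv n (\<lambda>i j. t * A i j) y = (\<lambda>i. t * mv n A y i)" by (simp add: mv_def sum_distrib_left mult.assoc)
    then show ?thesis by (simp only: ip_scale_right)
  qed
  have neg: "- ip n x (mv n A y) \<le> c * vnorm n x * vnorm n y"
  proof -
    have "ip n (\<lambda>i. - 1 * x i) (mv n A y) \<le> c * vnorm n (\<lambda>i. - 1 * x i) * vnorm n y" by (rule op_leD[OF assms])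
    then show ?thesis unfolding vnorm_ip ip_scale_left ip_scale_right by simp
  qed
  have "t * ip n x (mv n A y) \<le> \<bar>t\<bar> * (c * vnorm n x * vnorm n y)"
  proof (cases "0 \<le> t")
    case True
    then show ?thesis using op_leD[OF assms, of x y] by (simp add: mult_left_mono)
  next
    case False
    then show ?thesis using mult_left_mono[OF neg, of "- t"] by simp
  qed
  then show "ip n x (mv n (\<lambda>i j. t * A i j) y) \<le> \<bar>t\<bar> * c * vnorm n x * vnorm n y"
    unfolding mvt by (simp add: mult.assoc)
qed

lemma pot_grad_scale: "pot_grad d k \<kappa> A (\<lambda>i j. c * H i j) = c * pot_grad d k \<kappa> A H"
  by (simp add: pot_grad_def sum_distrib_left algebra_simps)

lemma tr_mpow_zero: "1 \<le> m \<Longrightarrow> tr d (mpow d (\<lambda>i j. 0) m) = 0"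
  by (cases m) (simp_all add: tr_def mm_def)

lemma sum_powers_le: "(\<Sum>i\<le>T. a ^ i) \<le> (a + 1) ^ T" for a :: nat
proof (induction T)
  case (Suc T)
  have "a ^ T \<le> (a + 1) ^ T" by (rule power_mono) auto
  then have "a * a ^ T \<le> a * (a + 1) ^ T" by (rule mult_le_mono2)
  moreover have "(\<Sum>i\<le>Suc T. a ^ i) = (\<Sum>i\<le>T. a ^ i) + a * a ^ T" by simp
  moreover have "(a + 1) ^ Suc T = (a + 1) ^ T + a * (a + 1) ^ T" by (simp add: algebra_simps)
  ultimately show ?case using Suc.IH by linarith
qed simp

text \<open>The matrix \<open>p\<close>-norm perceptron with \<open>p = 2 k \<approx> 2 ln (2 n)\<close>: as long as the current guess is
  off by more than \<open>\<epsilon>\<close> on some measurement, move the dual matrix by \<open>\<plusminus>\<eta>\<close> times that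
  measurement. Every mistake raises \<open>\<langle>A, X\<rangle>\<close> against the potential, so the number of mistakes is
  bounded, and the guess is determined by the list of mistakes.\<close>

lemma nuclear_ball_cover:
  assumes B: "\<And>i. i < m \<Longrightarrow> op_le n K (B i)" and K: "0 < K" and s: "0 < s" and \<epsilon>: "0 < \<epsilon>"
    and n: "1 \<le> n" and k: "1 \<le> k" and nk: "ln (real (2 * n)) \<le> real k"
    and T: "24 * real k * K\<^sup>2 * s\<^sup>2 / \<epsilon>\<^sup>2 \<le> real T"
  shows "\<exists>C :: (nat \<Rightarrow> real) set. finite C \<and> card C \<le> (2 * m + 1) ^ T \<and>
    (\<forall>X. nuc_norm n X \<le> s \<longrightarrow> (\<exists>c\<in>C. \<forall>i<m. \<bar>minner n (B i) X - c i\<bar> \<le> \<epsilon>))"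
proof -
  \<comment> \<open>The maximiser of the gain per mistake,
    \<open>\<eta> * \<epsilon> - 12 * real k * (\<eta> * K)\<^sup>2\<close>, whose value is then
    \<open>\<epsilon>\<^sup>2 / (48 * real k * K\<^sup>2)\<close>.\<close>
  define \<eta> where "\<eta> = \<epsilon> / (24 * real k * K\<^sup>2)"
  \<comment> \<open>Gives the zero matrix the potential \<open>s\<^sup>2 / 4\<close>, which equals
    the loss in the arithmetic-geometric mean step at the end.\<close>
  define \<kappa> where "\<kappa> = (s\<^sup>2 / 4) ^ k"
  define al where "al = {..<m} \<times> {1, - 1 :: real}"
  define st :: "(nat \<times> real) list \<Rightarrow> nat \<Rightarrow> nat \<Rightarrow> real"
    where "st = rec_list (\<lambda>i j. 0) (\<lambda>p xs A i j. A i j + (\<eta> * snd p) * B (fst p) i j)"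
  have st_Nil: "st [] = (\<lambda>i j. 0)" and st_Cons: "st (p # xs) = (\<lambda>i j. st xs i j + (\<eta> * snd p) * B (fst p) i j)" for p xs
    by (simp_all add: st_def)
  define P where "P xs = pot (2 * n) k \<kappa> (dil n (st xs))" for xs
  \<comment> \<open>The guess is the gradient of the potential at the dual matrix, evaluated on the
    measurements. It depends on \<open>X\<close> only through the mistakes, so these vectors can
    serve as centres.\<close>
  define ce where "ce xs = (\<lambda>i. pot_grad (2 * n) k \<kappa> (dil n (st xs)) (dil n (B i)))" for xs
  define L where "L = {xs. set xs \<subseteq> al \<and> length xs \<le> T}"
  have \<kappa>: "0 < \<kappa>" using s by (simp add: \<kappa>_def)
  have \<eta>: "0 < \<eta>" using \<epsilon> k K by (simp add: \<eta>_def)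
  have final: "finite al" and cal: "card al = 2 * m" by (auto simp: al_def card_cartesian_product)
  have finL: "finite L" unfolding L_def by (rule finite_lists_length_le[OF final])
  have cL: "card L \<le> (2 * m + 1) ^ T"
    unfolding L_def card_lists_length_le[OF final] cal by (rule sum_powers_le)
  have "\<exists>xs\<in>L. \<forall>i<m. \<bar>minner n (B i) X - ce xs i\<bar> \<le> \<epsilon>" if X: "nuc_norm n X \<le> s" for X
  proof (rule ccontr)
    assume "\<not> ?thesis"
    then have mistake: "\<exists>i<m. \<bar>minner n (B i) X - ce xs i\<bar> > \<epsilon>" if "xs \<in> L" for xs
      using that by (meson not_le)
    \<comment> \<open>By \<open>pot_smooth\<close> a mistake on \<open>i\<close> raises
      \<open>P\<close> by at most \<open>\<eta> * \<sigma> * ce xs i + 12 * real k * (\<eta> *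
      K)\<^sup>2\<close>, and it raises the pairing with \<open>X\<close> by
      \<open>\<eta> * \<sigma> * minner n (B i) X\<close>; the linear parts differ by more than
      \<open>\<eta> * \<epsilon>\<close>. Every list of length at most \<open>T\<close> is followed
      by a mistake, hence there are \<open>Suc T\<close> of them.\<close>
    have "\<exists>xs. set xs \<subseteq> al \<and> length xs = t \<and>
        P xs + real t * (\<eta> * \<epsilon> - 12 * real k * (\<eta> * K)\<^sup>2) \<le> s\<^sup>2 / 4 + minner n (st xs) X" if "t \<le> Suc T" for t
      using that
    proof (induction t)
      case 0
      have "dil n (st []) = (\<lambda>i j. 0)" by (intro ext) (simp add: st_Nil dil_def)
      then have "P [] = \<kappa> powr (1 / real k)" using k by (simp add: P_def pot_def tr_mpow_zero)
      also have "\<kappa> = (s\<^sup>2 / 4) powr real k" using s by (simp add: \<kappa>_def powr_realpow)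
      also have "\<dots> powr (1 / real k) = s\<^sup>2 / 4" using s k unfolding powr_powr by simp
      finally have "P [] + real 0 * (\<eta> * \<epsilon> - 12 * real k * (\<eta> * K)\<^sup>2) \<le> s\<^sup>2 / 4 + minner n (st []) X"
        by (simp add: st_Nil minner_def)
      then show ?case by (intro exI[of _ "[]"]) simp
    next
      case (Suc t)
      then obtain xs where xs: "set xs \<subseteq> al" "length xs = t"
        and inv: "P xs + real t * (\<eta> * \<epsilon> - 12 * real k * (\<eta> * K)\<^sup>2) \<le> s\<^sup>2 / 4 + minner n (st xs) X" by auto
      have "xs \<in> L" using xs Suc.prems by (simp add: L_def)
      then obtain i where i: "i < m" "\<bar>minner n (B i) X - ce xs i\<bar> > \<epsilon>" using mistake by blast
      define \<sigma> :: real where "\<sigma> = (if minner n (B i) X - ce xs i \<ge> 0 then 1 else - 1)"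
      have \<sigma>: "\<sigma> * (minner n (B i) X - ce xs i) > \<epsilon>" "\<sigma> \<in> {1, - 1}" "\<bar>\<sigma>\<bar> = 1"
        using i(2) by (auto simp: \<sigma>_def abs_if split: if_splits)
      let ?ys = "(i, \<sigma>) # xs"
      have "P ?ys \<le> P xs + pot_grad (2 * n) k \<kappa> (dil n (st xs)) (\<lambda>a b. (\<eta> * \<sigma>) * dil n (B i) a b)
          + 12 * real k * (\<bar>\<eta> * \<sigma>\<bar> * K)\<^sup>2"
        unfolding P_def st_Cons dil_add_scale fst_conv snd_conv
      proof (rule pot_smooth)
        show "op_le (2 * n) (\<bar>\<eta> * \<sigma>\<bar> * K) (\<lambda>a b. \<eta> * \<sigma> * dil n (B i) a b)"
          using K by (intro op_le_scale op_le_dil B i(1)) auto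
        show "dil n (st xs) a b = dil n (st xs) b a" for a b by (rule dil_symmetric)
        show "\<eta> * \<sigma> * dil n (B i) a b = \<eta> * \<sigma> * dil n (B i) b a" for a b by (simp only: dil_symmetric[of n "B i" a b])
      qed (use n k nk K \<kappa> in auto)
      then have "P ?ys \<le> P xs + \<eta> * \<sigma> * ce xs i + 12 * real k * (\<eta> * K)\<^sup>2"
        using \<eta> \<sigma>(3) by (simp add: pot_grad_scale ce_def abs_mult)
      moreover have "minner n (st ?ys) X = minner n (st xs) X + \<eta> * \<sigma> * minner n (B i) X"
        unfolding st_Cons fst_conv snd_conv minner_add_left minner_scale_left ..
      moreover have "\<eta> * \<epsilon> \<le> \<eta> * (\<sigma> * (minner n (B i) X - ce xs i))"
        using \<eta> \<sigma>(1) by (intro mult_left_mono) auto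
      ultimately have "P ?ys + real (Suc t) * (\<eta> * \<epsilon> - 12 * real k * (\<eta> * K)\<^sup>2) \<le> s\<^sup>2 / 4 + minner n (st ?ys) X"
        using inv by (simp add: algebra_simps)
      moreover have "set ?ys \<subseteq> al" using xs i \<sigma> by (auto simp: al_def)
      ultimately show ?case using xs by (intro exI[of _ ?ys]) simp
    qed
    from this[of "Suc T"] obtain xs where
      inv: "P xs + real (Suc T) * (\<eta> * \<epsilon> - 12 * real k * (\<eta> * K)\<^sup>2) \<le> s\<^sup>2 / 4 + minner n (st xs) X"
      by blast
    have P0: "0 \<le> P xs" by (simp add: P_def pot_def)
    have "op_le n (sqrt (P xs)) (st xs)"
      unfolding P_def by (rule op_le_of_dil, rule op_le_sqrt_pot[OF dil_symmetric k \<kappa>])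
    then have "minner n (st xs) X \<le> sqrt (P xs) * nuc_norm n X" by (rule minner_le_nuc_norm)
    also have "\<dots> \<le> sqrt (P xs) * s" using X P0 by (intro mult_left_mono) auto
    \<comment> \<open>This cancels the potential in the invariant: the gain of all mistakes together
      is at most \<open>s\<^sup>2 / 2\<close>, too little for \<open>Suc T\<close> of them.\<close>
    also have "\<dots> \<le> P xs + s\<^sup>2 / 4"
    proof -
      have "2 * sqrt (P xs) * (s / 2) \<le> (sqrt (P xs))\<^sup>2 + (s / 2)\<^sup>2" by (rule sum_squares_bound)
      then show ?thesis using P0 by (simp add: power_divide)
    qed
    finally have "real (Suc T) * (\<eta> * \<epsilon> - 12 * real k * (\<eta> * K)\<^sup>2) \<le> s\<^sup>2 / 2" using inv by simp
    moreover have "\<eta> * \<epsilon> - 12 * real k * (\<eta> * K)\<^sup>2 = \<epsilon>\<^sup>2 / (48 * real k * K\<^sup>2)"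
      using k K by (simp add: \<eta>_def field_simps power2_eq_square)
    ultimately have "real (Suc T) * (\<epsilon>\<^sup>2 / (48 * real k * K\<^sup>2)) \<le> s\<^sup>2 / 2" by simp
    then have "real (Suc T) \<le> 24 * real k * K\<^sup>2 * s\<^sup>2 / \<epsilon>\<^sup>2"
      using k K \<epsilon> by (simp add: field_simps)
    then show False using T by simp
  qed
  moreover have "card (ce ` L) \<le> (2 * m + 1) ^ T" using card_image_le[OF finL, of ce] cL by linarith
  ultimately show ?thesis using finL by (intro exI[of _ "ce ` L"]) auto
qed

subsection \<open>Chaining with random signs\<close>

lemma cosh_le_exp_half_square: "cosh x \<le> exp (x\<^sup>2 / 2)" for x :: real
proof -
  have pos: "cosh x \<le> exp (x\<^sup>2 / 2)" if x: "0 \<le> x" for x :: real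
  proof -
    have k: "0 \<le> y * cosh y - sinh y" if "0 \<le> y" for y :: real
    proof -
      have "0 * cosh 0 - sinh 0 \<le> y * cosh y - sinh y"
      proof (rule DERIV_nonneg_imp_nondecreasing[OF that])
        fix z :: real assume z: "0 \<le> z"
        have "((\<lambda>z. z * cosh z - sinh z) has_real_derivative z * sinh z) (at z)"
          by (auto intro!: derivative_eq_intros)
        then show "\<exists>d. ((\<lambda>z. z * cosh z - sinh z) has_real_derivative d) (at z) \<and> 0 \<le> d"
          using z by (intro exI[of _ "z * sinh z"]) auto
      qed
      then show ?thesis by simp
    qed
    have "0\<^sup>2 / 2 - ln (cosh 0) \<le> x\<^sup>2 / 2 - ln (cosh x)"
    proof (rule DERIV_nonneg_imp_nondecreasing[OF x])
      fix z :: real assume z: "0 \<le> z"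
      have "((\<lambda>z. z\<^sup>2 / 2 - ln (cosh z)) has_real_derivative z - sinh z / cosh z) (at z)"
        by (auto intro!: derivative_eq_intros)
      moreover have "0 \<le> z - sinh z / cosh z"
        using k[OF z] cosh_real_pos[of z] by (simp add: field_simps)
      ultimately show "\<exists>d. ((\<lambda>z. z\<^sup>2 / 2 - ln (cosh z)) has_real_derivative d) (at z) \<and> 0 \<le> d" by blast
    qed
    then have "ln (cosh x) \<le> x\<^sup>2 / 2" by simp
    then show ?thesis using cosh_real_pos[of x] ln_le_cancel_iff[of "cosh x" "exp (x\<^sup>2 / 2)"] by simp
  qed
  show ?thesis using pos[of x] pos[of "- x"] by (cases "0 \<le> x") auto
qed

text \<open>A sign pattern is coded by the set of its positive positions. Probabilities over random
  signs become cardinalities of subsets of \<open>Pow {..<m}\<close>, relative to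
  \<open>2 ^ m\<close>.\<close>

definition sg :: "nat set \<Rightarrow> nat \<Rightarrow> real" where
  "sg S i = (if i \<in> S then 1 else - 1)"

lemma sum_exp_signs:
  "(\<Sum>S\<in>Pow {..<m}. exp (\<Sum>i<m. sg S i * a i)) = (\<Prod>i<m. 2 * cosh (a i))"
proof -
  have "2 * cosh x = exp x + exp (- x)" for x :: real by (simp add: cosh_field_def field_simps)
  then have "(\<Prod>i<m. 2 * cosh (a i)) = (\<Prod>i<m. exp (a i) + exp (- a i))"
    by (simp only:)
  also have "\<dots> = (\<Sum>S\<in>Pow {..<m}. (\<Prod>i\<in>S. exp (a i)) * (\<Prod>i\<in>{..<m} - S. exp (- a i)))"
    by (rule prod_add) simp
  also have "\<dots> = (\<Sum>S\<in>Pow {..<m}. exp (\<Sum>i<m. sg S i * a i))"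
  proof (rule sum.cong[OF refl])
    fix S assume S: "S \<in> Pow {..<m}"
    then have fin: "finite S" by (auto intro: finite_subset)
    have "(\<Sum>i<m. sg S i * a i) = (\<Sum>i\<in>S. sg S i * a i) + (\<Sum>i\<in>{..<m} - S. sg S i * a i)"
      using S by (subst sum.subset_diff[of S]) auto
    also have "\<dots> = (\<Sum>i\<in>S. a i) + (\<Sum>i\<in>{..<m} - S. - a i)"
      by (intro arg_cong2[where f = "(+)"] sum.cong) (auto simp: sg_def)
    finally show "(\<Prod>i\<in>S. exp (a i)) * (\<Prod>i\<in>{..<m} - S. exp (- a i)) = exp (\<Sum>i<m. sg S i * a i)"
      using fin by (simp add: exp_add exp_sum del: sum_negf)
  qed
  finally show ?thesis by simp
qed

lemma card_signs_one_sided: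
  assumes V: "(\<Sum>i<m. (a i)\<^sup>2) \<le> V" "0 < V" and t: "0 \<le> t"
  shows "real (card {S \<in> Pow {..<m}. (\<Sum>i<m. sg S i * a i) > t}) \<le> 2 ^ m * exp (- t\<^sup>2 / (2 * V))"
proof -
  \<comment> \<open>The minimiser of the Chernoff exponent
    \<open>l\<^sup>2 / 2 * V - l * t\<close>.\<close>
  define l where "l = t / V"
  have l: "0 \<le> l" using t V by (simp add: l_def)
  let ?B = "{S \<in> Pow {..<m}. (\<Sum>i<m. sg S i * a i) > t}"
  have "real (card ?B) * exp (l * t) = (\<Sum>S\<in>?B. exp (l * t))" by simp
  also have "\<dots> \<le> (\<Sum>S\<in>?B. exp (\<Sum>i<m. sg S i * (l * a i)))"
  proof (rule sum_mono)
    fix S assume "S \<in> ?B"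
    then have "l * t \<le> l * (\<Sum>i<m. sg S i * a i)" using l by (intro mult_left_mono) auto
    also have "\<dots> = (\<Sum>i<m. sg S i * (l * a i))" by (simp add: sum_distrib_left algebra_simps)
    finally show "exp (l * t) \<le> exp (\<Sum>i<m. sg S i * (l * a i))" by simp
  qed
  also have "\<dots> \<le> (\<Sum>S\<in>Pow {..<m}. exp (\<Sum>i<m. sg S i * (l * a i)))"
    by (intro sum_mono2) auto
  also have "\<dots> = (\<Prod>i<m. 2 * cosh (l * a i))" by (rule sum_exp_signs)
  also have "\<dots> \<le> (\<Prod>i<m. 2 * exp ((l * a i)\<^sup>2 / 2))"
    by (intro prod_mono) (auto simp: cosh_le_exp_half_square intro: less_imp_le)
  also have "\<dots> = 2 ^ m * exp (\<Sum>i<m. (l * a i)\<^sup>2 / 2)"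
    by (simp add: prod.distrib exp_sum)
  also have "(\<Sum>i<m. (l * a i)\<^sup>2 / 2) = l\<^sup>2 / 2 * (\<Sum>i<m. (a i)\<^sup>2)"
    by (simp add: sum_distrib_left power_mult_distrib)
  also have "2 ^ m * exp (l\<^sup>2 / 2 * (\<Sum>i<m. (a i)\<^sup>2)) \<le> 2 ^ m * exp (l\<^sup>2 / 2 * V)"
    using V by (simp add: mult_left_mono)
  finally have "real (card ?B) \<le> 2 ^ m * exp (l\<^sup>2 / 2 * V) / exp (l * t)"
    by (simp add: field_simps)
  also have "\<dots> = 2 ^ m * exp (l\<^sup>2 / 2 * V - l * t)" by (simp add: exp_diff)
  also have "l\<^sup>2 / 2 * V - l * t = - t\<^sup>2 / (2 * V)"
    using V by (simp add: l_def field_simps power2_eq_square)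
  finally show ?thesis .
qed

lemma card_signs_two_sided:
  assumes V: "(\<Sum>i<m. (a i)\<^sup>2) \<le> V" "0 < V" and t: "0 \<le> t"
  shows "real (card {S \<in> Pow {..<m}. \<bar>\<Sum>i<m. sg S i * a i\<bar> > t}) \<le> 2 * 2 ^ m * exp (- t\<^sup>2 / (2 * V))"
proof -
  have "{S \<in> Pow {..<m}. \<bar>\<Sum>i<m. sg S i * a i\<bar> > t}
      = {S \<in> Pow {..<m}. (\<Sum>i<m. sg S i * a i) > t} \<union> {S \<in> Pow {..<m}. (\<Sum>i<m. sg S i * - a i) > t}"
    by (auto simp: sum_negf abs_if)
  then have "card {S \<in> Pow {..<m}. \<bar>\<Sum>i<m. sg S i * a i\<bar> > t}
      \<le> card {S \<in> Pow {..<m}. (\<Sum>i<m. sg S i * a i) > t} + card {S \<in> Pow {..<m}. (\<Sum>i<m. sg S i * - a i) > t}"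
    by (simp only: card_Un_le)
  moreover have "real (card {S \<in> Pow {..<m}. (\<Sum>i<m. sg S i * a i) > t}) \<le> 2 ^ m * exp (- t\<^sup>2 / (2 * V))"
    by (rule card_signs_one_sided[OF assms])
  moreover have "real (card {S \<in> Pow {..<m}. (\<Sum>i<m. sg S i * - a i) > t}) \<le> 2 ^ m * exp (- t\<^sup>2 / (2 * V))"
    by (rule card_signs_one_sided) (use assms in auto)
  ultimately show ?thesis by linarith
qed

text \<open>Chaining needs centres that satisfy the energy bound of \<open>V\<close>, so each cell
  of the cover is represented by one of its members. The triangle inequality through the old centre
  doubles the radius.\<close>

lemma cover_by_members:
  fixes V :: "(nat \<Rightarrow> real) set"
  assumes C: "finite C" "real (card C) \<le> N"
    and cov: "\<And>v. v \<in> V \<Longrightarrow> \<exists>c\<in>C. \<forall>i<m. \<bar>v i - c i\<bar> \<le> \<epsilon>"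
  shows "\<exists>p. (\<forall>v\<in>V. p v \<in> V \<and> (\<forall>i<m. \<bar>v i - p v i\<bar> \<le> 2 * \<epsilon>)) \<and> finite (p ` V) \<and> real (card (p ` V)) \<le> N"
proof -
  obtain c where c: "\<And>v. v \<in> V \<Longrightarrow> c v \<in> C \<and> (\<forall>i<m. \<bar>v i - c v i\<bar> \<le> \<epsilon>)" using cov by metis
  define r where "r x = (SOME v. v \<in> V \<and> c v = x)" for x
  have r: "r (c v) \<in> V" "c (r (c v)) = c v" if "v \<in> V" for v
    using someI[of "\<lambda>w. w \<in> V \<and> c w = c v" v] that by (auto simp: r_def)
  define p where "p v = r (c v)" for v
  have sub: "p ` V \<subseteq> r ` C" using c by (auto simp: p_def)
  then have fin: "finite (p ` V)" using C(1) finite_subset[OF sub] by blast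
  have "card (p ` V) \<le> card C"
    using sub C(1) card_mono[OF finite_imageI[OF C(1)] sub] card_image_le[OF C(1), of r] by linarith
  moreover have "\<bar>v i - p v i\<bar> \<le> 2 * \<epsilon>" if v: "v \<in> V" and i: "i < m" for v i
  proof -
    have "\<bar>v i - c v i\<bar> \<le> \<epsilon>" using c v i by blast
    moreover have "\<bar>p v i - c (p v) i\<bar> \<le> \<epsilon>" using c[of "p v"] r[OF v] i by (simp add: p_def)
    moreover have "c (p v) = c v" using r v by (simp add: p_def)
    ultimately show ?thesis by (simp add: abs_le_iff)
  qed
  ultimately show ?thesis using fin r C(2) by (intro exI[of _ p]) (auto simp: p_def)
qed

lemma telescope_from_1: "(\<Sum>j=1..J. f j - f (j - 1)) = f J - (f 0 :: real)" for J :: nat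
  by (induction J) auto

text \<open>A chain from 0 to \<open>v\<close> moves at scale \<open>j\<close> by at most
  \<open>6 * b / 2 ^ j\<close> in each coordinate, while sums of neighbours have energy at most
  \<open>4 * m * q\<^sup>2\<close>. The increments of the squares thus have total square at most
  \<open>144 * b\<^sup>2 * m * q\<^sup>2 / 4 ^ j\<close>, and Hoeffding's exponent grows like
  \<open>4 ^ j\<close>, as fast as the logarithm of the number of links.\<close>

theorem signs_chaining:
  fixes V :: "(nat \<Rightarrow> real) set"
  assumes b: "0 < b" and q: "0 < q" and m: "1 \<le> m" and A: "1 \<le> A" and L: "0 \<le> L"
    and bnd: "\<And>v i. v \<in> V \<Longrightarrow> i < m \<Longrightarrow> \<bar>v i\<bar> \<le> b"
    and en: "\<And>v. v \<in> V \<Longrightarrow> (\<Sum>i<m. (v i)\<^sup>2) \<le> real m * q\<^sup>2"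
    and cov: "\<And>j. 1 \<le> j \<Longrightarrow> j \<le> J \<Longrightarrow> \<exists>C. finite C \<and> real (card C) \<le> A ^ (4 ^ j) \<and>
        (\<forall>v\<in>V. \<exists>c\<in>C. \<forall>i<m. \<bar>v i - c i\<bar> \<le> b / 2 ^ j)"
  shows "real (card {S \<in> Pow {..<m}. \<exists>v\<in>V. \<bar>\<Sum>i<m. sg S i * (v i)\<^sup>2\<bar>
      > real J * sqrt (288 * b\<^sup>2 * real m * q\<^sup>2 * (2 * ln A + L)) + 4 * b / 2 ^ J * real m * q})
    \<le> 2 ^ m * (2 * real J * exp (- L))"
proof -
  \<comment> \<open>\<open>2 * ln A\<close> pays for the pairs of centres from two consecutive
    covers, and \<open>L\<close> is the exponent of the failure probability.\<close>
  define \<Lambda> where "\<Lambda> = 2 * ln A + L"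
  have \<Lambda>0: "0 \<le> \<Lambda>" using A L by (simp add: \<Lambda>_def)
  \<comment> \<open>One threshold for all scales: \<open>288 = 2 * 144\<close> makes
    \<open>t\<^sup>2 / (2 * W)\<close> equal to \<open>4 ^ j * \<Lambda>\<close>, with
    \<open>W\<close> the variance bound at scale \<open>j\<close>.\<close>
  define t where "t = sqrt (288 * b\<^sup>2 * real m * q\<^sup>2 * \<Lambda>)"
  have t0: "0 \<le> t" and t2: "t\<^sup>2 = 288 * b\<^sup>2 * real m * q\<^sup>2 * \<Lambda>" using \<Lambda>0 by (simp_all add: t_def)
  have "\<exists>p. (\<forall>v\<in>V. p v \<in> V \<and> (\<forall>i<m. \<bar>v i - p v i\<bar> \<le> 2 * (b / 2 ^ j))) \<and> finite (p ` V)
      \<and> real (card (p ` V)) \<le> A ^ (4 ^ j)" if "1 \<le> j" "j \<le> J" for j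
    using cov[OF that] cover_by_members by blast
  then obtain p0 where p0: "\<And>j. 1 \<le> j \<Longrightarrow> j \<le> J \<Longrightarrow> (\<forall>v\<in>V. p0 j v \<in> V \<and> (\<forall>i<m. \<bar>v i - p0 j v i\<bar> \<le> 2 * (b / 2 ^ j)))
      \<and> finite (p0 j ` V) \<and> real (card (p0 j ` V)) \<le> A ^ (4 ^ j)" by metis
  \<comment> \<open>The chain starts at the zero vector, whether or not it belongs to
    \<open>V\<close>: it is within \<open>b\<close> of every member and has energy 0.\<close>
  define p where "p j = (if j = 0 then (\<lambda>v i. 0) else p0 j)" for j
  have pclose: "\<bar>v i - p j v i\<bar> \<le> 2 * (b / 2 ^ j)" if "v \<in> V" "i < m" "j \<le> J" for v i j
  proof (cases "j = 0")
    case True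
    then show ?thesis using bnd[OF that(1,2)] b by (simp add: p_def)
  qed (use p0[of j] that in \<open>auto simp: p_def\<close>)
  have pen: "(\<Sum>i<m. (p j v i)\<^sup>2) \<le> real m * q\<^sup>2" if "v \<in> V" "j \<le> J" for v j
  proof (cases "j = 0")
    case True
    then show ?thesis by (simp add: p_def)
  qed (use p0[of j] that en in \<open>auto simp: p_def\<close>)
  have pcard: "finite (p j ` V) \<and> real (card (p j ` V)) \<le> A ^ (4 ^ j)" if "j \<le> J" for j
  proof (cases "j = 0")
    case True
    have "p j ` V \<subseteq> {\<lambda>i. 0}" using True by (auto simp: p_def)
    then have "finite (p j ` V)" "card (p j ` V) \<le> 1"
      using card_mono[of "{\<lambda>i. 0 :: real}" "p j ` V"] by (auto intro: finite_subset)
    then show ?thesis using A True by simp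
  qed (use p0[of j] that in \<open>auto simp: p_def\<close>)
  have sumen: "(\<Sum>i<m. (x i + y i)\<^sup>2) \<le> 4 * real m * q\<^sup>2"
    if "(\<Sum>i<m. (x i)\<^sup>2) \<le> real m * q\<^sup>2" "(\<Sum>i<m. (y i)\<^sup>2) \<le> real m * q\<^sup>2" for x y :: "nat \<Rightarrow> real"
  proof -
    have "(\<Sum>i<m. (x i + y i)\<^sup>2) \<le> (\<Sum>i<m. 2 * (x i)\<^sup>2 + 2 * (y i)\<^sup>2)"
    proof (rule sum_mono)
      fix i
      have "0 \<le> (x i - y i)\<^sup>2" by simp
      then show "(x i + y i)\<^sup>2 \<le> 2 * (x i)\<^sup>2 + 2 * (y i)\<^sup>2" by (simp add: power2_eq_square algebra_simps)
    qed
    then show ?thesis using that by (simp add: sum.distrib sum_distrib_left[symmetric])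
  qed
  define D where "D j = (\<lambda>v. (p j v, p (j - 1) v)) ` V" for j
  define Bad where "Bad z = {S \<in> Pow {..<m}. \<bar>\<Sum>i<m. sg S i * ((fst z i)\<^sup>2 - (snd z i)\<^sup>2)\<bar> > t}"
    for z :: "(nat \<Rightarrow> real) \<times> (nat \<Rightarrow> real)"
  have Dsub: "D j \<subseteq> (p j ` V) \<times> (p (j - 1) ` V)" for j by (auto simp: D_def)
  have Dfin: "finite (D j)" and Dcard: "real (card (D j)) \<le> exp (2 * 4 ^ j * ln A)" if j: "1 \<le> j" "j \<le> J" for j
  proof -
    have f: "finite (p j ` V)" "finite (p (j - 1) ` V)" using pcard j by auto
    show "finite (D j)" using finite_subset[OF Dsub] f by blast
    have "real (card (D j)) \<le> real (card ((p j ` V) \<times> (p (j - 1) ` V)))"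
      using f by (intro of_nat_mono card_mono Dsub) auto
    also have "\<dots> = real (card (p j ` V)) * real (card (p (j - 1) ` V))" by (simp add: card_cartesian_product)
    also have "\<dots> \<le> A ^ (4 ^ j) * A ^ (4 ^ (j - 1))" using pcard[of j] pcard[of "j - 1"] j A by (intro mult_mono) auto
    also have "\<dots> \<le> A ^ (4 ^ j) * A ^ (4 ^ j)"
      using A by (intro mult_left_mono power_increasing) auto
    also have "\<dots> = A powr (real (2 * 4 ^ j))" using A by (simp add: powr_realpow[symmetric] powr_add[symmetric])
    also have "\<dots> = exp (2 * 4 ^ j * ln A)" using A by (simp add: powr_def)
    finally show "real (card (D j)) \<le> exp (2 * 4 ^ j * ln A)" .
  qed
  have Badcard: "real (card (Bad z)) \<le> 2 * 2 ^ m * exp (- (4 ^ j * \<Lambda>))" if j: "1 \<le> j" "j \<le> J" and z: "z \<in> D j" for j z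
  proof -
    obtain v where v: "v \<in> V" and z: "z = (p j v, p (j - 1) v)" using z by (auto simp: D_def)
    define W where "W = 144 * b\<^sup>2 * real m * q\<^sup>2 / 4 ^ j"
    have pw: "b / 2 ^ (j - 1) = 2 * (b / 2 ^ j)" using j by (cases j) (auto simp: field_simps)
    have "(\<Sum>i<m. ((fst z i)\<^sup>2 - (snd z i)\<^sup>2)\<^sup>2) \<le> (\<Sum>i<m. (6 * (b / 2 ^ j))\<^sup>2 * (fst z i + snd z i)\<^sup>2)"
    proof (rule sum_mono)
      fix i assume i: "i \<in> {..<m}"
      have "\<bar>v i - p j v i\<bar> \<le> 2 * (b / 2 ^ j)" using i j by (intro pclose v) auto
      moreover have "\<bar>v i - p (j - 1) v i\<bar> \<le> 2 * (b / 2 ^ (j - 1))" using i j by (intro pclose v) auto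
      ultimately have "\<bar>fst z i - snd z i\<bar> \<le> 6 * (b / 2 ^ j)" unfolding z pw fst_conv snd_conv by linarith
      then have "(fst z i - snd z i)\<^sup>2 \<le> (6 * (b / 2 ^ j))\<^sup>2"
        using abs_le_square_iff[of "fst z i - snd z i" "6 * (b / 2 ^ j)"] b by simp
      then have "(fst z i - snd z i)\<^sup>2 * (fst z i + snd z i)\<^sup>2 \<le> (6 * (b / 2 ^ j))\<^sup>2 * (fst z i + snd z i)\<^sup>2"
        by (intro mult_right_mono) auto
      moreover have "((fst z i)\<^sup>2 - (snd z i)\<^sup>2)\<^sup>2 = (fst z i - snd z i)\<^sup>2 * (fst z i + snd z i)\<^sup>2"
        by (simp add: power2_eq_square algebra_simps)
      ultimately show "((fst z i)\<^sup>2 - (snd z i)\<^sup>2)\<^sup>2 \<le> (6 * (b / 2 ^ j))\<^sup>2 * (fst z i + snd z i)\<^sup>2" by simp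
    qed
    also have "\<dots> = (6 * (b / 2 ^ j))\<^sup>2 * (\<Sum>i<m. (fst z i + snd z i)\<^sup>2)" by (simp add: sum_distrib_left)
    also have "\<dots> \<le> (6 * (b / 2 ^ j))\<^sup>2 * (4 * real m * q\<^sup>2)"
      using j by (intro mult_left_mono sumen) (auto simp: z intro!: pen v)
    also have "\<dots> = W"
    proof -
      have "((2::real) ^ j)\<^sup>2 = (2\<^sup>2) ^ j" by (simp only: power_mult[symmetric] mult.commute)
      then have "((2::real) ^ j)\<^sup>2 = 4 ^ j" by simp
      then show ?thesis by (simp add: W_def power_mult_distrib power_divide)
    qed
    finally have le: "(\<Sum>i<m. ((fst z i)\<^sup>2 - (snd z i)\<^sup>2)\<^sup>2) \<le> W" .
    have W: "0 < W" using b q m by (simp add: W_def)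
    have "real (card (Bad z)) \<le> 2 * 2 ^ m * exp (- t\<^sup>2 / (2 * W))"
      unfolding Bad_def by (rule card_signs_two_sided[OF le W t0])
    also have "- t\<^sup>2 / (2 * W) = - (4 ^ j * \<Lambda>)"
      unfolding t2 W_def using b q m by (simp add: field_simps)
    finally show ?thesis .
  qed
  let ?U = "\<Union>j\<in>{1..J}. \<Union>z\<in>D j. Bad z"
  have Ucard: "real (card ?U) \<le> 2 ^ m * (2 * real J * exp (- L))"
  proof -
    have "real (card ?U) \<le> (\<Sum>j\<in>{1..J}. real (card (\<Union>z\<in>D j. Bad z)))"
      using card_UN_le[of "{1..J}" "\<lambda>j. \<Union>z\<in>D j. Bad z"] by (simp flip: of_nat_sum)
    also have "\<dots> \<le> (\<Sum>j\<in>{1..J}. 2 * 2 ^ m * exp (- L))"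
    proof (rule sum_mono)
      fix j assume "j \<in> {1..J}"
      then have j: "1 \<le> j" "j \<le> J" by auto
      have "real (card (\<Union>z\<in>D j. Bad z)) \<le> (\<Sum>z\<in>D j. real (card (Bad z)))"
        using card_UN_le[OF Dfin[OF j], of Bad] by (simp flip: of_nat_sum)
      also have "\<dots> \<le> (\<Sum>z\<in>D j. 2 * 2 ^ m * exp (- (4 ^ j * \<Lambda>)))" by (intro sum_mono Badcard j)
      also have "\<dots> = real (card (D j)) * (2 * 2 ^ m * exp (- (4 ^ j * \<Lambda>)))" by simp
      also have "\<dots> \<le> exp (2 * 4 ^ j * ln A) * (2 * 2 ^ m * exp (- (4 ^ j * \<Lambda>)))"
        by (intro mult_right_mono Dcard j) auto
      also have "\<dots> = 2 * 2 ^ m * exp (- (4 ^ j * L))"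
        by (simp add: \<Lambda>_def exp_add[symmetric] algebra_simps)
      also have "\<dots> \<le> 2 * 2 ^ m * exp (- L)"
        using L mult_right_mono[of 1 "4 ^ j" L] by simp
      finally show "real (card (\<Union>z\<in>D j. Bad z)) \<le> 2 * 2 ^ m * exp (- L)" .
    qed
    finally show ?thesis by (simp add: mult_ac)
  qed
  have sub: "{S \<in> Pow {..<m}. \<exists>v\<in>V. \<bar>\<Sum>i<m. sg S i * (v i)\<^sup>2\<bar>
      > real J * t + 4 * b / 2 ^ J * real m * q} \<subseteq> ?U"
  proof (rule subsetI, rule ccontr)
    fix S assume "S \<in> {S \<in> Pow {..<m}. \<exists>v\<in>V. \<bar>\<Sum>i<m. sg S i * (v i)\<^sup>2\<bar>
      > real J * t + 4 * b / 2 ^ J * real m * q}" and SU: "S \<notin> ?U"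
    then obtain v where S: "S \<in> Pow {..<m}" and v: "v \<in> V"
      and gt: "\<bar>\<Sum>i<m. sg S i * (v i)\<^sup>2\<bar> > real J * t + 4 * b / 2 ^ J * real m * q" by blast
    define f where "f j = (\<Sum>i<m. sg S i * (p j v i)\<^sup>2)" for j
    have inc: "\<bar>f j - f (j - 1)\<bar> \<le> t" if "1 \<le> j" "j \<le> J" for j
    proof -
      have "S \<notin> Bad (p j v, p (j - 1) v)" using SU that v by (auto simp: D_def)
      then show ?thesis using S by (auto simp: Bad_def f_def sum_subtractf right_diff_distrib)
    qed
    have "\<bar>f J - f 0\<bar> \<le> (\<Sum>j=1..J. \<bar>f j - f (j - 1)\<bar>)"
      unfolding telescope_from_1[symmetric] by (rule sum_abs)
    also have "\<dots> \<le> (\<Sum>j=1..J. t)" by (intro sum_mono inc) auto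
    finally have 1: "\<bar>f J\<bar> \<le> real J * t" by (simp add: f_def p_def)
    have "\<bar>(\<Sum>i<m. sg S i * (v i)\<^sup>2) - f J\<bar> = \<bar>\<Sum>i<m. sg S i * ((v i)\<^sup>2 - (p J v i)\<^sup>2)\<bar>"
      by (simp add: f_def sum_subtractf right_diff_distrib)
    also have "\<dots> \<le> (\<Sum>i<m. \<bar>sg S i * ((v i)\<^sup>2 - (p J v i)\<^sup>2)\<bar>)" by (rule sum_abs)
    also have "\<dots> \<le> (\<Sum>i<m. 2 * (b / 2 ^ J) * \<bar>v i + p J v i\<bar>)"
    proof (rule sum_mono)
      fix i assume i: "i \<in> {..<m}"
      have "\<bar>sg S i * ((v i)\<^sup>2 - (p J v i)\<^sup>2)\<bar> = \<bar>v i - p J v i\<bar> * \<bar>v i + p J v i\<bar>"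
      proof -
        have e: "(v i)\<^sup>2 - (p J v i)\<^sup>2 = (v i - p J v i) * (v i + p J v i)"
          by (simp add: power2_eq_square algebra_simps)
        show ?thesis unfolding e abs_mult by (simp add: sg_def)
      qed
      also have "\<dots> \<le> 2 * (b / 2 ^ J) * \<bar>v i + p J v i\<bar>"
        using pclose[OF v, of i J] i by (intro mult_right_mono) auto
      finally show "\<bar>sg S i * ((v i)\<^sup>2 - (p J v i)\<^sup>2)\<bar> \<le> 2 * (b / 2 ^ J) * \<bar>v i + p J v i\<bar>" .
    qed
    also have "\<dots> = 2 * (b / 2 ^ J) * (\<Sum>i<m. \<bar>v i + p J v i\<bar>)" by (simp add: sum_distrib_left)
    finally have res: "\<bar>(\<Sum>i<m. sg S i * (v i)\<^sup>2) - f J\<bar> \<le> 2 * (b / 2 ^ J) * (\<Sum>i<m. \<bar>v i + p J v i\<bar>)" .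
    \<comment> \<open>The Cauchy-Schwarz inequality passes from the absolute sum to the energy,
      which makes the truncation error linear in \<open>q\<close>, like the links of the
      chain.\<close>
    have "(\<Sum>i<m. \<bar>v i + p J v i\<bar>) \<le> 2 * real m * q"
    proof (rule power2_le_imp_le)
      have "(\<Sum>i<m. 1 * \<bar>v i + p J v i\<bar>)\<^sup>2 \<le> (\<Sum>i<m. 1\<^sup>2) * (\<Sum>i<m. \<bar>v i + p J v i\<bar>\<^sup>2)"
        by (rule Cauchy_Schwarz_ineq_sum)
      also have "\<dots> \<le> real m * (4 * real m * q\<^sup>2)"
        using sumen[OF en[OF v] pen[OF v, of J]] by (simp add: mult_left_mono)
      finally show "(\<Sum>i<m. \<bar>v i + p J v i\<bar>)\<^sup>2 \<le> (2 * real m * q)\<^sup>2" by (simp add: power2_eq_square algebra_simps)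
    qed (use q in simp)
    then have "2 * (b / 2 ^ J) * (\<Sum>i<m. \<bar>v i + p J v i\<bar>) \<le> 2 * (b / 2 ^ J) * (2 * real m * q)"
      using b by (intro mult_left_mono) auto
    also have "\<dots> = 4 * b / 2 ^ J * real m * q" by simp
    finally show False using gt 1 res by linarith
  qed
  have "finite ?U" by (rule finite_subset[of _ "Pow {..<m}"]) (auto simp: Bad_def)
  then have "real (card {S \<in> Pow {..<m}. \<exists>v\<in>V. \<bar>\<Sum>i<m. sg S i * (v i)\<^sup>2\<bar>
      > real J * t + 4 * b / 2 ^ J * real m * q}) \<le> real (card ?U)"
    using sub by (intro of_nat_mono card_mono)
  then show ?thesis using Ucard unfolding t_def \<Lambda>_def by linarith
qed

subsection \<open>Ghost samples\<close>

text \<open>A sample \<open>x\<close> with large deviation, read off against an independent sample \<open>y\<close> with small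
  deviation, forces \<open>(x, y)\<close> into \<open>G\<close>; Fubini converts this into a bound on the probability.\<close>

lemma ghost_sample_step:
  fixes a :: "'q :: countable \<Rightarrow> 'x \<Rightarrow> real" and a' :: "'q \<Rightarrow> 'y \<Rightarrow> real"
  assumes A: "prob_space A" and B: "prob_space B"
    and ma: "\<And>X. a X \<in> borel_measurable A" and ma': "\<And>X. a' X \<in> borel_measurable B"
    and G: "G \<in> sets (A \<Otimes>\<^sub>M B)"
    and cheb: "\<And>X. measure B {y \<in> space B. \<bar>a' X y - 1\<bar> > \<eta>} \<le> 1 / 8"
    and tail: "measure B {y \<in> space B. \<exists>X. \<bar>a' X y - 1\<bar> > u} \<le> 1 / 2"
    and noG: "\<And>x y q X. x \<in> space A \<Longrightarrow> y \<in> space B \<Longrightarrow> (x, y) \<notin> G \<Longrightarrow> 1 \<le> (q::nat) \<Longrightarrow>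
        (\<forall>Y. a Y x + a' Y y \<le> (real q)\<^sup>2) \<Longrightarrow> \<bar>a X x - a' X y\<bar> \<le> \<theta> * real q"
    and bdd: "\<And>x X. x \<in> space A \<Longrightarrow> \<bar>a X x\<bar> \<le> b"
    and \<theta>: "0 \<le> \<theta>" "\<theta> \<le> 1 / 4" and t: "0 < t" and u: "0 \<le> u"
    and cond: "\<eta> + \<theta> * (3 + u) \<le> t * (1 / 2 - \<theta>)"
  shows "measure A {x \<in> space A. \<exists>X. \<bar>a X x - 1\<bar> > t} \<le> 8 / 3 * measure (A \<Otimes>\<^sub>M B) G"
proof -
  interpret A: prob_space A by fact
  interpret B: prob_space B by fact
  interpret AB: pair_prob_space A B ..
  note [measurable] = ma ma' G
  define bad where "bad = {x \<in> space A. \<exists>X. \<bar>a X x - 1\<bar> > t}"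
  define tl where "tl = {y \<in> space B. \<exists>X. \<bar>a' X y - 1\<bar> > u}"
  have bad_s: "bad \<in> sets A"
    unfolding bad_def by measurable
  have tl_s: "tl \<in> sets B"
    unfolding tl_def by measurable
  have sect: "ennreal (3 / 8) \<le> emeasure B (Pair x -` G)" if x: "x \<in> bad" for x
  proof -
    have xs: "x \<in> space A" using x by (simp add: bad_def)
    \<comment> \<open>The largest deviation of \<open>x\<close> itself, possibly far above
      \<open>t\<close>, bounds the second moments of all \<open>Y\<close> simultaneously.\<close>
    define D where "D = (SUP X. \<bar>a X x - 1\<bar>)"
    have bd: "bdd_above (range (\<lambda>X. \<bar>a X x - 1\<bar>))"
    proof (rule bdd_aboveI2)
      fix X
      show "\<bar>a X x - 1\<bar> \<le> b + 1" using bdd[OF xs, of X] by linarith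
    qed
    have le: "\<bar>a X x - 1\<bar> \<le> D" for X unfolding D_def by (rule cSUP_upper[OF UNIV_I bd])
    obtain X0 where X0: "\<bar>a X0 x - 1\<bar> > t" using x by (auto simp: bad_def)
    have Dt: "t < D" using le[of X0] X0 by linarith
    \<comment> \<open>The supremum need not be attained; an index beyond half of it is enough and
      accounts for the \<open>1 / 2\<close> in \<open>cond\<close>.\<close>
    then have "D / 2 < D" using t by linarith
    then obtain X where X: "D / 2 < \<bar>a X x - 1\<bar>"
      using less_cSUP_iff[OF _ bd, of "D / 2"] by (auto simp: D_def)
    have "space B - ({y \<in> space B. \<bar>a' X y - 1\<bar> > \<eta>} \<union> tl) \<subseteq> Pair x -` G"
    proof (rule subsetI, rule ccontr)
      fix y assume "y \<in> space B - ({y \<in> space B. \<bar>a' X y - 1\<bar> > \<eta>} \<union> tl)" "y \<notin> Pair x -` G"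
      then have y: "y \<in> space B" "\<bar>a' X y - 1\<bar> \<le> \<eta>" "y \<notin> tl" "(x, y) \<notin> G" by (auto simp: not_less)
      have yu: "\<bar>a' Y y - 1\<bar> \<le> u" for Y using y(1,3) by (auto simp: tl_def not_less)
      \<comment> \<open>The least integer whose square dominates all \<open>a Y x + a' Y y\<close>,
        which are at most \<open>(1 + D) + (1 + u)\<close>.\<close>
      define q where "q = nat \<lceil>sqrt (2 + D + u)\<rceil>"
      have pos: "0 < sqrt (2 + D + u)" using Dt t u by simp
      have qge: "sqrt (2 + D + u) \<le> real q" using real_nat_ceiling_ge[of "sqrt (2 + D + u)"] by (simp add: q_def)
      have q1: "1 \<le> q" using pos qge by (cases q) auto
      have qle: "real q \<le> 3 + D + u"
      proof -
        have "real q \<le> sqrt (2 + D + u) + 1" using pos by (simp add: q_def)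
        also have "sqrt (2 + D + u) \<le> 2 + D + u"
          using Dt t u real_sqrt_le_iff[of "2 + D + u" "(2 + D + u)\<^sup>2"]
          by (simp add: power2_eq_square)
        finally show ?thesis by simp
      qed
      have "a Y x + a' Y y \<le> (real q)\<^sup>2" for Y
      proof -
        have "a Y x + a' Y y \<le> 2 + D + u" using le[of Y] yu[of Y] by linarith
        also have "\<dots> = (sqrt (2 + D + u))\<^sup>2" using Dt t u by simp
        also have "\<dots> \<le> (real q)\<^sup>2" using qge pos by (intro power_mono) auto
        finally show ?thesis .
      qed
      then have "\<bar>a X x - a' X y\<bar> \<le> \<theta> * real q" using noG[OF xs y(1) y(4) q1] by blast
      also have "\<dots> \<le> \<theta> * (3 + D + u)" using qle \<theta>(1) by (intro mult_left_mono)
      finally have "D / 2 < \<eta> + \<theta> * (3 + D + u)" using X y(2) by linarith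
      then have "D * (1 / 2 - \<theta>) < \<eta> + \<theta> * (3 + u)" by (simp add: algebra_simps)
      moreover have "t * (1 / 2 - \<theta>) \<le> D * (1 / 2 - \<theta>)" using Dt \<theta>(2) by (intro mult_right_mono) auto
      ultimately show False using cond by linarith
    qed
    then have "emeasure B (space B - ({y \<in> space B. \<bar>a' X y - 1\<bar> > \<eta>} \<union> tl)) \<le> emeasure B (Pair x -` G)"
      by (rule emeasure_mono) (rule sets_Pair1[OF G])
    \<comment> \<open>What remains of 1 after the \<open>1 / 8\<close> from \<open>cheb\<close> and
      the \<open>1 / 2\<close> from \<open>tail\<close>.\<close>
    moreover have "3 / 8 \<le> measure B (space B - ({y \<in> space B. \<bar>a' X y - 1\<bar> > \<eta>} \<union> tl))"
    proof -
      have s1: "{y \<in> space B. \<bar>a' X y - 1\<bar> > \<eta>} \<in> sets B" by measurable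
      have "measure B ({y \<in> space B. \<bar>a' X y - 1\<bar> > \<eta>} \<union> tl) \<le> 1 / 8 + 1 / 2"
        using measure_Un_le[OF s1 tl_s] cheb[of X] tail by (simp add: tl_def)
      then show ?thesis using B.prob_compl[of "{y \<in> space B. \<bar>a' X y - 1\<bar> > \<eta>} \<union> tl"] s1 tl_s by simp
    qed
    ultimately show ?thesis by (simp add: B.emeasure_eq_measure ennreal_leI order_trans[rotated])
  qed
  have "ennreal (3 / 8) * emeasure A bad = (\<integral>\<^sup>+x. ennreal (3 / 8) * indicator bad x \<partial>A)"
    using bad_s by (simp add: nn_integral_cmult_indicator)
  also have "\<dots> \<le> (\<integral>\<^sup>+x. emeasure B (Pair x -` G) \<partial>A)"
    by (intro nn_integral_mono) (auto simp: sect split: split_indicator)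
  also have "\<dots> = emeasure (A \<Otimes>\<^sub>M B) G" by (rule B.emeasure_pair_measure_alt[OF G, symmetric])
  finally have "3 / 8 * measure A bad \<le> measure (A \<Otimes>\<^sub>M B) G"
    by (simp add: A.emeasure_eq_measure AB.emeasure_eq_measure ennreal_mult[symmetric])
  then show ?thesis by (simp add: bad_def)
qed

section \<open>Variance of an empirical mean\<close>

lemma PiM_Chebyshev:
  fixes g :: "'a \<Rightarrow> real"
  assumes M: "prob_space M" and I: "finite I" "I \<noteq> {}"
    and g: "g \<in> borel_measurable M" and bdd: "\<And>z. z \<in> space M \<Longrightarrow> \<bar>g z\<bar> \<le> b"
    and v: "(\<integral>z. (g z)\<^sup>2 \<partial>M) \<le> v" and t: "0 < t"
  shows "measure (PiM I (\<lambda>_. M)) {z \<in> space (PiM I (\<lambda>_. M)). \<bar>(\<Sum>i\<in>I. g (z i)) / real (card I) - (\<integral>z. g z \<partial>M)\<bar> > t}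
    \<le> v / (real (card I) * t\<^sup>2)"
proof -
  interpret M: prob_space M by fact
  interpret P: product_prob_space "\<lambda>_. M" I ..
  let ?P = "PiM I (\<lambda>_. M)"
  define E where "E = (\<integral>z. g z \<partial>M)"
  define h where "h z = g z - E" for z
  note [measurable] = g
  have ig: "integrable M g" by (rule M.integrable_const_bound[of _ b]) (auto simp: bdd)
  have ig2: "integrable M (\<lambda>z. (g z)\<^sup>2)"
    by (rule M.integrable_const_bound[of _ "b\<^sup>2"]) (auto intro!: AE_I2 simp: abs_square_le_1 power2_le_iff_abs_le bdd dest: bdd intro: order_trans[OF abs_ge_zero bdd])
  have ih: "integrable M h" unfolding h_def using ig by simp
  have h0: "(\<integral>z. h z \<partial>M) = 0" using ig by (simp add: h_def E_def M.prob_space)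
  have ih2: "integrable M (\<lambda>z. (h z)\<^sup>2)"
    unfolding h_def power2_diff using ig ig2 by simp
  have h2: "(\<integral>z. (h z)\<^sup>2 \<partial>M) \<le> v"
  proof -
    have "(\<integral>z. (h z)\<^sup>2 \<partial>M) = (\<integral>z. (g z)\<^sup>2 \<partial>M) - E\<^sup>2"
      unfolding h_def power2_diff using ig ig2 by (simp add: M.prob_space E_def[symmetric] power2_eq_square)
    then show ?thesis using v zero_le_power2[of E] by linarith
  qed
  \<comment> \<open>Writes \<open>h (z i) * h (z j)\<close> as a product over all coordinates, with
    constant 1 elsewhere and the square at \<open>i\<close> if \<open>i = j\<close>, so that
    integration over the product measure factorises.\<close>
  define c where "c i j k = (if k = i then (if i = j then (\<lambda>z. (h z)\<^sup>2) else h) else if k = j then h else (\<lambda>_. 1))" for i j k :: 'b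
  have cint: "integrable M (c i j k)" for i j k using ih ih2 by (auto simp: c_def)
  have cprod: "(\<Prod>k\<in>I. c i j k (z k)) = h (z i) * h (z j)" if "i \<in> I" "j \<in> I" for i j z
  proof (cases "i = j")
    case True
    have "(\<Prod>k\<in>I. c i j k (z k)) = (\<Prod>k\<in>I. if k = i then (h (z k))\<^sup>2 else 1)"
      by (intro prod.cong) (auto simp: c_def True)
    then show ?thesis using True that I by (simp add: power2_eq_square)
  next
    case False
    have "(\<Prod>k\<in>I. c i j k (z k)) = (\<Prod>k\<in>I. (if k = i then h (z k) else 1) * (if k = j then h (z k) else 1))"
      using False by (intro prod.cong) (auto simp: c_def)
    then show ?thesis using that I by (simp add: prod.distrib)
  qed
  have cov_int: "integrable ?P (\<lambda>z. h (z i) * h (z j))" if "i \<in> I" "j \<in> I" for i j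
    using P.product_integrable_prod[OF I(1), of "c i j"] cint cprod[OF that] by simp
  have cov: "(\<integral>z. h (z i) * h (z j) \<partial>?P) = (if i = j then (\<integral>z. (h z)\<^sup>2 \<partial>M) else 0)" if "i \<in> I" "j \<in> I" for i j
  proof -
    have "(\<integral>z. h (z i) * h (z j) \<partial>?P) = (\<Prod>k\<in>I. (\<integral>z. c i j k z \<partial>M))"
      using P.product_integral_prod[OF I(1), of "c i j"] cint cprod[OF that] by simp
    also have "\<dots> = (if i = j then (\<integral>z. (h z)\<^sup>2 \<partial>M) else 0)"
    proof (cases "i = j")
      case True
      have "(\<Prod>k\<in>I. (\<integral>z. c i j k z \<partial>M)) = (\<Prod>k\<in>I. if k = i then (\<integral>z. (h z)\<^sup>2 \<partial>M) else 1)"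
        by (intro prod.cong) (auto simp: c_def True M.prob_space)
      then show ?thesis using True that I by simp
    next
      case False
      have "(\<integral>z. c i j i z \<partial>M) = 0" using False h0 by (simp add: c_def)
      then show ?thesis using False that I by (auto intro: prod_zero)
    qed
    finally show ?thesis .
  qed
  define s where "s z = (\<Sum>i\<in>I. h (z i))" for z
  have s2: "(s z)\<^sup>2 = (\<Sum>i\<in>I. \<Sum>j\<in>I. h (z i) * h (z j))" for z
    by (simp add: s_def power2_eq_square sum_product)
  have s2int: "integrable ?P (\<lambda>z. (s z)\<^sup>2)"
    unfolding s2 by (intro Bochner_Integration.integrable_sum cov_int)
  have "(\<integral>z. (s z)\<^sup>2 \<partial>?P) = (\<Sum>i\<in>I. \<Sum>j\<in>I. \<integral>z. h (z i) * h (z j) \<partial>?P)"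
    unfolding s2 by (simp add: Bochner_Integration.integral_sum cov_int)
  also have "\<dots> = (\<Sum>i\<in>I. (\<integral>z. (h z)\<^sup>2 \<partial>M))"
    using I by (intro sum.cong refl) (simp add: cov)
  also have "\<dots> \<le> real (card I) * v" using mult_left_mono[OF h2, of "real (card I)"] by simp
  finally have sv: "(\<integral>z. (s z)\<^sup>2 \<partial>?P) \<le> real (card I) * v" .
  define n where "n = real (card I)"
  have n: "n > 0" using I by (simp add: n_def card_gt_0_iff)
  have "{z \<in> space ?P. \<bar>(\<Sum>i\<in>I. g (z i)) / real (card I) - (\<integral>z. g z \<partial>M)\<bar> > t}
      \<subseteq> {z \<in> space ?P. (n * t)\<^sup>2 \<le> (s z)\<^sup>2}"
  proof safe
    fix z assume "\<bar>(\<Sum>i\<in>I. g (z i)) / real (card I) - (\<integral>z. g z \<partial>M)\<bar> > t"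
    moreover have "(\<Sum>i\<in>I. g (z i)) / real (card I) - (\<integral>z. g z \<partial>M) = s z / n"
      using n by (simp add: s_def h_def sum_subtractf E_def[symmetric] n_def diff_divide_distrib)
    ultimately have "t < \<bar>s z\<bar> / n" using n by (simp add: abs_divide)
    then have "n * t \<le> \<bar>s z\<bar>" using n by (simp add: field_simps)
    then show "(n * t)\<^sup>2 \<le> (s z)\<^sup>2" using n t abs_le_square_iff[of "n * t" "s z"] by simp
  qed
  moreover have "s \<in> borel_measurable ?P"
    unfolding s_def h_def by measurable
  ultimately have "measure ?P {z \<in> space ?P. \<bar>(\<Sum>i\<in>I. g (z i)) / real (card I) - (\<integral>z. g z \<partial>M)\<bar> > t}
      \<le> measure ?P {z \<in> space ?P. (n * t)\<^sup>2 \<le> (s z)\<^sup>2}"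
    by (intro P.P.finite_measure_mono) auto
  also have "\<dots> \<le> (\<integral>z. (s z)\<^sup>2 \<partial>?P) / (n * t)\<^sup>2"
    using n t by (intro integral_Markov_inequality_measure[OF s2int, where A = "space ?P"]) auto
  also have "\<dots> \<le> (n * v) / (n * t)\<^sup>2" using sv by (intro divide_right_mono) (auto simp: n_def)
  also have "\<dots> = v / (real (card I) * t\<^sup>2)" using n by (simp add: n_def[symmetric] field_simps power2_eq_square)
  finally show ?thesis .
qed


text \<open>Positions outside \<open>S\<close> trade places with their partner at distance
  \<open>m\<close>, and those in \<open>S\<close> stay put; this matches the sign
  \<open>sg S\<close>.\<close>

definition pair_swap :: "nat \<Rightarrow> nat set \<Rightarrow> nat \<Rightarrow> nat" where
  "pair_swap m S i = (if i < m then (if i \<in> S then i else i + m) else (if i - m \<in> S then i else i - m))"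

lemma pair_swap_involution: "i < 2 * m \<Longrightarrow> pair_swap m S (pair_swap m S i) = i"
  by (auto simp: pair_swap_def)

lemma pair_swap_in: "i < 2 * m \<Longrightarrow> pair_swap m S i < 2 * m"
  by (auto simp: pair_swap_def)

lemma bij_pair_swap: "bij_betw (pair_swap m S) {..<2 * m} {..<2 * m}"
  by (rule bij_betwI[where g = "pair_swap m S"]) (auto simp: pair_swap_in pair_swap_involution)

text \<open>The difference of the halves is normalised by \<open>q\<close>, an integer upper bound
  for the root of their joint second moment. The range of \<open>q\<close> is countable, which keeps
  the event measurable.\<close>

definition ghost_event :: "nat \<Rightarrow> real \<Rightarrow> ('q \<Rightarrow> 'a \<Rightarrow> real) \<Rightarrow> 'a measure \<Rightarrow> (nat \<Rightarrow> 'a) set" where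
  "ghost_event m \<theta> f M = {w \<in> space (PiM {..<2 * m} (\<lambda>_. M)). \<exists>q::nat. 1 \<le> q
      \<and> (\<forall>Y. (\<Sum>i<2 * m. f Y (w i)) \<le> real m * (real q)\<^sup>2)
      \<and> (\<exists>X. \<bar>\<Sum>i<m. f X (w i) - f X (w (i + m))\<bar> > \<theta> * real m * real q)}"

lemma ghost_event_sets:
  fixes f :: "'q :: countable \<Rightarrow> 'a \<Rightarrow> real"
  assumes [measurable]: "\<And>X. f X \<in> borel_measurable M"
  shows "ghost_event m \<theta> f M \<in> sets (PiM {..<2 * m} (\<lambda>_. M))"
proof -
  have [measurable]: "(\<lambda>w. f X (w i)) \<in> borel_measurable (PiM {..<2 * m} (\<lambda>_. M))" if "i < 2 * m" for X i
    using that assms by (intro measurable_compose[OF measurable_component_singleton]) auto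
  have [measurable]: "(\<lambda>w. \<Sum>i<2 * m. f X (w i)) \<in> borel_measurable (PiM {..<2 * m} (\<lambda>_. M))" for X
    by (rule borel_measurable_sum) auto
  have [measurable]: "(\<lambda>w. \<Sum>i<m. f X (w i) - f X (w (i + m))) \<in> borel_measurable (PiM {..<2 * m} (\<lambda>_. M))" for X
    by (intro borel_measurable_sum borel_measurable_diff) auto
  show ?thesis unfolding ghost_event_def by measurable
qed

text \<open>Swapping paired coordinates preserves the product measure, so the probability is the
  mean over all \<open>2 ^ m\<close> swaps. For a fixed double sample a swapped difference is a
  signed sum, and it splits into one signed sum for each half, each allotted
  \<open>\<theta> / 2\<close>.\<close>

lemma ghost_event_bound:
  fixes f :: "'q :: countable \<Rightarrow> 'a \<Rightarrow> real"
  assumes M: "prob_space M" and m: "1 \<le> m"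
    and mf: "\<And>X. f X \<in> borel_measurable M" and f0: "\<And>X z. z \<in> space M \<Longrightarrow> 0 \<le> f X z" and \<theta>: "0 \<le> \<theta>" and \<rho>: "0 \<le> \<rho>"
    and signs: "\<And>z q. (\<And>i. i < m \<Longrightarrow> z i \<in> space M) \<Longrightarrow> 1 \<le> (q::nat) \<Longrightarrow>
        (\<And>Y. (\<Sum>i<m. f Y (z i)) \<le> real m * (real q)\<^sup>2) \<Longrightarrow>
        real (card {S \<in> Pow {..<m}. \<exists>X. \<bar>\<Sum>i<m. sg S i * f X (z i)\<bar> > \<theta> / 2 * real m * real q}) \<le> 2 ^ m * \<rho>"
  shows "measure (PiM {..<2 * m} (\<lambda>_. M)) (ghost_event m \<theta> f M) \<le> 2 * \<rho>"
proof -
  interpret M: prob_space M by fact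
  let ?P = "PiM {..<2 * m} (\<lambda>_. M)"
  interpret P: prob_space ?P by (intro prob_space_PiM M)
  define G where "G = ghost_event m \<theta> f M"
  have G: "G \<in> sets ?P" unfolding G_def by (rule ghost_event_sets[OF mf])
  define T where "T S = (\<lambda>w :: nat \<Rightarrow> 'a. \<lambda>n\<in>{..<2 * m}. w (pair_swap m S n))" for S
  have T: "distr ?P ?P (T S) = ?P" for S
    unfolding T_def using bij_pair_swap[of m S] pair_swap_in
    by (intro distr_PiM_reindex[where M = "\<lambda>_. M"]) (auto simp: bij_betw_def M)
  have mT: "T S \<in> measurable ?P ?P" for S
    unfolding T_def by (rule measurable_restrict) (auto intro!: measurable_component_singleton pair_swap_in)
  have TG: "emeasure ?P (T S -` G \<inter> space ?P) = emeasure ?P G" for S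
    using emeasure_distr[OF mT[of S] G] T[of S] by simp
  have count: "real (card {S \<in> Pow {..<m}. T S w \<in> G}) \<le> 2 * 2 ^ m * \<rho>" if w: "w \<in> space ?P" for w
  proof -
    have ws: "w i \<in> space M" if "i < 2 * m" for i using w that by (auto simp: space_PiM)
    define en where "en q \<longleftrightarrow> 1 \<le> q \<and> (\<forall>Y. (\<Sum>i<2 * m. f Y (w i)) \<le> real m * (real q)\<^sup>2)" for q :: nat
    define F where "F X S = (\<Sum>i<m. sg S i * (f X (w i) - f X (w (i + m))))" for X S
    have TSG: "T S w \<in> G \<longleftrightarrow> (\<exists>q. en q \<and> (\<exists>X. \<bar>F X S\<bar> > \<theta> * real m * real q))" for S
    proof -
      have sp: "T S w \<in> space ?P" using measurable_space[OF mT w] .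
      have 1: "(\<Sum>i<2 * m. f Y (T S w i)) = (\<Sum>i<2 * m. f Y (w i))" for Y
        using sum.reindex_bij_betw[OF bij_pair_swap[of m S], of "\<lambda>i. f Y (w i)"] by (simp add: T_def)
      have 2: "(\<Sum>i<m. f X (T S w i) - f X (T S w (i + m))) = F X S" for X
        unfolding F_def by (intro sum.cong refl) (auto simp: T_def pair_swap_def sg_def)
      show ?thesis using sp by (auto simp: G_def ghost_event_def 1 2 en_def)
    qed
    show ?thesis
    proof (cases "\<exists>q. en q")
      case False
      then show ?thesis using \<rho> by (simp add: TSG)
    next
      case True
      \<comment> \<open>The joint energy is invariant under swaps, so the admissible
        \<open>q\<close> do not depend on \<open>S\<close>. The least of them makes the weakest
        demand on the difference, and no union over \<open>q\<close> is needed.\<close>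
      define q where "q = (LEAST q. en q)"
      have q: "en q" using True unfolding q_def by (rule LeastI_ex[of en])
      have qle: "q \<le> q'" if "en q'" for q' unfolding q_def by (rule Least_le[of en]) (rule that)
      have e1: "(\<Sum>i<m. f Y (w i)) \<le> real m * (real q)\<^sup>2" for Y
      proof -
        have "(\<Sum>i<m. f Y (w i)) \<le> (\<Sum>i<2 * m. f Y (w i))"
          by (rule sum_mono2) (auto intro: f0 ws)
        then show ?thesis using q unfolding en_def by (meson order_trans)
      qed
      have e2: "(\<Sum>i<m. f Y (w (i + m))) \<le> real m * (real q)\<^sup>2" for Y
      proof -
        have "(\<Sum>i<m. f Y (w (i + m))) = (\<Sum>i\<in>{m..<2 * m}. f Y (w i))"
          by (rule sum.reindex_bij_witness[where i = "\<lambda>i. i - m" and j = "\<lambda>i. i + m"]) auto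
        also have "\<dots> \<le> (\<Sum>i<2 * m. f Y (w i))"
          by (rule sum_mono2) (auto intro: f0 ws)
        finally show ?thesis using q unfolding en_def by (meson order_trans)
      qed
      define B1 where "B1 = {S \<in> Pow {..<m}. \<exists>X. \<bar>\<Sum>i<m. sg S i * f X (w i)\<bar> > \<theta> / 2 * real m * real q}"
      define B2 where "B2 = {S \<in> Pow {..<m}. \<exists>X. \<bar>\<Sum>i<m. sg S i * f X (w (i + m))\<bar> > \<theta> / 2 * real m * real q}"
      have "{S \<in> Pow {..<m}. T S w \<in> G} \<subseteq> B1 \<union> B2"
      proof (rule subsetI, rule ccontr)
        fix S assume S: "S \<in> {S \<in> Pow {..<m}. T S w \<in> G}" "S \<notin> B1 \<union> B2"
        then obtain q' X where q': "en q'" and gt: "\<bar>F X S\<bar> > \<theta> * real m * real q'" using TSG by auto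
        have "\<theta> * real m * real q \<le> \<theta> * real m * real q'" using qle[OF q'] \<theta> by (intro mult_left_mono) auto
        moreover have "\<bar>\<Sum>i<m. sg S i * f X (w i)\<bar> \<le> \<theta> / 2 * real m * real q"
          "\<bar>\<Sum>i<m. sg S i * f X (w (i + m))\<bar> \<le> \<theta> / 2 * real m * real q"
          using S by (auto simp: B1_def B2_def not_less)
        moreover have "F X S = (\<Sum>i<m. sg S i * f X (w i)) - (\<Sum>i<m. sg S i * f X (w (i + m)))"
          by (simp add: F_def right_diff_distrib sum_subtractf)
        ultimately show False using gt by linarith
      qed
      then have "card {S \<in> Pow {..<m}. T S w \<in> G} \<le> card (B1 \<union> B2)"
        by (intro card_mono) (auto simp: B1_def B2_def)
      also have "\<dots> \<le> card B1 + card B2" by (rule card_Un_le)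
      finally have "real (card {S \<in> Pow {..<m}. T S w \<in> G}) \<le> real (card B1) + real (card B2)" by linarith
      also have "\<dots> \<le> 2 ^ m * \<rho> + 2 ^ m * \<rho>"
        unfolding B1_def B2_def using q ws
        by (intro add_mono signs e1 signs[where z = "\<lambda>i. w (i + m)"] e2) (auto simp: en_def)
      finally show ?thesis by (simp add: mult_ac)
    qed
  qed
  \<comment> \<open>Invariance under each \<open>T S\<close>, then exchange of sum and integral: the
    integrand counts the swaps that lead into \<open>G\<close>.\<close>
  have "ennreal (2 ^ m) * emeasure ?P G = (\<Sum>S\<in>Pow {..<m}. emeasure ?P G)"
    by (simp add: card_Pow ennreal_of_nat_eq_real_of_nat[symmetric] flip: ennreal_power)
  also have "\<dots> = (\<Sum>S\<in>Pow {..<m}. \<integral>\<^sup>+w. indicator (T S -` G \<inter> space ?P) w \<partial>?P)"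
    using measurable_sets[OF mT G] by (simp add: TG)
  also have "\<dots> = (\<integral>\<^sup>+w. (\<Sum>S\<in>Pow {..<m}. indicator (T S -` G \<inter> space ?P) w) \<partial>?P)"
    using measurable_sets[OF mT G] by (intro nn_integral_sum[symmetric]) auto
  also have "\<dots> \<le> (\<integral>\<^sup>+w. ennreal (2 * 2 ^ m * \<rho>) \<partial>?P)"
  proof (rule nn_integral_mono)
    fix w assume w: "w \<in> space ?P"
    have "(\<Sum>S\<in>Pow {..<m}. indicator (T S -` G \<inter> space ?P) w) = (\<Sum>S\<in>Pow {..<m}. if T S w \<in> G then 1 else 0 :: ennreal)"
      using w by (intro sum.cong) (auto simp: indicator_def)
    also have "\<dots> = of_nat (card {S \<in> Pow {..<m}. T S w \<in> G})" by (simp add: sum.If_cases Int_def)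
    also have "\<dots> = ennreal (real (card {S \<in> Pow {..<m}. T S w \<in> G}))" by (simp add: ennreal_of_nat_eq_real_of_nat)
    also have "\<dots> \<le> ennreal (2 * 2 ^ m * \<rho>)" using count[OF w] by (rule ennreal_leI)
    finally show "(\<Sum>S\<in>Pow {..<m}. indicator (T S -` G \<inter> space ?P) w) \<le> ennreal (2 * 2 ^ m * \<rho>)" .
  qed
  also have "\<dots> = ennreal (2 * 2 ^ m * \<rho>)" by (simp add: P.emeasure_space_1)
  finally have "2 ^ m * measure ?P G \<le> 2 * 2 ^ m * \<rho>"
    using \<rho> by (simp add: P.emeasure_eq_measure ennreal_mult[symmetric])
  then show ?thesis unfolding G_def by simp
qed


section \<open>Descent over deviation levels\<close>

lemma measure_pair_swap:
  assumes A: "prob_space A" and B: "prob_space B" and G: "G \<in> sets (A \<Otimes>\<^sub>M B)"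
  defines "G' \<equiv> (\<lambda>(y, x). (x, y)) -` G \<inter> space (B \<Otimes>\<^sub>M A)"
  shows "G' \<in> sets (B \<Otimes>\<^sub>M A)" "measure (B \<Otimes>\<^sub>M A) G' = measure (A \<Otimes>\<^sub>M B) G"
proof -
  interpret A: prob_space A by fact
  interpret B: prob_space B by fact
  interpret AB: pair_prob_space A B ..
  have m: "(\<lambda>(y, x). (x, y)) \<in> measurable (B \<Otimes>\<^sub>M A) (A \<Otimes>\<^sub>M B)" by (rule measurable_pair_swap')
  show "G' \<in> sets (B \<Otimes>\<^sub>M A)" unfolding G'_def by (rule measurable_sets[OF m G])
  show "measure (B \<Otimes>\<^sub>M A) G' = measure (A \<Otimes>\<^sub>M B) G"
    unfolding G'_def
    using arg_cong[OF AB.distr_pair_swap, of "\<lambda>N. measure N G"] measure_distr[OF m G] by (simp only:)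
qed

text \<open>Each half of a double sample is the ghost of the other. If one half exceeds level
  \<open>u\<close> with probability at most \<open>1 / 2\<close>, the other exceeds \<open>t\<close>
  with probability at most \<open>16 / 3 * \<rho>\<close>, again below \<open>1 / 2\<close>, as soon
  as \<open>t\<close> satisfies \<open>cond\<close> of \<open>ghost_sample_step\<close>. Steps by a
  factor 8 lead from a level that boundedness rules out to level 1, and a last step leads to
  \<delta>.\<close>

theorem empirical_process_deviation:
  fixes f :: "'q :: countable \<Rightarrow> 'a \<Rightarrow> real"
  assumes M: "prob_space M" and m: "1 \<le> m"
    and mf: "\<And>X. f X \<in> borel_measurable M"
    and f0: "\<And>X z. z \<in> space M \<Longrightarrow> 0 \<le> f X z" and fb: "\<And>X z. z \<in> space M \<Longrightarrow> f X z \<le> b"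
    and mean: "\<And>X. \<bar>(\<integral>z. f X z \<partial>M) - 1\<bar> \<le> \<delta> / 32"
    and var: "\<And>X. (\<integral>z. (f X z)\<^sup>2 \<partial>M) \<le> v" and vm: "v \<le> real m * (\<delta> / 32)\<^sup>2 / 8"
    and \<delta>: "0 < \<delta>" "\<delta> < 1" and \<rho>: "0 \<le> \<rho>" "\<rho> \<le> 1 / 16"
    and signs: "\<And>z q. (\<And>i. i < m \<Longrightarrow> z i \<in> space M) \<Longrightarrow> 1 \<le> (q::nat) \<Longrightarrow>
        (\<And>Y. (\<Sum>i<m. f Y (z i)) \<le> real m * (real q)\<^sup>2) \<Longrightarrow>
        real (card {S \<in> Pow {..<m}. \<exists>X. \<bar>\<Sum>i<m. sg S i * f X (z i)\<bar> > \<delta> / 128 * real m * real q}) \<le> 2 ^ m * \<rho>"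
  shows "measure (PiM {..<m} (\<lambda>_. M)) {z \<in> space (PiM {..<m} (\<lambda>_. M)). \<exists>X. \<bar>(\<Sum>i<m. f X (z i)) / real m - 1\<bar> > \<delta>} \<le> 6 * \<rho>"
proof -
  interpret M: prob_space M by fact
  \<comment> \<open>Twice the \<open>\<delta> / 128\<close> of \<open>signs\<close>, because a
    swapped difference consists of two signed sums.\<close>
  define \<theta> where "\<theta> = \<delta> / 64"
  \<comment> \<open>Half of it covers the bias of the mean, the other half is the deviation in
    Chebyshev's inequality.\<close>
  define \<eta> where "\<eta> = \<delta> / 16"
  define I J where "I = {..<m}" and "J = {m..<2 * m}"
  let ?A = "PiM I (\<lambda>_. M)" and ?B = "PiM J (\<lambda>_. M)" and ?P = "PiM {..<2 * m} (\<lambda>_. M)"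
  interpret A: prob_space ?A by (intro prob_space_PiM M)
  interpret B: prob_space ?B by (intro prob_space_PiM M)
  interpret prod: product_sigma_finite "\<lambda>_ :: nat. M" ..
  have IJ: "I \<inter> J = {}" "I \<union> J = {..<2 * m}" "finite I" "finite J" by (auto simp: I_def J_def)
  have cI: "card I = m" "card J = m" by (auto simp: I_def J_def)
  have ne: "I \<noteq> {}" "J \<noteq> {}" using m by (auto simp: I_def J_def lessThan_empty_iff)
  define a where "a X x = (\<Sum>i\<in>I. f X (x i)) / real m" for X and x :: "nat \<Rightarrow> 'a"
  define a' where "a' X x = (\<Sum>i\<in>J. f X (x i)) / real m" for X and x :: "nat \<Rightarrow> 'a"
  have comp: "(\<lambda>w. f X (w i)) \<in> borel_measurable (PiM K (\<lambda>_. M))" if "i \<in> K" for X i and K :: "nat set"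
    using that mf by (intro measurable_compose[OF measurable_component_singleton]) auto
  have ma: "a X \<in> borel_measurable ?A" and ma': "a' X \<in> borel_measurable ?B" for X
    unfolding a_def a'_def by (intro borel_measurable_divide borel_measurable_sum comp; simp)+
  define G where "G = merge I J -` ghost_event m \<theta> f M \<inter> space (?A \<Otimes>\<^sub>M ?B)"
  have mm: "merge I J \<in> measurable (?A \<Otimes>\<^sub>M ?B) ?P"
    using measurable_merge[of I J "\<lambda>_. M"] by (simp add: IJ)
  have Ge: "ghost_event m \<theta> f M \<in> sets ?P" by (rule ghost_event_sets[OF mf])
  have G: "G \<in> sets (?A \<Otimes>\<^sub>M ?B)" unfolding G_def by (rule measurable_sets[OF mm Ge])
  have GP: "measure (?A \<Otimes>\<^sub>M ?B) G \<le> 2 * \<rho>"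
  proof -
    have "measure (?A \<Otimes>\<^sub>M ?B) G = measure ?P (ghost_event m \<theta> f M)"
      using prod.distr_merge[of I J] measure_distr[OF mm Ge] by (simp add: IJ G_def)
    also have "\<dots> \<le> 2 * \<rho>"
      by (rule ghost_event_bound[OF M m mf f0 _ \<rho>(1)]) (use signs \<delta> in \<open>auto simp: \<theta>_def\<close>)
    finally show ?thesis .
  qed
  have noG: "\<bar>a X x - a' X y\<bar> \<le> \<theta> * real q"
    if x: "x \<in> space ?A" and y: "y \<in> space ?B" and nG: "(x, y) \<notin> G" and q: "1 \<le> (q::nat)"
      and en: "\<forall>Y. a Y x + a' Y y \<le> (real q)\<^sup>2" for x y q X
  proof -
    define w where "w = merge I J (x, y)"
    have wI: "w i = x i" if "i \<in> I" for i using that by (simp add: w_def merge_def)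
    have wJ: "w i = y i" if "i \<in> J" for i using that IJ by (auto simp: w_def merge_def)
    have ws: "w \<in> space ?P" unfolding w_def using x y by (intro measurable_space[OF mm]) (simp add: space_pair_measure)
    have "w \<notin> ghost_event m \<theta> f M" using nG x y by (auto simp: G_def w_def space_pair_measure)
    moreover have "(\<Sum>i<2 * m. f Y (w i)) \<le> real m * (real q)\<^sup>2" for Y
    proof -
      have "(\<Sum>i<2 * m. f Y (w i)) = (\<Sum>i\<in>I. f Y (w i)) + (\<Sum>i\<in>J. f Y (w i))"
        unfolding IJ(2)[symmetric] by (rule sum.union_disjoint) (use IJ in auto)
      also have "\<dots> = real m * (a Y x + a' Y y)"
        using m by (simp add: a_def a'_def wI wJ add_divide_distrib[symmetric])
      also have "\<dots> \<le> real m * (real q)\<^sup>2" using en by (intro mult_left_mono) auto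
      finally show ?thesis .
    qed
    ultimately have "\<bar>\<Sum>i<m. f X (w i) - f X (w (i + m))\<bar> \<le> \<theta> * real m * real q"
      using ws q by (auto simp: ghost_event_def not_less)
    moreover have "(\<Sum>i<m. f X (w i) - f X (w (i + m))) = real m * (a X x - a' X y)"
    proof -
      have "(\<Sum>i<m. f X (w (i + m))) = (\<Sum>i\<in>J. f X (w i))"
        unfolding J_def by (rule sum.reindex_bij_witness[where i = "\<lambda>i. i - m" and j = "\<lambda>i. i + m"]) auto
      then show ?thesis using m wI wJ by (simp add: sum_subtractf a_def a'_def I_def diff_divide_distrib[symmetric])
    qed
    ultimately have "real m * \<bar>a X x - a' X y\<bar> \<le> real m * (\<theta> * real q)"
      by (simp add: abs_mult mult_ac)
    then show ?thesis using m by simp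
  qed
  have cheb: "measure (PiM K (\<lambda>_. M)) {y \<in> space (PiM K (\<lambda>_. M)). \<bar>(\<Sum>i\<in>K. f X (y i)) / real m - 1\<bar> > \<eta>} \<le> 1 / 8"
    if K: "finite K" "K \<noteq> {}" "card K = m" for K :: "nat set" and X
  proof -
    interpret K: prob_space "PiM K (\<lambda>_. M)" by (intro prob_space_PiM M)
    have "measure (PiM K (\<lambda>_. M)) {y \<in> space (PiM K (\<lambda>_. M)). \<bar>(\<Sum>i\<in>K. f X (y i)) / real m - 1\<bar> > \<eta>}
        \<le> measure (PiM K (\<lambda>_. M)) {y \<in> space (PiM K (\<lambda>_. M)). \<bar>(\<Sum>i\<in>K. f X (y i)) / real (card K) - (\<integral>z. f X z \<partial>M)\<bar> > \<delta> / 32}"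
    proof (rule K.finite_measure_mono)
      have [measurable]: "(\<lambda>y. (\<Sum>i\<in>K. f X (y i)) / real (card K)) \<in> borel_measurable (PiM K (\<lambda>_. M))"
        by (intro borel_measurable_divide borel_measurable_sum comp; simp)
      show "{y \<in> space (PiM K (\<lambda>_. M)). \<bar>(\<Sum>i\<in>K. f X (y i)) / real (card K) - (\<integral>z. f X z \<partial>M)\<bar> > \<delta> / 32}
        \<in> sets (PiM K (\<lambda>_. M))" by measurable
      show "{y \<in> space (PiM K (\<lambda>_. M)). \<bar>(\<Sum>i\<in>K. f X (y i)) / real m - 1\<bar> > \<eta>}
        \<subseteq> {y \<in> space (PiM K (\<lambda>_. M)). \<bar>(\<Sum>i\<in>K. f X (y i)) / real (card K) - (\<integral>z. f X z \<partial>M)\<bar> > \<delta> / 32}"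
      proof safe
        fix y assume "\<bar>(\<Sum>i\<in>K. f X (y i)) / real m - 1\<bar> > \<eta>"
        then show "\<bar>(\<Sum>i\<in>K. f X (y i)) / real (card K) - (\<integral>z. f X z \<partial>M)\<bar> > \<delta> / 32"
          using mean[of X] unfolding \<eta>_def K(3) by linarith
      qed
    qed
    also have "\<dots> \<le> v / (real (card K) * (\<delta> / 32)\<^sup>2)"
    proof (rule PiM_Chebyshev[OF M K(1,2) mf])
      show "\<bar>f X z\<bar> \<le> b" if "z \<in> space M" for z using f0[OF that] fb[OF that] by simp
    qed (use var \<delta> in auto)
    also have "\<dots> \<le> 1 / 8" using vm m \<delta> unfolding K(3) by (simp add: field_simps)
    finally show ?thesis .
  qed
  have ab: "\<bar>(\<Sum>i\<in>K. f X (x i)) / real m\<bar> \<le> b" if "card K = m" "x \<in> space (PiM K (\<lambda>_. M))" for X x and K :: "nat set"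
  proof -
    have xs: "x i \<in> space M" if "i \<in> K" for i using \<open>x \<in> space _\<close> that by (auto simp: space_PiM)
    have "0 \<le> (\<Sum>i\<in>K. f X (x i))" by (intro sum_nonneg f0 xs)
    moreover have "(\<Sum>i\<in>K. f X (x i)) \<le> (\<Sum>i\<in>K. b)" by (intro sum_mono fb xs)
    ultimately show ?thesis using m that(1) by (simp add: field_simps)
  qed
  define G' where "G' = (\<lambda>(y, x). (x, y)) -` G \<inter> space (?B \<Otimes>\<^sub>M ?A)"
  have G': "G' \<in> sets (?B \<Otimes>\<^sub>M ?A)" "measure (?B \<Otimes>\<^sub>M ?A) G' = measure (?A \<Otimes>\<^sub>M ?B) G"
    unfolding G'_def by (rule measure_pair_swap[OF A.prob_space_axioms B.prob_space_axioms G])+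
  have noG': "\<bar>a' X y - a X x\<bar> \<le> \<theta> * real q"
    if "y \<in> space ?B" "x \<in> space ?A" "(y, x) \<notin> G'" "1 \<le> (q::nat)"
      "\<forall>Y. a' Y y + a Y x \<le> (real q)\<^sup>2" for x y q X
    using noG[of x y q X] that by (auto simp: G'_def space_pair_measure abs_minus_commute add.commute)
  have \<theta>: "0 \<le> \<theta>" "\<theta> \<le> 1 / 4" using \<delta> by (auto simp: \<theta>_def)
  let ?tA = "\<lambda>t. measure ?A {x \<in> space ?A. \<exists>X. \<bar>a X x - 1\<bar> > t}"
  let ?tB = "\<lambda>t. measure ?B {y \<in> space ?B. \<exists>X. \<bar>a' X y - 1\<bar> > t}"
  have stepA: "?tA t \<le> 8 / 3 * (2 * \<rho>)"
    if "?tB u \<le> 1 / 2" "0 < t" "0 \<le> u" "\<eta> + \<theta> * (3 + u) \<le> t * (1 / 2 - \<theta>)" for t u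
  proof -
    have "?tA t \<le> 8 / 3 * measure (?A \<Otimes>\<^sub>M ?B) G"
      by (rule ghost_sample_step[OF A.prob_space_axioms B.prob_space_axioms ma ma' G _ that(1) noG _ \<theta> that(2-4)])
        (use cheb[OF IJ(4) ne(2) cI(2)] ab[OF cI(1)] in \<open>auto simp: a_def a'_def\<close>)
    then show ?thesis using GP by linarith
  qed
  have stepB: "?tB t \<le> 8 / 3 * (2 * \<rho>)"
    if "?tA u \<le> 1 / 2" "0 < t" "0 \<le> u" "\<eta> + \<theta> * (3 + u) \<le> t * (1 / 2 - \<theta>)" for t u
  proof -
    have "?tB t \<le> 8 / 3 * measure (?B \<Otimes>\<^sub>M ?A) G'"
      by (rule ghost_sample_step[OF B.prob_space_axioms A.prob_space_axioms ma' ma G'(1) _ that(1) noG' _ \<theta> that(2-4)])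
        (use cheb[OF IJ(3) ne(1) cI(1)] ab[OF cI(2)] in \<open>auto simp: a_def a'_def\<close>)
    then show ?thesis using GP G'(2) by linarith
  qed
  have \<rho>2: "8 / 3 * (2 * \<rho>) \<le> 1 / 2" using \<rho> by simp
  have cnd: "\<eta> + \<theta> * (3 + 8 * t) \<le> t * (1 / 2 - \<theta>)" if "1 \<le> t" for t
  proof -
    have "\<theta> * (3 + 8 * t) + t * \<theta> \<le> 1 / 64 * (12 * t)"
      using that \<delta> mult_mono[of \<theta> "1 / 64" "3 + 9 * t" "12 * t"] by (simp add: \<theta>_def algebra_simps)
    moreover have "\<eta> \<le> t / 16" using that \<delta> by (simp add: \<eta>_def)
    ultimately show ?thesis using that by (simp add: algebra_simps)
  qed
  \<comment> \<open>Both halves descend together, since each step for one half uses the previous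
    level of the other.\<close>
  have down: "?tA (8 ^ k) \<le> 1 / 2 \<and> ?tB (8 ^ k) \<le> 1 / 2" if "k \<le> N" "?tA (8 ^ N) \<le> 1 / 2 \<and> ?tB (8 ^ N) \<le> 1 / 2" for k N
    using that(1)
  proof (induction rule: inc_induct)
    case base
    then show ?case using that(2) by simp
  next
    case (step k)
    have 1: "(1::real) \<le> 8 ^ k" by simp
    show ?case
      using stepA[of "8 * 8 ^ k" "8 ^ k"] stepB[of "8 * 8 ^ k" "8 ^ k"] step.IH cnd[OF 1] \<rho>2 by simp
  qed
  \<comment> \<open>Deviations never exceed \<open>b + 1\<close>, so at level \<open>8 ^ N\<close>
    both events are empty. The value of \<open>N\<close> does not enter the final bound.\<close>
  obtain N :: nat where N: "b + 1 < 8 ^ N" using real_arch_pow[of 8 "b + 1"] by auto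
  have small: "\<bar>z - 1\<bar> \<le> 8 ^ N" if "\<bar>z\<bar> \<le> b" for z :: real using N that by linarith
  have "\<bar>a X x - 1\<bar> \<le> 8 ^ N" if "x \<in> space ?A" for X x
    unfolding a_def by (intro small ab cI that)
  then have "{x \<in> space ?A. \<exists>X. \<bar>a X x - 1\<bar> > 8 ^ N} = {}" by (auto simp: not_less)
  moreover have "\<bar>a' X y - 1\<bar> \<le> 8 ^ N" if "y \<in> space ?B" for X y
    unfolding a'_def by (intro small ab cI that)
  then have "{y \<in> space ?B. \<exists>X. \<bar>a' X y - 1\<bar> > 8 ^ N} = {}" by (auto simp: not_less)
  ultimately have "?tA (8 ^ N) \<le> 1 / 2 \<and> ?tB (8 ^ N) \<le> 1 / 2" by (simp only:) simp
  from down[of 0 N, OF _ this] have "?tB 1 \<le> 1 / 2" by simp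
  then have "?tA \<delta> \<le> 8 / 3 * (2 * \<rho>)"
  proof (rule stepA)
    have "\<eta> + \<theta> * (3 + 1) \<le> \<delta> / 2 - 1 * \<theta>" using \<delta> by (simp add: \<eta>_def \<theta>_def)
    also have "\<dots> \<le> \<delta> / 2 - \<delta> * \<theta>" using \<delta> \<theta> by (intro diff_left_mono mult_right_mono) auto
    also have "\<dots> = \<delta> * (1 / 2 - \<theta>)" by (simp add: algebra_simps)
    finally show "\<eta> + \<theta> * (3 + 1) \<le> \<delta> * (1 / 2 - \<theta>)" .
  qed (use \<delta> in auto)
  also have "\<dots> \<le> 6 * \<rho>" using \<rho> by simp
  finally show ?thesis by (simp add: a_def I_def)
qed

subsection \<open>The uniform bound and recovery\<close>

lemma vnorm_scale: "vnorm n (\<lambda>i. c * x i) = \<bar>c\<bar> * vnorm n x"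
proof -
  have "vnorm n (\<lambda>i. c * x i) = sqrt (c\<^sup>2 * ip n x x)"
    unfolding vnorm_ip ip_scale_left ip_scale_right by (simp add: power2_eq_square mult.assoc)
  then show ?thesis by (simp add: real_sqrt_mult vnorm_ip)
qed

lemma vnorm_diff_le: "vnorm n (\<lambda>i. x i - y i) \<le> vnorm n x + vnorm n y"
proof (rule power2_le_imp_le)
  have "ip n (\<lambda>i. x i - y i) (\<lambda>i. x i - y i) = ip n x x - 2 * ip n x y + ip n y y"
    unfolding ip_diff_left ip_diff_right by (simp add: ip_commute[of n y x])
  also have "\<dots> \<le> (vnorm n x)\<^sup>2 + 2 * (vnorm n x * vnorm n y) + (vnorm n y)\<^sup>2"
    using ip_Cauchy_Schwarz[of n x y] by (simp add: vnorm_power2)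
  finally show "(vnorm n (\<lambda>i. x i - y i))\<^sup>2 \<le> (vnorm n x + vnorm n y)\<^sup>2"
    by (simp add: vnorm_power2[of n "\<lambda>i. x i - y i"] power2_sum)
qed simp

lemma vnorm_mv_le_frob: "vnorm n (mv n B x) \<le> frob n B * vnorm n x"
proof (rule power2_le_imp_le)
  have "(vnorm n (mv n B x))\<^sup>2 = (\<Sum>i<n. (ip n (B i) x)\<^sup>2)"
    unfolding vnorm_power2 by (simp add: ip_def[of n "mv n B x"] mv_def ip_def power2_eq_square)
  also have "\<dots> \<le> (\<Sum>i<n. ip n (B i) (B i) * (vnorm n x)\<^sup>2)"
  proof (rule sum_mono)
    fix i
    have "\<bar>ip n (B i) x\<bar>\<^sup>2 \<le> (vnorm n (B i) * vnorm n x)\<^sup>2"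
      by (intro power_mono ip_Cauchy_Schwarz) simp
    then show "(ip n (B i) x)\<^sup>2 \<le> ip n (B i) (B i) * (vnorm n x)\<^sup>2"
      by (simp add: power_mult_distrib vnorm_power2[of n "B i"])
  qed
  also have "\<dots> = (frob n B * vnorm n x)\<^sup>2"
    by (simp add: power_mult_distrib frob_power2 minner_ip sum_distrib_right)
  finally show "(vnorm n (mv n B x))\<^sup>2 \<le> (frob n B * vnorm n x)\<^sup>2" .
qed simp

lemma op_leI:
  assumes "\<And>y. vnorm n (mv n B y) \<le> c * vnorm n y"
  shows "op_le n c B"
  unfolding op_le_def
proof (intro allI)
  fix x y
  have "ip n x (mv n B y) \<le> vnorm n x * vnorm n (mv n B y)" using ip_Cauchy_Schwarz[of n x "mv n B y"] by simp
  also have "\<dots> \<le> vnorm n x * (c * vnorm n y)" using assms by (intro mult_left_mono) auto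
  finally show "ip n x (mv n B y) \<le> c * vnorm n x * vnorm n y" by (simp add: mult_ac)
qed

lemma op_le_frob: "op_le n (frob n B) B"
  by (intro op_leI vnorm_mv_le_frob)

text \<open>The supremum in \<open>spec_norm\<close> dominates its members only because the set is
  bounded, here by the Frobenius norm; homogeneity then extends the bound from the unit
  ball.\<close>

lemma op_le_spec_norm:
  assumes "spec_norm n B \<le> K"
  shows "op_le n K B"
proof (rule op_leI)
  fix y
  have bdd: "bdd_above {vnorm n (\<lambda>i. \<Sum>j<n. B i j * x j) | x. vnorm n x \<le> 1}"
  proof (rule bdd_aboveI)
    fix w assume "w \<in> {vnorm n (\<lambda>i. \<Sum>j<n. B i j * x j) | x. vnorm n x \<le> 1}"
    then obtain x where x: "w = vnorm n (mv n B x)" "vnorm n x \<le> 1" by (auto simp: mv_def)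
    have "frob n B * vnorm n x \<le> frob n B * 1" using x(2) by (intro mult_left_mono) auto
    then show "w \<le> frob n B" using vnorm_mv_le_frob[of n B x] x(1) by simp
  qed
  have unit: "vnorm n (mv n B x) \<le> K" if "vnorm n x \<le> 1" for x
  proof -
    have "vnorm n (mv n B x) \<le> spec_norm n B"
      unfolding spec_norm_def using that by (intro cSup_upper[OF _ bdd]) (auto simp: mv_def)
    then show ?thesis using assms by simp
  qed
  show "vnorm n (mv n B y) \<le> K * vnorm n y"
  proof (cases "vnorm n y = 0")
    case True
    then show ?thesis using vnorm_mv_le_frob[of n B y] by simp
  next
    case False
    then have pos: "0 < vnorm n y" using vnorm_nonneg[of n y] by linarith
    have "vnorm n (mv n B (\<lambda>i. 1 / vnorm n y * y i)) \<le> K"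
      by (rule unit) (unfold vnorm_scale, use pos in simp)
    then have "1 / vnorm n y * vnorm n (mv n B y) \<le> K"
      unfolding mv_scale vnorm_scale using pos by simp
    then show ?thesis using pos by (simp add: field_simps)
  qed
qed

lemma frob_le_nuc_norm: "frob n X \<le> nuc_norm n X"
proof (cases "frob n X = 0")
  case False
  then have "0 < frob n X" using frob_nonneg[of n X] by linarith
  moreover have "frob n X * frob n X \<le> frob n X * nuc_norm n X"
    using minner_le_nuc_norm[OF op_le_frob, of n X X] by (simp add: frob_power2[symmetric] power2_eq_square)
  ultimately show ?thesis by simp
qed (simp add: nuc_norm_nonneg)

lemma abs_minner_le:
  assumes "op_le n K B" "0 \<le> K"
  shows "\<bar>minner n B X\<bar> \<le> K * nuc_norm n X"
proof -
  have "op_le n (\<bar>- 1\<bar> * K) (\<lambda>i j. - 1 * B i j)" by (rule op_le_scale[OF assms(1)])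
  then have "minner n (\<lambda>i j. - 1 * B i j) X \<le> K * nuc_norm n X"
    using minner_le_nuc_norm[of n K "\<lambda>i j. - 1 * B i j" X] by simp
  then show ?thesis using minner_le_nuc_norm[OF assms(1), of X] unfolding minner_scale_left by simp
qed

section \<open>Restricted isometry on a nuclear norm cone\<close>

lemma mrank_le: "mrank n X \<le> n"
  unfolding mrank_def by (rule vec_space.rank_le_nc) (simp add: to_mat_def)

definition nuclear_rip :: "nat \<Rightarrow> nat \<Rightarrow> real \<Rightarrow> real \<Rightarrow> (nat \<Rightarrow> nat \<Rightarrow> nat \<Rightarrow> real) \<Rightarrow> bool" where
  "nuclear_rip n m s \<delta> Bs \<longleftrightarrow> (\<forall>X\<in>sqmats n. nuc_norm n X \<le> s * frob n X \<longrightarrow>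
     \<bar>(vnorm m (meas n Bs X))\<^sup>2 / real m - (frob n X)\<^sup>2\<bar> \<le> \<delta> * (frob n X)\<^sup>2)"

text \<open>Ranks never exceed \<open>n\<close>, so \<open>min r n\<close> loses nothing and lets
  the probabilistic part assume \<open>r \<le> n\<close>.\<close>

lemma nuclear_rip_rank:
  assumes rip: "nuclear_rip n m (3 * sqrt (real (min r n))) \<delta> Bs" and X: "X \<in> sqmats n" "mrank n X \<le> r"
  shows "\<bar>(vnorm m (meas n Bs X))\<^sup>2 / real m - (frob n X)\<^sup>2\<bar> \<le> \<delta> * (frob n X)\<^sup>2"
proof -
  have "nuc_norm n X \<le> sqrt (real (min r n)) * frob n X"
    using X(2) mrank_le[of n X] by (intro nuc_norm_le_rank) simp
  also have "\<dots> \<le> 3 * sqrt (real (min r n)) * frob n X" by (simp add: mult_right_mono)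
  finally show ?thesis using rip X(1) by (simp add: nuclear_rip_def)
qed

text \<open>The error \<open>H\<close> lies in the cone by
  \<open>nuc_norm_descent_direction\<close>, and both matrices fit the data within \<epsilon>, so
  \<open>H\<close> has measurements of norm at most \<open>2 * \<epsilon>\<close>. The lower
  isometry bound converts this into a bound on \<open>H\<close>.\<close>

lemma nuclear_rip_recovery:
  assumes rip: "nuclear_rip n m (3 * sqrt (real (min r n))) \<delta> Bs" and \<delta>: "\<delta> < 1" and m: "0 < m"
    and X: "X \<in> sqmats n" "mrank n X \<le> r" and Z: "Z \<in> sqmats n"
    and yX: "vnorm m (\<lambda>l. y l - meas n Bs X l) \<le> \<epsilon>" and yZ: "vnorm m (\<lambda>l. y l - meas n Bs Z l) \<le> \<epsilon>"
    and le: "nuc_norm n Z \<le> nuc_norm n X"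
  shows "frob n (\<lambda>i j. Z i j - X i j) \<le> 2 / sqrt (1 - \<delta>) * \<epsilon> / sqrt (real m)"
proof -
  define H where "H = (\<lambda>i j. Z i j - X i j)"
  have "nuc_norm n H \<le> 3 * sqrt (real (min r n)) * frob n H"
    using X(2) mrank_le[of n X] le by (intro nuc_norm_descent_direction[of n X]) (simp_all add: H_def)
  moreover have "H \<in> sqmats n" using X Z by (simp add: sqmats_def H_def)
  ultimately have "\<bar>(vnorm m (meas n Bs H))\<^sup>2 / real m - (frob n H)\<^sup>2\<bar> \<le> \<delta> * (frob n H)\<^sup>2"
    using rip by (simp add: nuclear_rip_def)
  then have low: "(1 - \<delta>) * (frob n H)\<^sup>2 \<le> (vnorm m (meas n Bs H))\<^sup>2 / real m"
    by (simp add: algebra_simps)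
  have "meas n Bs H = (\<lambda>l. (y l - meas n Bs X l) - (y l - meas n Bs Z l))"
    by (simp add: meas_def H_def minner_diff_right)
  then have "vnorm m (meas n Bs H) \<le> 2 * \<epsilon>"
    using vnorm_diff_le[of m "\<lambda>l. y l - meas n Bs X l" "\<lambda>l. y l - meas n Bs Z l"] yX yZ by simp
  then have "(vnorm m (meas n Bs H))\<^sup>2 \<le> (2 * \<epsilon>)\<^sup>2" by (intro power_mono) auto
  then have "(vnorm m (meas n Bs H))\<^sup>2 / real m \<le> (2 * \<epsilon>)\<^sup>2 / real m" by (intro divide_right_mono) auto
  with low have "(frob n H)\<^sup>2 * (1 - \<delta>) \<le> (2 * \<epsilon>)\<^sup>2 / real m" by (simp only: mult.commute)
  then have "(frob n H)\<^sup>2 \<le> (2 * \<epsilon>)\<^sup>2 / real m / (1 - \<delta>)" using \<delta> by (subst pos_le_divide_eq) simp_all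
  also have "\<dots> = (2 / sqrt (1 - \<delta>) * \<epsilon> / sqrt (real m))\<^sup>2"
    using \<delta> m by (simp add: power_divide power_mult_distrib)
  finally have "(frob n H)\<^sup>2 \<le> (2 / sqrt (1 - \<delta>) * \<epsilon> / sqrt (real m))\<^sup>2" .
  moreover have "0 \<le> \<epsilon>" using order_trans[OF vnorm_nonneg yX] .
  ultimately have "frob n H \<le> 2 / sqrt (1 - \<delta>) * \<epsilon> / sqrt (real m)"
    using \<delta> by (intro power2_le_imp_le[of "frob n H"]) auto
  then show ?thesis by (simp only: H_def)
qed

text \<open>Serves the case \<open>r = 0\<close>: the cone then contains only matrices of Frobenius
  norm 0, because the nuclear norm dominates it.\<close>

lemma nuclear_rip_scale_zero: "nuclear_rip n m 0 \<delta> Bs"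
  unfolding nuclear_rip_def
proof (intro ballI impI)
  fix X assume "nuc_norm n X \<le> 0 * frob n X"
  then have f: "frob n X = 0" using frob_le_nuc_norm[of n X] frob_nonneg[of n X] by linarith
  then have "minner n (Bs l) X = 0" for l using minner_Cauchy_Schwarz[of n "Bs l" X] by simp
  then show "\<bar>(vnorm m (meas n Bs X))\<^sup>2 / real m - (frob n X)\<^sup>2\<bar> \<le> \<delta> * (frob n X)\<^sup>2"
    using f by (simp add: meas_def vnorm_def)
qed

text \<open>The constant is \<open>9331200 = 6\<^sup>2 * 288 * 9 * 100\<close>. When \<open>m\<close> exceeds \<open>n ^ 20 / 2\<close>, the factor
  \<open>ln (2 m + 1)\<close> is not of order \<open>ln n\<close> and is absorbed by \<open>\<surd>m\<close> instead.\<close>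

lemma sample_size_suffices:
  fixes n m r J k :: nat and K \<tau> :: real
  assumes \<tau>: "0 < \<tau>" and n: "72 \<le> n" "16 * 9331200 / \<tau>\<^sup>2 \<le> real n" and r: "1 \<le> r" "r \<le> n"
    and K: "0 < K" "K \<le> (real n)\<^sup>2" and m: "real m > 80 * 9331200 / \<tau>\<^sup>2 * real r * K\<^sup>2 * (ln (real n)) ^ 7"
    and J: "real J \<le> 6 * ln (real n)" and k: "real k \<le> 2 * ln (real n)"
  shows "(real J)\<^sup>2 * 288 * (9 * real r * K\<^sup>2) * (2 * (24 * real k * ln (real (2 * m + 1))) + 4 * ln (real n))
    \<le> \<tau>\<^sup>2 / 4 * real m"
proof -
  define L where "L = ln (real n)"
  define l where "l = ln (real (2 * m + 1))"
  define a where "a = real r * K\<^sup>2"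
  have L1: "1 \<le> L"
  proof -
    have "exp 1 \<le> real n" using exp_le n by linarith
    then show ?thesis using n by (simp add: L_def ln_ge_iff)
  qed
  have a0: "0 < a" using r K by (simp add: a_def)
  have m1: "1 \<le> m"
  proof -
    have "0 \<le> 80 * 9331200 / \<tau>\<^sup>2 * real r * K\<^sup>2 * (ln (real n)) ^ 7" using n by simp
    then show ?thesis using m by simp
  qed
  have l1: "1 \<le> l"
  proof -
    have "exp 1 \<le> real (2 * m + 1)" using exp_le m1 by linarith
    then show ?thesis using m1 by (simp add: l_def ln_ge_iff)
  qed
  have "(real J)\<^sup>2 * 288 * (9 * real r * K\<^sup>2) * (2 * (24 * real k * l) + 4 * L)
      \<le> (6 * L)\<^sup>2 * 288 * (9 * real r * K\<^sup>2) * (100 * L * l)"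
  proof (intro mult_mono)
    show "(real J)\<^sup>2 \<le> (6 * L)\<^sup>2" using J by (intro power_mono) (auto simp: L_def)
    \<comment> \<open>The constant 100 is \<open>2 * 24 * 2 + 4\<close>.\<close>
    have "real k * l \<le> 2 * L * l" using k l1 by (intro mult_right_mono) (auto simp: L_def)
    moreover have "L \<le> L * l" using L1 l1 by simp
    ultimately show "2 * (24 * real k * l) + 4 * L \<le> 100 * L * l" by (simp add: algebra_simps)
    show "0 \<le> 2 * (24 * real k * l) + 4 * L" using l1 L1 by simp
  qed (use r K in auto)
  also have "\<dots> = 9331200 * a * L ^ 3 * l" by (simp add: a_def power2_eq_square power3_eq_cube)
  also have "\<dots> \<le> \<tau>\<^sup>2 / 4 * real m"
  proof (cases "real (2 * m + 1) \<le> real n ^ 20")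
    case True
    \<comment> \<open>In this range \<open>J\<close>, \<open>k\<close> and \<open>l\<close>
      contribute \<open>L ^ 4\<close> in all, below the seventh power of the hypothesis. The factor
      20 and the 4 of \<open>\<tau>\<^sup>2 / 4\<close> make up the 80.\<close>
    have "l \<le> ln (real n ^ 20)" using True n unfolding l_def by (subst ln_le_cancel_iff) auto
    then have "l \<le> 20 * L" using n by (simp add: L_def ln_realpow)
    then have "9331200 * a * L ^ 3 * l \<le> 9331200 * a * L ^ 3 * (20 * L)"
      using a0 L1 by (intro mult_left_mono) auto
    also have "\<dots> = 20 * 9331200 * a * L ^ 4" by (simp add: power4_eq_xxxx power3_eq_cube)
    also have "\<dots> \<le> 20 * 9331200 * a * L ^ 7" using a0 L1 by (intro mult_left_mono power_increasing) auto
    also have "\<dots> \<le> \<tau>\<^sup>2 / 4 * real m"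
      using m \<tau> by (simp add: a_def L_def field_simps)
    finally show ?thesis .
  next
    case False
    \<comment> \<open>Here \<open>m\<close> outgrows everything else: \<open>a * L ^ 3\<close> is at
      most \<open>n ^ 8\<close> and \<open>l\<close> at most \<open>4 * sqrt m\<close>, while
      \<open>n ^ 9 \<le> sqrt m\<close> leaves one factor \<open>n\<close> for the
      constants.\<close>
    have n18: "real n ^ 18 \<le> real m"
    proof (rule ccontr)
      assume "\<not> ?thesis"
      then have "real (2 * m + 1) \<le> 2 * real n ^ 18 + 1" by simp
      also have "1 \<le> real n ^ 18" using n by simp
      also have "2 * real n ^ 18 + real n ^ 18 \<le> (real n)\<^sup>2 * real n ^ 18"
      proof -
        have "3 \<le> (real n)\<^sup>2" using n power_mono[of 72 "real n" 2] by simp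
        then have "3 * real n ^ 18 \<le> (real n)\<^sup>2 * real n ^ 18" by (intro mult_right_mono) auto
        then show ?thesis by simp
      qed
      also have "\<dots> = real n ^ 20" by (simp add: power_add[symmetric])
      finally show False using False by simp
    qed
    have n9: "real n ^ 9 \<le> sqrt (real m)"
    proof (rule real_le_rsqrt)
      show "(real n ^ 9)\<^sup>2 \<le> real m" using n18 by (simp add: power_mult[symmetric])
    qed
    have "l = 2 * ln (sqrt (real (2 * m + 1)))" by (simp add: l_def ln_sqrt)
    also have "\<dots> \<le> 2 * sqrt (real (2 * m + 1))"
      using ln_le_minus_one[of "sqrt (real (2 * m + 1))"] by simp
    also have "\<dots> \<le> 2 * sqrt (4 * real m)" using m1 by simp
    finally have l4: "l \<le> 4 * sqrt (real m)" by (simp add: real_sqrt_mult)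
    have an: "a \<le> real n ^ 5"
    proof -
      have "a \<le> real n * ((real n)\<^sup>2)\<^sup>2" unfolding a_def using r K by (intro mult_mono power_mono) auto
      then show ?thesis by (simp add: power_mult[symmetric] power_Suc[symmetric])
    qed
    have Ln: "L \<le> real n" using ln_le_minus_one[of "real n"] n by (simp add: L_def)
    have "9331200 * a * L ^ 3 * l \<le> 9331200 * real n ^ 5 * real n ^ 3 * (4 * sqrt (real m))"
      using an Ln l4 a0 L1 l1 by (intro mult_mono power_mono) auto
    also have "\<dots> = 4 * 9331200 * real n ^ 8 * sqrt (real m)" by (simp add: power_add[symmetric])
    also have "\<dots> \<le> \<tau>\<^sup>2 / 4 * real n ^ 9 * sqrt (real m)"
    proof (rule mult_right_mono)
      have "16 * 9331200 \<le> \<tau>\<^sup>2 * real n" using n(2) \<tau> by (simp add: field_simps)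
      then have "16 * 9331200 * real n ^ 8 \<le> \<tau>\<^sup>2 * real n * real n ^ 8" by (intro mult_right_mono) auto
      also have "\<dots> = \<tau>\<^sup>2 * real n ^ 9" by (simp add: mult.assoc flip: power_Suc)
      finally show "4 * 9331200 * real n ^ 8 \<le> \<tau>\<^sup>2 / 4 * real n ^ 9" by simp
    qed simp
    also have "\<dots> \<le> \<tau>\<^sup>2 / 4 * sqrt (real m) * sqrt (real m)"
      using n9 by (intro mult_right_mono mult_left_mono) auto
    also have "\<dots> = \<tau>\<^sup>2 / 4 * real m" by (simp add: mult.assoc)
    finally show ?thesis .
  qed
  finally show ?thesis unfolding L_def l_def .
qed


text \<open>Reduces a condition on uncountably many matrices to countably many, so that its failure
  is a measurable event. One point is chosen from each basic open set that meets
  \<open>U\<close>.\<close>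

lemma countable_dense_subset:
  fixes U :: "'a :: second_countable_topology set"
  obtains T where "countable T" "T \<subseteq> U" "U \<subseteq> closure T"
proof -
  obtain B :: "'a set set" where B: "countable B" "topological_basis B"
    using ex_countable_basis by blast
  define pt where "pt b = (SOME x. x \<in> b \<inter> U)" for b
  define T where "T = pt ` {b \<in> B. b \<inter> U \<noteq> {}}"
  have pt: "pt b \<in> b \<inter> U" if "b \<inter> U \<noteq> {}" for b
    using that someI_ex[of "\<lambda>x. x \<in> b \<inter> U"] unfolding pt_def by blast
  have "x \<in> closure T" if x: "x \<in> U" for x
    unfolding closure_iff_nhds_not_empty
  proof (intro allI impI)
    fix W S assume W: "S \<subseteq> W" "open S" "x \<in> S"
    then obtain b where b: "b \<in> B" "x \<in> b" "b \<subseteq> S" by (meson B(2) topological_basisE)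
    then have "pt b \<in> T" "pt b \<in> b" using x pt[of b] by (auto simp: T_def)
    then show "T \<inter> W \<noteq> {}" using b W by blast
  qed
  moreover have "countable T" using B(1) by (simp add: T_def)
  moreover have "T \<subseteq> U" using pt by (auto simp: T_def)
  ultimately show ?thesis using that by blast
qed

section \<open>Matrix entries, measurability and second moments\<close>

definition unit_mat :: "nat \<Rightarrow> nat \<Rightarrow> nat \<Rightarrow> nat \<Rightarrow> real" where
  "unit_mat i j = (\<lambda>a b. if a = i then (if b = j then 1 else 0) else 0)"

lemma minner_unit_mat: "i < n \<Longrightarrow> j < n \<Longrightarrow> minner n B (unit_mat i j) = B i j"
proof -
  assume ij: "i < n" "j < n"
  have "(\<Sum>b<n. B a b * unit_mat i j a b) = (if a = i then B a j else 0)" for a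
  proof (cases "a = i")
    case True
    have "(\<Sum>b<n. B a b * unit_mat i j a b) = (\<Sum>b<n. if b = j then B a b else 0)"
      using True by (intro sum.cong) (auto simp: unit_mat_def)
    then show ?thesis using True ij by simp
  qed (simp add: unit_mat_def)
  then show ?thesis using ij by (simp add: minner_def)
qed

lemma frob_unit_mat:
  assumes "i < n" "j < n"
  shows "frob n (unit_mat i j) = 1"
proof (rule power2_eq_imp_eq)
  show "(frob n (unit_mat i j))\<^sup>2 = 1\<^sup>2"
    unfolding frob_power2 minner_unit_mat[OF assms] by (simp add: unit_mat_def)
qed simp_all

lemma nuc_norm_le_sqrt_dim: "nuc_norm n X \<le> sqrt (real n) * frob n X"
  by (rule nuc_norm_le_rank[OF mrank_le])

lemma abs_entry_le_frob: "i < n \<Longrightarrow> j < n \<Longrightarrow> \<bar>X i j\<bar> \<le> frob n X"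
  using minner_Cauchy_Schwarz[of n X "unit_mat i j"] by (simp add: minner_unit_mat frob_unit_mat)

lemma op_le_nonneg:
  assumes "op_le n K B" "1 \<le> n"
  shows "0 \<le> K"
proof -
  have v: "vnorm n (std 0) = 1" using assms(2) by (simp add: vnorm_ip ip_std) (simp add: std_def)
  have "ip n (\<lambda>i. - 1 * std 0 i) (mv n B (std 0)) \<le> K * vnorm n (\<lambda>i. - 1 * std 0 i) * vnorm n (std 0)"
    by (rule op_leD[OF assms(1)])
  then have "- ip n (std 0) (mv n B (std 0)) \<le> K" unfolding ip_scale_left vnorm_scale v by simp
  then show ?thesis using op_leD[OF assms(1), of "std 0" "std 0"] by (simp add: v)
qed

lemma measurable_entry:
  assumes "sets \<mu> = sets (matsp n)" "i < n" "j < n"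
  shows "(\<lambda>B. B i j) \<in> borel_measurable \<mu>"
proof -
  have "(\<lambda>B. B i) \<in> measurable (matsp n) (PiM {..<n} (\<lambda>_. borel))"
    unfolding matsp_def using assms by (intro measurable_component_singleton) auto
  moreover have "(\<lambda>x. x j) \<in> measurable (PiM {..<n} (\<lambda>_. borel)) (borel :: real measure)"
    using assms by (intro measurable_component_singleton) auto
  ultimately have "(\<lambda>B. B i j) \<in> borel_measurable (matsp n)" by (rule measurable_compose)
  then show ?thesis using measurable_cong_sets[OF assms(1) refl] by blast
qed

lemma measurable_minner:
  assumes "sets \<mu> = sets (matsp n)"
  shows "(\<lambda>B. minner n B X) \<in> borel_measurable \<mu>"
  unfolding minner_def by (intro borel_measurable_sum borel_measurable_times measurable_entry[OF assms]) auto

text \<open>The integral minus 1 is the quadratic form at \<open>X\<close> of the operator in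
  \<open>EBB_minus_I\<close>, and the operator norm bounds it. The almost sure bound on
  \<open>B\<close> supplies the integrability that lets sums and integrals be exchanged.\<close>

lemma second_moment_bound:
  assumes \<mu>: "prob_space \<mu>" and sets: "sets \<mu> = sets (matsp n)" and K: "0 \<le> K"
    and ae: "AE B in \<mu>. op_le n K B"
    and op: "op_norm_F n (EBB_minus_I n \<mu>) \<le> c"
    and X: "X \<in> sqmats n" "frob n X = 1"
  shows "\<bar>(\<integral>B. (minner n B X)\<^sup>2 \<partial>\<mu>) - 1\<bar> \<le> c"
proof -
  interpret prob_space \<mu> by fact
  define D where "D = K * sqrt (real n)"
  have D0: "0 \<le> D" using K by (simp add: D_def)
  have bdX: "\<bar>minner n B Y\<bar> \<le> D" if "op_le n K B" "frob n Y \<le> 1" for B Y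
  proof -
    have "nuc_norm n Y \<le> sqrt (real n) * 1"
      using nuc_norm_le_sqrt_dim[of n Y] mult_left_mono[OF that(2), of "sqrt (real n)"] by simp
    then have "K * nuc_norm n Y \<le> D" using K by (simp add: D_def mult_left_mono)
    then show ?thesis using abs_minner_le[OF that(1) K, of Y] by simp
  qed
  have bdE: "\<bar>B i j\<bar> \<le> D" if "op_le n K B" "i < n" "j < n" for B i j
    using bdX[OF that(1), of "unit_mat i j"] that by (simp add: minner_unit_mat frob_unit_mat)
  have bdp: "AE B in \<mu>. norm (minner n B Y * B i j) \<le> D * D" if "frob n Y \<le> 1" "i < n" "j < n" for Y i j
    using ae
  proof eventually_elim
    case (elim B)
    show ?case using bdX[OF elim that(1)] bdE[OF elim that(2,3)] D0 by (simp add: abs_mult mult_mono)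
  qed
  have int: "integrable \<mu> (\<lambda>B. minner n B Y * B i j)" if "frob n Y \<le> 1" "i < n" "j < n" for Y i j
    using bdp[OF that] that
    by (intro integrable_const_bound[of _ "D * D"] borel_measurable_times measurable_minner[OF sets] measurable_entry[OF sets])
  \<comment> \<open>The supremum in \<open>op_norm_F\<close> is an upper bound only for a bounded
    set.\<close>
  have bdd: "bdd_above {frob n (EBB_minus_I n \<mu> Y) | Y. Y \<in> sqmats n \<and> frob n Y \<le> 1}"
  proof (rule bdd_aboveI)
    fix w assume "w \<in> {frob n (EBB_minus_I n \<mu> Y) | Y. Y \<in> sqmats n \<and> frob n Y \<le> 1}"
    then obtain Y where w: "w = frob n (EBB_minus_I n \<mu> Y)" and Y: "frob n Y \<le> 1" by auto
    have "\<bar>EBB_minus_I n \<mu> Y i j\<bar> \<le> D * D + 1" if ij: "i < n" "j < n" for i j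
    proof -
      have "AE B in \<mu>. minner n B Y * B i j \<le> D * D" using bdp[OF Y ij] by eventually_elim auto
      then have 1: "(\<integral>B. minner n B Y * B i j \<partial>\<mu>) \<le> D * D" by (rule integral_le_const[OF int[OF Y ij]])
      have "AE B in \<mu>. - (D * D) \<le> minner n B Y * B i j" using bdp[OF Y ij] by eventually_elim auto
      then have 2: "- (D * D) \<le> (\<integral>B. minner n B Y * B i j \<partial>\<mu>)" by (rule integral_ge_const[OF int[OF Y ij]])
      have "\<bar>Y i j\<bar> \<le> 1" using abs_entry_le_frob[OF ij, of Y] Y by simp
      then show ?thesis using 1 2 ij by (simp add: EBB_minus_I_def)
    qed
    then have "(EBB_minus_I n \<mu> Y i j)\<^sup>2 \<le> (D * D + 1)\<^sup>2" if "i < n" "j < n" for i j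
      using that D0 abs_le_square_iff[of "EBB_minus_I n \<mu> Y i j" "D * D + 1"] by simp
    then show "w \<le> sqrt (\<Sum>i<n. \<Sum>j<n. (D * D + 1)\<^sup>2)"
      unfolding w frob_def by (intro real_sqrt_le_mono sum_mono) auto
  qed
  have fr: "frob n (EBB_minus_I n \<mu> X) \<le> c"
  proof -
    have "frob n (EBB_minus_I n \<mu> X) \<le> op_norm_F n (EBB_minus_I n \<mu>)"
      unfolding op_norm_F_def using X by (intro cSup_upper[OF _ bdd]) auto
    then show ?thesis using op by simp
  qed
  have "minner n (EBB_minus_I n \<mu> X) X = (\<Sum>i<n. \<Sum>j<n. ((\<integral>B. minner n B X * B i j \<partial>\<mu>) - X i j) * X i j)"
    by (simp add: minner_def EBB_minus_I_def)
  also have "\<dots> = (\<Sum>i<n. \<Sum>j<n. (\<integral>B. minner n B X * B i j * X i j \<partial>\<mu>)) - minner n X X"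
    by (simp add: minner_def left_diff_distrib sum_subtractf)
  also have "(\<Sum>i<n. \<Sum>j<n. (\<integral>B. minner n B X * B i j * X i j \<partial>\<mu>)) = (\<integral>B. (\<Sum>i<n. \<Sum>j<n. minner n B X * B i j * X i j) \<partial>\<mu>)"
  proof -
    have int2: "integrable \<mu> (\<lambda>B. minner n B X * B i j * X i j)" if "i < n" "j < n" for i j
      using int[of X i j] that X by simp
    have "(\<integral>B. (\<Sum>i<n. \<Sum>j<n. minner n B X * B i j * X i j) \<partial>\<mu>) = (\<Sum>i<n. \<integral>B. (\<Sum>j<n. minner n B X * B i j * X i j) \<partial>\<mu>)"
      by (rule Bochner_Integration.integral_sum) (auto intro!: Bochner_Integration.integrable_sum int2)
    also have "\<dots> = (\<Sum>i<n. \<Sum>j<n. (\<integral>B. minner n B X * B i j * X i j \<partial>\<mu>))"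
      by (intro sum.cong refl Bochner_Integration.integral_sum int2) auto
    finally show ?thesis by simp
  qed
  also have "\<dots> = (\<integral>B. (minner n B X)\<^sup>2 \<partial>\<mu>)"
  proof (rule Bochner_Integration.integral_cong[OF refl])
    fix B
    have "(\<Sum>i<n. \<Sum>j<n. minner n B X * B i j * X i j) = minner n B X * minner n B X"
      by (subst (3) minner_def) (simp add: sum_distrib_left mult.assoc)
    then show "(\<Sum>i<n. \<Sum>j<n. minner n B X * B i j * X i j) = (minner n B X)\<^sup>2" by (simp add: power2_eq_square)
  qed
  finally have "(\<integral>B. (minner n B X)\<^sup>2 \<partial>\<mu>) - 1 = minner n (EBB_minus_I n \<mu> X) X"
    using frob_power2[of n X] X by simp
  then show ?thesis using minner_Cauchy_Schwarz[of n "EBB_minus_I n \<mu> X" X] fr X by simp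
qed


text \<open>\<open>empirical_process_deviation\<close> is applied to the squared measurements of a
  dense sequence of unit matrices in the cone. Its sign hypothesis comes from
  \<open>signs_chaining\<close>, with the covers supplied by
  \<open>nuclear_ball_cover\<close>.\<close>

lemma nuclear_rip_event:
  fixes \<mu> :: "(nat \<Rightarrow> nat \<Rightarrow> real) measure" and n m r :: nat and K \<delta> c5 :: real
  assumes \<mu>: "prob_space \<mu>" and sets: "sets \<mu> = sets (matsp n)"
    and \<delta>: "0 < \<delta>" "\<delta> < 1" and \<tau>: "\<tau> = \<delta> / 128"
    and n: "72 \<le> n" "16 * 9331200 / \<tau>\<^sup>2 \<le> real n" "72 / \<tau> \<le> real n" "32 * c5 / \<delta> \<le> real n"
    and r: "1 \<le> r" "r \<le> n" and K: "K \<le> (real n)\<^sup>2"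
    and spec: "AE B in \<mu>. spec_norm n B \<le> K"
    and op: "op_norm_F n (EBB_minus_I n \<mu>) \<le> c5 / real n"
    and m: "real m > 80 * 9331200 / \<tau>\<^sup>2 * real r * K\<^sup>2 * (ln (real n)) ^ 7"
  shows "\<exists>E \<in> sets (PiM {..<m} (\<lambda>_. \<mu>)). measure (PiM {..<m} (\<lambda>_. \<mu>)) E \<ge> 1 - 1 / (real n)\<^sup>2 \<and>
    (\<forall>Bs\<in>E. nuclear_rip n m (3 * sqrt (real r)) \<delta> Bs)"
proof -
  interpret prob_space \<mu> by fact
  let ?P = "PiM {..<m} (\<lambda>_. \<mu>)"
  interpret P: prob_space ?P by (intro prob_space_PiM \<mu>)
  have n1: "1 \<le> n" using n by simp
  have \<tau>0: "0 < \<tau>" using \<delta> \<tau> by simp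
  have ae: "AE B in \<mu>. op_le n K B" using spec by eventually_elim (rule op_le_spec_norm)
  then obtain N where N: "{B \<in> space \<mu>. \<not> op_le n K B} \<subseteq> N" "emeasure \<mu> N = 0" "N \<in> sets \<mu>"
    by (rule AE_E)
  have notN: "AE B in \<mu>. B \<notin> N" using N by (intro AE_not_in) (auto simp: null_sets_def)
  have good: "op_le n K B" if "B \<in> space \<mu>" "B \<notin> N" for B using that N by blast
  have K0: "0 \<le> K"
  proof -
    have "N \<noteq> space \<mu>" using N emeasure_space_1 by auto
    then obtain B where "B \<in> space \<mu>" "B \<notin> N" using sets.sets_into_space[OF N(3)] by blast
    then show ?thesis using op_le_nonneg[OF good n1] by blast
  qed
  have c5n: "c5 / real n \<le> \<delta> / 32" using n \<delta> by (simp add: field_simps)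
  have mean: "\<bar>(\<integral>B. (minner n B X)\<^sup>2 \<partial>\<mu>) - 1\<bar> \<le> \<delta> / 32" if "X \<in> sqmats n" "frob n X = 1" for X
    using second_moment_bound[OF \<mu> sets K0 ae op that] c5n by linarith
  \<comment> \<open>For \<open>K = 0\<close> the measurement of a unit matrix would vanish almost
    surely, against a second moment close to 1.\<close>
  have Kpos: "0 < K"
  proof (rule ccontr)
    assume "\<not> 0 < K"
    then have "K = 0" using K0 by simp
    have "AE B in \<mu>. (minner n B (unit_mat 0 0))\<^sup>2 = 0"
      using ae
    proof eventually_elim
      case (elim B)
      then show ?case using abs_minner_le[OF elim K0, of "unit_mat 0 0"] \<open>K = 0\<close> by simp
    qed
    then have "(\<integral>B. (minner n B (unit_mat 0 0))\<^sup>2 \<partial>\<mu>) = 0" by (rule integral_eq_zero_AE)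
    moreover have "unit_mat 0 0 \<in> sqmats n" using n1 by (auto simp: sqmats_def unit_mat_def)
    moreover have "frob n (unit_mat 0 0) = 1" using n1 by (intro frob_unit_mat) auto
    ultimately show False using mean[of "unit_mat 0 0"] \<delta> by simp
  qed
  define L where "L = ln (real n)"
  have L2: "2 \<le> L"
  proof -
    have "2 \<le> 3 * ln (2::real)" using ln2_ge_two_thirds by simp
    also have "\<dots> = ln (2 ^ 3)" by (subst ln_realpow) simp_all
    also have "\<dots> \<le> L" using n unfolding L_def by (subst ln_le_cancel_iff) auto
    finally show ?thesis .
  qed
  have m1: "1 \<le> m"
  proof -
    have "0 \<le> 80 * 9331200 / \<tau>\<^sup>2 * real r * K\<^sup>2 * (ln (real n)) ^ 7" using n by simp
    then show ?thesis using m by simp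
  qed
  define s where "s = 3 * sqrt (real r)"
  have s0: "0 < s" using r by (simp add: s_def)
  define b where "b = s * K"
  have b0: "0 < b" using s0 Kpos by (simp add: b_def)
  have b2: "b\<^sup>2 = 9 * real r * K\<^sup>2" by (simp add: b_def s_def power_mult_distrib)
  have bn: "b \<le> 3 * real n ^ 3"
  proof -
    have "1 \<le> real n" using n1 by simp
    then have "real n \<le> (real n)\<^sup>2" by (simp add: power2_eq_square)
    then have "sqrt (real r) \<le> real n" using r by (intro real_le_lsqrt) auto
    then have "b \<le> 3 * real n * (real n)\<^sup>2" unfolding b_def s_def using K Kpos by (intro mult_mono) auto
    then show ?thesis by (simp add: power2_eq_square power3_eq_cube)
  qed
  define k where "k = nat \<lceil>ln (real (2 * n))\<rceil>"
  \<comment> \<open>Enough scales to bring the truncation error \<open>4 * b / 2 ^ J\<close> below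
    \<open>\<tau> / 2\<close>. That \<open>O(ln n)\<close> of them suffice rests on
    \<open>b \<le> 3 * real n ^ 3\<close>, hence on \<open>K \<le> (real n)\<^sup>2\<close>.\<close>
  define J where "J = nat \<lceil>log 2 (24 * real n ^ 3 / \<tau>)\<rceil>"
  have ln2n: "ln (real (2 * n)) = ln 2 + L" using n1 by (simp add: L_def ln_mult)
  have nk: "ln (real (2 * n)) \<le> real k" unfolding k_def by (rule real_nat_ceiling_ge)
  have k1: "1 \<le> k"
  proof -
    have "0 < real k" using nk ln2n L2 ln_gt_zero[of "2::real"] by linarith
    then show ?thesis by simp
  qed
  have kL: "real k \<le> 2 * L"
  proof -
    have "0 \<le> ln (real (2 * n))" using n1 by simp
    then have "real k \<le> ln (real (2 * n)) + 1" unfolding k_def by linarith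
    also have "\<dots> \<le> 2 * L" using ln2n L2 ln_le_minus_one[of "2::real"] by simp
    finally show ?thesis .
  qed
  have arg: "1 \<le> 24 * real n ^ 3 / \<tau>"
  proof -
    have "1 \<le> real n ^ 3" using n1 by (simp add: one_le_power)
    then show ?thesis using \<tau>0 \<tau> \<delta> by (simp add: field_simps)
  qed
  have JL: "real J \<le> 6 * L"
  proof -
    have "0 \<le> log 2 (24 * real n ^ 3 / \<tau>)" using arg by simp
    then have "real J \<le> log 2 (24 * real n ^ 3 / \<tau>) + 1" unfolding J_def by linarith
    also have "log 2 (24 * real n ^ 3 / \<tau>) = (ln (24 / \<tau>) + 3 * L) / ln 2"
    proof -
      have "24 * real n ^ 3 / \<tau> = (24 / \<tau>) * real n ^ 3" by simp
      then have "ln (24 * real n ^ 3 / \<tau>) = ln (24 / \<tau>) + ln (real n ^ 3)"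
        using \<tau>0 n1 by (simp only:) (rule ln_mult_pos, auto)
      then show ?thesis using n1 by (simp add: log_def L_def ln_realpow)
    qed
    also have "\<dots> \<le> 3 / 2 * (ln (24 / \<tau>) + 3 * L)"
    proof -
      have "0 \<le> ln (24 / \<tau>)" using \<tau>0 \<tau> \<delta> by simp
      then have p: "0 \<le> ln (24 / \<tau>) + 3 * L" using L2 by simp
      have "(ln (24 / \<tau>) + 3 * L) / ln 2 \<le> (ln (24 / \<tau>) + 3 * L) / (2 / 3)"
        using p ln2_ge_two_thirds by (intro divide_left_mono) auto
      then show ?thesis by simp
    qed
    also have "3 / 2 * (ln (24 / \<tau>) + 3 * L) + 1 \<le> 6 * L"
    proof -
      define u v w where "u = ln (24 / \<tau>)" and "v = ln (3::real)" and "w = ln (72 / \<tau>)"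
      have "1 \<le> v" unfolding v_def using exp_le by (subst ln_ge_iff) auto
      moreover have "u + v = w"
        unfolding u_def v_def w_def using \<tau>0 ln_mult_pos[of "24 / \<tau>" 3] by simp
      moreover have "w \<le> L" unfolding w_def using n \<tau>0 unfolding L_def by (subst ln_le_cancel_iff) auto
      ultimately have "3 / 2 * (u + 3 * L) + 1 \<le> 6 * L" by (simp only: distrib_left)
      then show ?thesis by (simp only: u_def)
    qed
    finally show ?thesis by simp
  qed
  have J2: "4 * b / 2 ^ J \<le> \<tau> / 2"
  proof -
    have "24 * real n ^ 3 / \<tau> = 2 powr (log 2 (24 * real n ^ 3 / \<tau>))" using arg by simp
    also have "\<dots> \<le> 2 powr (real J)" unfolding J_def by (intro powr_mono real_nat_ceiling_ge) auto
    finally have "24 * real n ^ 3 / \<tau> \<le> 2 ^ J" by (simp add: powr_realpow)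
    then have "8 * (3 * real n ^ 3) \<le> \<tau> * 2 ^ J" using \<tau>0 by (simp add: field_simps)
    then have "8 * b \<le> \<tau> * 2 ^ J" using bn by linarith
    then show ?thesis by (simp add: field_simps)
  qed
  \<comment> \<open>The cover size for the mistake bound \<open>24 * k\<close>. At scale
    \<open>j\<close> the mistake bound is \<open>4 ^ j\<close> times larger, so the size is
    \<open>A ^ (4 ^ j)\<close>.\<close>
  define A where "A = real ((2 * m + 1) ^ (24 * k))"
  have A1: "1 \<le> A" unfolding A_def by simp
  have lnA: "ln A = 24 * real k * ln (real (2 * m + 1))"
    unfolding A_def of_nat_power by (subst ln_realpow) auto
  define \<Lambda> where "\<Lambda> = 2 * ln A + 4 * L"
  have main: "(real J)\<^sup>2 * 288 * b\<^sup>2 * \<Lambda> \<le> \<tau>\<^sup>2 / 4 * real m"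
    using sample_size_suffices[OF \<tau>0 n(1,2) r Kpos K m, of J k] JL kL
    unfolding \<Lambda>_def lnA b2 L_def by simp
  have \<Lambda>0: "0 \<le> \<Lambda>" using A1 L2 by (simp add: \<Lambda>_def)
  \<comment> \<open>The failure proportion of \<open>signs_chaining\<close> with exponent
    \<open>4 * ln n\<close>: the decay \<open>1 / n ^ 4\<close> absorbs \<open>J\<close> and the
    factor 6 and still leaves \<open>1 / n\<^sup>2\<close>.\<close>
  define \<rho> where "\<rho> = 2 * real J * exp (- (4 * L))"
  have eL: "exp (- (4 * L)) = 1 / real n ^ 4"
  proof -
    have "exp (4 * L) = real n ^ 4" using n1 exp_of_nat_mult[of 4 L] by (simp add: L_def)
    then show ?thesis by (simp add: exp_minus field_simps)
  qed
  have \<rho>0: "0 \<le> \<rho>" by (simp add: \<rho>_def)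
  have JN: "real J \<le> 6 * real n" using JL ln_le_minus_one[of "real n"] n1 by (simp add: L_def)
  have \<rho>n: "6 * \<rho> \<le> 1 / (real n)\<^sup>2"
  proof -
    have "72 * real n \<le> (real n)\<^sup>2" using n(1) by (simp add: power2_eq_square)
    then have "12 * real J \<le> (real n)\<^sup>2" using JN by linarith
    then have "12 * real J / real n ^ 4 \<le> (real n)\<^sup>2 / real n ^ 4" by (intro divide_right_mono) auto
    also have "\<dots> = 1 / (real n)\<^sup>2" using n1 by (simp add: field_simps power2_eq_square power4_eq_xxxx)
    finally show ?thesis by (simp add: \<rho>_def eL)
  qed
  have \<rho>16: "\<rho> \<le> 1 / 16"
  proof -
    have "72\<^sup>2 \<le> (real n)\<^sup>2" using n(1) by (intro power_mono) auto
    then have "1 / (real n)\<^sup>2 \<le> 1 / 72\<^sup>2" using n1 by (intro divide_left_mono) auto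
    then show ?thesis using \<rho>n by simp
  qed
  define U where "U = {X \<in> sqmats n. frob n X = 1 \<and> nuc_norm n X \<le> s}"
  obtain T where T: "countable T" "T \<subseteq> U" "U \<subseteq> closure T" by (rule countable_dense_subset)
  \<comment> \<open>The deviation is continuous in the entries of \<open>X\<close>, so the bound
    passes from \<open>T\<close> to its closure, and homogeneity passes from unit matrices to the
    whole cone.\<close>
  have extend: "nuclear_rip n m s \<delta> Bs"
    if bd: "\<And>X. X \<in> T \<Longrightarrow> \<bar>(\<Sum>l<m. (minner n (Bs l) X)\<^sup>2) / real m - 1\<bar> \<le> \<delta>" for Bs
  proof -
    have "closed {X. \<bar>(\<Sum>l<m. (minner n (Bs l) X)\<^sup>2) / real m - 1\<bar> \<le> \<delta>}"
    proof -
      have "continuous_on UNIV (\<lambda>X :: nat \<Rightarrow> nat \<Rightarrow> real. X i j)" for i j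
        by (rule continuous_on_product_then_coordinatewise[OF continuous_on_product_coordinates])
      then have "continuous_on UNIV (\<lambda>X :: nat \<Rightarrow> nat \<Rightarrow> real. minner n (Bs l) X)" for l
        unfolding minner_def by (intro continuous_on_sum continuous_on_mult_left)
      then show ?thesis using m1 by (intro closed_Collect_le continuous_intros) auto
    qed
    then have "closure T \<subseteq> {X. \<bar>(\<Sum>l<m. (minner n (Bs l) X)\<^sup>2) / real m - 1\<bar> \<le> \<delta>}"
      using bd by (intro closure_minimal) auto
    then have onU: "\<bar>(\<Sum>l<m. (minner n (Bs l) X)\<^sup>2) / real m - 1\<bar> \<le> \<delta>" if "X \<in> U" for X
      using T(3) that by blast
    show ?thesis
      unfolding nuclear_rip_def
    proof (intro ballI impI)
      fix X assume X: "X \<in> sqmats n" "nuc_norm n X \<le> s * frob n X"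
      define c where "c = frob n X"
      have vm: "(vnorm m (meas n Bs X))\<^sup>2 = (\<Sum>l<m. (minner n (Bs l) X)\<^sup>2)"
        by (simp add: vnorm_def meas_def sum_nonneg)
      show "\<bar>(vnorm m (meas n Bs X))\<^sup>2 / real m - (frob n X)\<^sup>2\<bar> \<le> \<delta> * (frob n X)\<^sup>2"
      proof (cases "c = 0")
        case True
        then have "minner n (Bs l) X = 0" for l using minner_Cauchy_Schwarz[of n "Bs l" X] by (simp add: c_def)
        then show ?thesis using True unfolding vm by (simp add: c_def)
      next
        case False
        then have c: "0 < c" using frob_nonneg[of n X] by (simp add: c_def less_le)
        let ?Y = "\<lambda>i j. 1 / c * X i j"
        have "frob n ?Y = 1" unfolding frob_scale using c by (simp add: c_def)
        moreover have "nuc_norm n ?Y \<le> s"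
          using X(2) c by (subst nuc_norm_scale) (auto simp: c_def[symmetric] field_simps)
        moreover have "?Y \<in> sqmats n" using X(1) by (simp add: sqmats_def)
        ultimately have "?Y \<in> U" by (simp add: U_def)
        from onU[OF this] have "\<bar>(\<Sum>l<m. (minner n (Bs l) X)\<^sup>2) / real m / c\<^sup>2 - 1\<bar> \<le> \<delta>"
          unfolding minner_scale_right power_mult_distrib sum_distrib_left[symmetric]
          by (simp add: power_divide mult.commute)
        moreover have "(\<Sum>l<m. (minner n (Bs l) X)\<^sup>2) / real m - c\<^sup>2
            = c\<^sup>2 * ((\<Sum>l<m. (minner n (Bs l) X)\<^sup>2) / real m / c\<^sup>2 - 1)"
          using c by (simp add: field_simps)
        ultimately show ?thesis
          unfolding vm c_def[symmetric] using c
          by (simp add: abs_mult mult.commute[of \<delta>] mult_left_mono)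
      qed
    qed
  qed
  show ?thesis
  proof (cases "T = {}")
    \<comment> \<open>An empty \<open>T\<close> has no enumeration; here the hypothesis of
      \<open>extend\<close> is vacuous and the whole space serves as event.\<close>
    case True
    then show ?thesis
      using extend P.prob_space by (intro bexI[of _ "space ?P"]) (auto simp: s_def)
  next
    case False
    define Xs where "Xs = from_nat_into T"
    have XsT: "range Xs = T" unfolding Xs_def using range_from_nat_into[OF False T(1)] .
    have XsU: "Xs q \<in> sqmats n" "frob n (Xs q) = 1" "nuc_norm n (Xs q) \<le> s" for q
      using T(2) XsT by (auto simp: U_def)
    \<comment> \<open>Replacing measurements from the null set \<open>N\<close> by 0 makes the
      spectral bound hold at every point, as the pointwise hypotheses of
      \<open>empirical_process_deviation\<close> require. The event \<open>nul\<close> takes such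
      samples out again at the end.\<close>
    define Bt where "Bt B = (if B \<in> N then (\<lambda>i j. 0) else B)" for B
    define f where "f q B = (minner n (Bt B) (Xs q))\<^sup>2" for q B
    have fif: "f q B = (if B \<in> N then 0 else (minner n B (Xs q))\<^sup>2)" for q B
      by (simp add: f_def Bt_def minner_def)
    have Btop: "op_le n K (Bt B)" if "B \<in> space \<mu>" for B
    proof (cases "B \<in> N")
      case True
      then show ?thesis using K0 by (simp add: Bt_def op_le_def mv_def ip_def)
    qed (use good that in \<open>simp add: Bt_def\<close>)
    have vb: "\<bar>minner n (Bt B) (Xs q)\<bar> \<le> b" if "B \<in> space \<mu>" for B q
    proof -
      have "K * nuc_norm n (Xs q) \<le> K * s" using XsU K0 by (intro mult_left_mono) auto
      then show ?thesis using abs_minner_le[OF Btop[OF that] K0, of "Xs q"] by (simp add: b_def mult.commute)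
    qed
    have fb: "f q B \<le> b\<^sup>2" if "B \<in> space \<mu>" for B q
      using vb[OF that, of q] b0 abs_le_square_iff[of "minner n (Bt B) (Xs q)" b] by (simp add: f_def)
    have f0: "0 \<le> f q B" for q B by (simp add: f_def)
    have mf[measurable]: "f q \<in> borel_measurable \<mu>" for q
    proof -
      have [measurable]: "(\<lambda>B. minner n B (Xs q)) \<in> borel_measurable \<mu>" by (rule measurable_minner[OF sets])
      have [measurable]: "N \<in> sets \<mu>" by (rule N(3))
      show ?thesis unfolding fif[abs_def] by measurable
    qed
    have fint: "integrable \<mu> (f q)" for q
      by (rule integrable_const_bound[of _ "b\<^sup>2"]) (auto intro!: AE_I2 simp: f0 fb)
    have fE: "(\<integral>B. f q B \<partial>\<mu>) = (\<integral>B. (minner n B (Xs q))\<^sup>2 \<partial>\<mu>)" for q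
    proof (rule integral_cong_AE)
      show "AE B in \<mu>. f q B = (minner n B (Xs q))\<^sup>2" using notN by eventually_elim (simp add: fif)
      show "(\<lambda>B. (minner n B (Xs q))\<^sup>2) \<in> borel_measurable \<mu>"
        by (intro borel_measurable_power measurable_minner[OF sets])
    qed simp
    have fmean: "\<bar>(\<integral>B. f q B \<partial>\<mu>) - 1\<bar> \<le> \<delta> / 32" for q
      unfolding fE by (rule mean) (rule XsU)+
    \<comment> \<open>Boundedness reduces the second moment to the mean: the square of
      \<open>f\<close> is at most \<open>b\<^sup>2\<close> times \<open>f\<close>, and the mean is
      at most 2.\<close>
    have fvar: "(\<integral>B. (f q B)\<^sup>2 \<partial>\<mu>) \<le> 2 * b\<^sup>2" for q
    proof -
      have "(\<integral>B. (f q B)\<^sup>2 \<partial>\<mu>) \<le> (\<integral>B. b\<^sup>2 * f q B \<partial>\<mu>)"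
      proof (rule integral_mono)
        show "integrable \<mu> (\<lambda>B. (f q B)\<^sup>2)"
        proof (rule integrable_const_bound[OF AE_I2])
          show "norm ((f q B)\<^sup>2) \<le> (b\<^sup>2)\<^sup>2" if "B \<in> space \<mu>" for B
            using power_mono[OF fb[OF that] f0, of q 2] by (simp only: real_norm_def abs_power2)
        qed simp
        show "(f q B)\<^sup>2 \<le> b\<^sup>2 * f q B" if "B \<in> space \<mu>" for B
          unfolding power2_eq_square[of "f q B"] using fb[OF that] f0 by (intro mult_right_mono) auto
      qed (use fint in simp)
      also have "\<dots> = b\<^sup>2 * (\<integral>B. f q B \<partial>\<mu>)" by simp
      also have "b\<^sup>2 * (\<integral>B. f q B \<partial>\<mu>) \<le> b\<^sup>2 * 2"
      proof (rule mult_left_mono)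
        show "(\<integral>B. f q B \<partial>\<mu>) \<le> 2" using fmean[of q] \<delta> by linarith
      qed simp
      finally show ?thesis by simp
    qed
    have vm: "2 * b\<^sup>2 \<le> real m * (\<delta> / 32)\<^sup>2 / 8"
    proof -
      have "1 \<le> (ln (real n)) ^ 7" using L2 by (intro one_le_power) (simp add: L_def)
      then have "80 * 9331200 / \<tau>\<^sup>2 * real r * K\<^sup>2 * 1 \<le> 80 * 9331200 / \<tau>\<^sup>2 * real r * K\<^sup>2 * (ln (real n)) ^ 7"
        by (intro mult_left_mono) auto
      then have "80 * 9331200 / \<tau>\<^sup>2 * real r * K\<^sup>2 \<le> real m" using m by linarith
      then have "80 * 9331200 * (real r * K\<^sup>2) \<le> \<tau>\<^sup>2 * real m" using \<tau>0 by (simp add: field_simps)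
      moreover have "\<tau>\<^sup>2 * real m = real m * (\<delta> / 32)\<^sup>2 / 16" by (simp add: \<tau> power_divide)
      moreover have "0 \<le> real r * K\<^sup>2" by simp
      moreover have "2 * b\<^sup>2 = 18 * (real r * K\<^sup>2)" by (simp add: b2)
      ultimately show ?thesis by linarith
    qed
    have signs: "real (card {S \<in> Pow {..<m}. \<exists>X. \<bar>\<Sum>i<m. sg S i * f X (z i)\<bar> > \<delta> / 128 * real m * real q}) \<le> 2 ^ m * \<rho>"
      if z: "\<And>i. i < m \<Longrightarrow> z i \<in> space \<mu>" and q: "1 \<le> (q::nat)"
        and en: "\<And>Y. (\<Sum>i<m. f Y (z i)) \<le> real m * (real q)\<^sup>2" for z q
    proof -
      define V where "V = range (\<lambda>X i. minner n (Bt (z i)) (Xs X))"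
      define th where "th = real J * sqrt (288 * b\<^sup>2 * real m * (real q)\<^sup>2 * (2 * ln A + 4 * L)) + 4 * b / 2 ^ J * real m * real q"
      have "real (card {S \<in> Pow {..<m}. \<exists>v\<in>V. \<bar>\<Sum>i<m. sg S i * (v i)\<^sup>2\<bar> > th}) \<le> 2 ^ m * (2 * real J * exp (- (4 * L)))"
        unfolding th_def
      proof (rule signs_chaining[OF b0 _ m1 A1])
        show "0 < real q" using q by simp
        show "0 \<le> 4 * L" using L2 by simp
        show "\<bar>v i\<bar> \<le> b" if "v \<in> V" "i < m" for v i using that vb z by (auto simp: V_def)
        show "(\<Sum>i<m. (v i)\<^sup>2) \<le> real m * (real q)\<^sup>2" if "v \<in> V" for v
          using that en by (auto simp: V_def f_def)
        fix j :: nat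
        \<comment> \<open>Since \<open>b = s * K\<close>, radius and spectral bound cancel and the
          mistake bound at error \<open>b / 2 ^ j\<close> is exactly
          \<open>24 * k * 4 ^ j\<close>.\<close>
        have "24 * real k * K\<^sup>2 * s\<^sup>2 / (b / 2 ^ j)\<^sup>2 \<le> real (24 * k * 4 ^ j)"
        proof -
          have "((2::real) ^ j)\<^sup>2 = (2\<^sup>2) ^ j" by (simp only: power_mult[symmetric] mult.commute)
          then have "(b / 2 ^ j)\<^sup>2 = s\<^sup>2 * K\<^sup>2 / 4 ^ j" by (simp add: power_divide b_def power_mult_distrib)
          then show ?thesis using s0 Kpos by simp
        qed
        moreover have "0 < b / 2 ^ j" using b0 by simp
        ultimately obtain C :: "(nat \<Rightarrow> real) set" where C: "finite C" "card C \<le> (2 * m + 1) ^ (24 * k * 4 ^ j)"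
          "\<forall>X. nuc_norm n X \<le> s \<longrightarrow> (\<exists>c\<in>C. \<forall>i<m. \<bar>minner n (Bt (z i)) X - c i\<bar> \<le> b / 2 ^ j)"
          using nuclear_ball_cover[of m n K "\<lambda>i. Bt (z i)" s "b / 2 ^ j" k "24 * k * 4 ^ j"] Btop z Kpos s0 n1 k1 nk by blast
        have "real (card C) \<le> real ((2 * m + 1) ^ (24 * k * 4 ^ j))" using C(2) by (rule of_nat_mono)
        also have "\<dots> = A ^ (4 ^ j)" unfolding A_def of_nat_power power_mult ..
        finally have "real (card C) \<le> A ^ (4 ^ j)" .
        then show "\<exists>C. finite C \<and> real (card C) \<le> A ^ (4 ^ j) \<and> (\<forall>v\<in>V. \<exists>c\<in>C. \<forall>i<m. \<bar>v i - c i\<bar> \<le> b / 2 ^ j)"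
          using C(1,3) XsU(3) unfolding V_def by (intro exI[of _ C]) auto
      qed
      \<comment> \<open>The budget \<open>\<tau> = \<delta> / 128\<close> is shared equally by the
        chain and the truncation error.\<close>
      moreover have thle: "th \<le> \<delta> / 128 * real m * real q"
      proof -
        have "real J * sqrt (288 * b\<^sup>2 * real m * (real q)\<^sup>2 * \<Lambda>) \<le> \<tau> / 2 * real m * real q"
        proof (rule power2_le_imp_le)
          have "(real J * sqrt (288 * b\<^sup>2 * real m * (real q)\<^sup>2 * \<Lambda>))\<^sup>2
              = ((real J)\<^sup>2 * 288 * b\<^sup>2 * \<Lambda>) * (real m * (real q)\<^sup>2)"
            using \<Lambda>0 by (simp add: power_mult_distrib)
          also have "\<dots> \<le> (\<tau>\<^sup>2 / 4 * real m) * (real m * (real q)\<^sup>2)"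
            using main by (intro mult_right_mono) auto
          also have "\<dots> = (\<tau> / 2 * real m * real q)\<^sup>2" by (simp add: power2_eq_square)
          finally show "(real J * sqrt (288 * b\<^sup>2 * real m * (real q)\<^sup>2 * \<Lambda>))\<^sup>2 \<le> (\<tau> / 2 * real m * real q)\<^sup>2" .
        qed (use \<tau>0 in simp)
        moreover have "4 * b / 2 ^ J * real m * real q \<le> \<tau> / 2 * real m * real q"
          using J2 by (intro mult_right_mono) auto
        moreover have "\<tau> / 2 * real m * real q + \<tau> / 2 * real m * real q = \<delta> / 128 * real m * real q"
          by (simp add: \<tau>)
        ultimately show ?thesis unfolding th_def \<Lambda>_def[symmetric] by linarith
      qed
      have "{S \<in> Pow {..<m}. \<exists>X. \<bar>\<Sum>i<m. sg S i * f X (z i)\<bar> > \<delta> / 128 * real m * real q}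
          \<subseteq> {S \<in> Pow {..<m}. \<exists>v\<in>V. \<bar>\<Sum>i<m. sg S i * (v i)\<^sup>2\<bar> > th}"
      proof (rule subsetI)
        fix S assume "S \<in> {S \<in> Pow {..<m}. \<exists>X. \<bar>\<Sum>i<m. sg S i * f X (z i)\<bar> > \<delta> / 128 * real m * real q}"
        then obtain X where X: "S \<in> Pow {..<m}" "\<bar>\<Sum>i<m. sg S i * f X (z i)\<bar> > \<delta> / 128 * real m * real q" by blast
        have "(\<lambda>i. minner n (Bt (z i)) (Xs X)) \<in> V" by (simp add: V_def)
        moreover have "th < \<bar>\<Sum>i<m. sg S i * (minner n (Bt (z i)) (Xs X))\<^sup>2\<bar>"
          using order.strict_trans1[OF thle X(2)] by (simp only: f_def)
        ultimately show "S \<in> {S \<in> Pow {..<m}. \<exists>v\<in>V. \<bar>\<Sum>i<m. sg S i * (v i)\<^sup>2\<bar> > th}" using X(1)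
          by (intro CollectI conjI bexI[of _ "\<lambda>i. minner n (Bt (z i)) (Xs X)"])
      qed
      then have "real (card {S \<in> Pow {..<m}. \<exists>X. \<bar>\<Sum>i<m. sg S i * f X (z i)\<bar> > \<delta> / 128 * real m * real q})
          \<le> real (card {S \<in> Pow {..<m}. \<exists>v\<in>V. \<bar>\<Sum>i<m. sg S i * (v i)\<^sup>2\<bar> > th})"
        by (intro of_nat_mono card_mono) auto
      ultimately show ?thesis unfolding \<rho>_def by linarith
    qed
    define bad where "bad = {z \<in> space ?P. \<exists>X. \<bar>(\<Sum>i<m. f X (z i)) / real m - 1\<bar> > \<delta>}"
    have pbad: "measure ?P bad \<le> 6 * \<rho>"
      unfolding bad_def
      by (rule empirical_process_deviation[OF \<mu> m1 mf f0 fb fmean fvar vm \<delta> \<rho>0 \<rho>16 signs])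
    have comp: "(\<lambda>w. f X (w i)) \<in> borel_measurable ?P" if "i < m" for X i
      using that mf by (intro measurable_compose[OF measurable_component_singleton]) auto
    have [measurable]: "(\<lambda>z. \<Sum>i<m. f X (z i)) \<in> borel_measurable ?P" for X
      by (intro borel_measurable_sum comp) auto
    have badS: "bad \<in> sets ?P" unfolding bad_def by measurable
    define nul where "nul = {z \<in> space ?P. \<exists>i<m. z i \<in> N}"
    have nulS: "nul \<in> sets ?P"
    proof -
      have "nul = (\<Union>i\<in>{..<m}. (\<lambda>z. z i) -` N \<inter> space ?P)" by (auto simp: nul_def)
      moreover have "\<dots> \<in> sets ?P"
        using N(3) by (intro sets.finite_UN measurable_sets[OF measurable_component_singleton]) auto
      ultimately show ?thesis by simp
    qed
    have "AE z in ?P. \<forall>i\<in>{..<m}. z i \<notin> N"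
      using notN by (intro AE_finite_allI AE_PiM_component \<mu>) auto
    then have "AE z in ?P. z \<notin> nul" by eventually_elim (auto simp: nul_def)
    then have pnul: "measure ?P nul = 0"
      using nulS by (subst P.prob_eq_0) auto
    define E where "E = space ?P - (bad \<union> nul)"
    have ES: "E \<in> sets ?P" unfolding E_def using badS nulS by auto
    have "measure ?P (bad \<union> nul) \<le> 1 / (real n)\<^sup>2"
      using measure_Un_le[OF badS nulS] pbad pnul \<rho>n by linarith
    then have PE: "measure ?P E \<ge> 1 - 1 / (real n)\<^sup>2"
      unfolding E_def using P.prob_compl[of "bad \<union> nul"] badS nulS by simp
    have "nuclear_rip n m (3 * sqrt (real r)) \<delta> Bs" if Bs: "Bs \<in> E" for Bs
      unfolding s_def[symmetric]
    proof (rule extend)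
      fix X assume "X \<in> T"
      then obtain q where q: "X = Xs q" using XsT by auto
      have "Bs \<in> space ?P" "Bs \<notin> bad" "\<And>i. i < m \<Longrightarrow> Bs i \<notin> N" using Bs by (auto simp: E_def nul_def)
      then show "\<bar>(\<Sum>l<m. (minner n (Bs l) X)\<^sup>2) / real m - 1\<bar> \<le> \<delta>"
        by (auto simp: bad_def not_less fif q)
    qed
    then show ?thesis using ES PE by blast
  qed
qed

theorem theorem5:
  fixes c5 \<delta> :: real
  assumes "c5 > 0" and "0 < \<delta>" and "\<delta> < 1"
  shows "\<exists>c0 C2 :: real. c0 > 0 \<and> C2 > 0 \<and> (\<exists>N::nat. \<forall>n\<ge>N. \<forall>(m::nat) (r::nat) (K::real)
      (\<mu> :: (nat \<Rightarrow> nat \<Rightarrow> real) measure).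
      prob_space \<mu> \<longrightarrow> sets \<mu> = sets (matsp n) \<longrightarrow>
      K \<le> real n ^ 2 \<longrightarrow>
      (AE B in \<mu>. spec_norm n B \<le> K) \<longrightarrow>
      op_norm_F n (EBB_minus_I n \<mu>) \<le> c5 / real n \<longrightarrow>
      real m > c0 * real r * K\<^sup>2 * (ln (real n)) ^ 7 \<longrightarrow>
      (\<exists>E \<in> sets (PiM {..<m} (\<lambda>_. \<mu>)).
         measure (PiM {..<m} (\<lambda>_. \<mu>)) E \<ge> 1 - 1 / (real n)\<^sup>2 \<and>
         (\<forall>Bs\<in>E.
           (\<forall>X\<in>sqmats n. mrank n X \<le> r \<longrightarrow>
              \<bar>(vnorm m (meas n Bs X))\<^sup>2 / real m - (frob n X)\<^sup>2\<bar> \<le> \<delta> * (frob n X)\<^sup>2) \<and>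
           (\<forall>\<K> \<subseteq> sqmats n. \<forall>\<epsilon>2 :: real. \<forall>\<Sigma> y \<Sigma>h.
              mconvex \<K> \<longrightarrow> \<epsilon>2 \<ge> 0 \<longrightarrow> \<Sigma> \<in> \<K> \<longrightarrow> mrank n \<Sigma> \<le> r \<longrightarrow>
              vnorm m (\<lambda>l. y l - meas n Bs \<Sigma> l) \<le> \<epsilon>2 \<longrightarrow>
              \<Sigma>h \<in> \<K> \<longrightarrow> vnorm m (\<lambda>l. y l - meas n Bs \<Sigma>h l) \<le> \<epsilon>2 \<longrightarrow>
              (\<forall>M\<in>\<K>. vnorm m (\<lambda>l. y l - meas n Bs M l) \<le> \<epsilon>2 \<longrightarrow> nuc_norm n \<Sigma>h \<le> nuc_norm n M) \<longrightarrow>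
              frob n (\<lambda>i j. \<Sigma>h i j - \<Sigma> i j) \<le> C2 * \<epsilon>2 / sqrt (real m)))))"
proof -
  define \<tau> where "\<tau> = \<delta> / 128"
  define c0 where "c0 = 80 * 9331200 / \<tau>\<^sup>2"
  define C2 where "C2 = 2 / sqrt (1 - \<delta>)"
  \<comment> \<open>Collects the four lower bounds on \<open>n\<close> in
    \<open>nuclear_rip_event\<close>.\<close>
  define N where "N = max 72 (nat \<lceil>max (16 * 9331200 / \<tau>\<^sup>2) (max (72 / \<tau>) (32 * c5 / \<delta>))\<rceil>)"
  have c0: "0 < c0" and C2: "0 < C2" using assms by (auto simp: c0_def C2_def \<tau>_def)
  have event: "\<exists>E \<in> sets (PiM {..<m} (\<lambda>_. \<mu>)). measure (PiM {..<m} (\<lambda>_. \<mu>)) E \<ge> 1 - 1 / (real n)\<^sup>2 \<and>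
      (\<forall>Bs\<in>E. nuclear_rip n m (3 * sqrt (real (min r n))) \<delta> Bs)"
    if n: "N \<le> n" and \<mu>: "prob_space \<mu>" "sets \<mu> = sets (matsp n)" and K: "K \<le> real n ^ 2"
      and sp: "AE B in \<mu>. spec_norm n B \<le> K" and op: "op_norm_F n (EBB_minus_I n \<mu>) \<le> c5 / real n"
      and m: "real m > c0 * real r * K\<^sup>2 * (ln (real n)) ^ 7"
    for n m r K and \<mu> :: "(nat \<Rightarrow> nat \<Rightarrow> real) measure"
  proof (cases "r = 0")
    case True
    interpret prob_space "PiM {..<m} (\<lambda>_. \<mu>)" by (intro prob_space_PiM \<mu>)
    show ?thesis
      using True prob_space
      by (intro bexI[of _ "space (PiM {..<m} (\<lambda>_. \<mu>))"]) (auto simp: nuclear_rip_scale_zero)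
  next
    case False
    have nN: "72 \<le> n" using n by (simp add: N_def)
    have "max (16 * 9331200 / \<tau>\<^sup>2) (max (72 / \<tau>) (32 * c5 / \<delta>)) \<le> real n"
    proof -
      have "nat \<lceil>max (16 * 9331200 / \<tau>\<^sup>2) (max (72 / \<tau>) (32 * c5 / \<delta>))\<rceil> \<le> n" using n by (simp add: N_def)
      then show ?thesis using real_nat_ceiling_ge order_trans of_nat_mono by blast
    qed
    then have nb: "16 * 9331200 / \<tau>\<^sup>2 \<le> real n" "72 / \<tau> \<le> real n" "32 * c5 / \<delta> \<le> real n" by auto
    \<comment> \<open>Capping the rank at \<open>n\<close> only weakens the sample size
      condition.\<close>
    have "c0 * real (min r n) * K\<^sup>2 * (ln (real n)) ^ 7 \<le> c0 * real r * K\<^sup>2 * (ln (real n)) ^ 7"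
      using c0 nN by (intro mult_right_mono mult_left_mono) auto
    then have m': "real m > 80 * 9331200 / \<tau>\<^sup>2 * real (min r n) * K\<^sup>2 * (ln (real n)) ^ 7"
      using m unfolding c0_def by linarith
    have r': "1 \<le> min r n" "min r n \<le> n" using False nN by auto
    show ?thesis
      by (rule nuclear_rip_event[OF \<mu> assms(2,3) \<tau>_def nN nb r' K sp op m'])
  qed
  have pos: "0 < m" if "N \<le> n" "real m > c0 * real r * K\<^sup>2 * (ln (real n)) ^ 7" for n m r :: nat and K
  proof -
    have "0 \<le> c0 * real r * K\<^sup>2 * (ln (real n)) ^ 7" using c0 that(1) by (simp add: N_def)
    then show ?thesis using that(2) by simp
  qed
  show ?thesis
  proof (rule exI[of _ c0], rule exI[of _ C2], intro exI[of _ N] conjI c0 C2 allI impI)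
    fix n m r :: nat and K :: real and \<mu> :: "(nat \<Rightarrow> nat \<Rightarrow> real) measure"
    assume h: "N \<le> n" "prob_space \<mu>" "sets \<mu> = sets (matsp n)" "K \<le> real n ^ 2"
      "AE B in \<mu>. spec_norm n B \<le> K" "op_norm_F n (EBB_minus_I n \<mu>) \<le> c5 / real n"
      "c0 * real r * K\<^sup>2 * (ln (real n)) ^ 7 < real m"
    have m0: "0 < m" by (rule pos[OF h(1,7)])
    obtain E where E: "E \<in> sets (PiM {..<m} (\<lambda>_. \<mu>))"
      "measure (PiM {..<m} (\<lambda>_. \<mu>)) E \<ge> 1 - 1 / (real n)\<^sup>2"
      and rip: "\<And>Bs. Bs \<in> E \<Longrightarrow> nuclear_rip n m (3 * sqrt (real (min r n))) \<delta> Bs"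
      using event[OF h] by blast
    show "\<exists>E \<in> sets (PiM {..<m} (\<lambda>_. \<mu>)).
         measure (PiM {..<m} (\<lambda>_. \<mu>)) E \<ge> 1 - 1 / (real n)\<^sup>2 \<and>
         (\<forall>Bs\<in>E.
           (\<forall>X\<in>sqmats n. mrank n X \<le> r \<longrightarrow>
              \<bar>(vnorm m (meas n Bs X))\<^sup>2 / real m - (frob n X)\<^sup>2\<bar> \<le> \<delta> * (frob n X)\<^sup>2) \<and>
           (\<forall>\<K> \<subseteq> sqmats n. \<forall>\<epsilon>2 :: real. \<forall>\<Sigma> y \<Sigma>h.
              mconvex \<K> \<longrightarrow> \<epsilon>2 \<ge> 0 \<longrightarrow> \<Sigma> \<in> \<K> \<longrightarrow> mrank n \<Sigma> \<le> r \<longrightarrow>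
              vnorm m (\<lambda>l. y l - meas n Bs \<Sigma> l) \<le> \<epsilon>2 \<longrightarrow>
              \<Sigma>h \<in> \<K> \<longrightarrow> vnorm m (\<lambda>l. y l - meas n Bs \<Sigma>h l) \<le> \<epsilon>2 \<longrightarrow>
              (\<forall>M\<in>\<K>. vnorm m (\<lambda>l. y l - meas n Bs M l) \<le> \<epsilon>2 \<longrightarrow> nuc_norm n \<Sigma>h \<le> nuc_norm n M) \<longrightarrow>
              frob n (\<lambda>i j. \<Sigma>h i j - \<Sigma> i j) \<le> C2 * \<epsilon>2 / sqrt (real m)))"
    proof (intro bexI[OF _ E(1)] conjI E(2) ballI allI impI)
      fix Bs X assume "Bs \<in> E" "X \<in> sqmats n" "mrank n X \<le> r"
      then show "\<bar>(vnorm m (meas n Bs X))\<^sup>2 / real m - (frob n X)\<^sup>2\<bar> \<le> \<delta> * (frob n X)\<^sup>2"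
        using nuclear_rip_rank[OF rip] by blast
    next
      fix Bs \<K> \<epsilon>2 \<Sigma> y \<Sigma>h
      assume a: "Bs \<in> E" "\<K> \<subseteq> sqmats n" "\<Sigma> \<in> \<K>" "mrank n \<Sigma> \<le> r"
        "vnorm m (\<lambda>l. y l - meas n Bs \<Sigma> l) \<le> \<epsilon>2" "\<Sigma>h \<in> \<K>" "vnorm m (\<lambda>l. y l - meas n Bs \<Sigma>h l) \<le> \<epsilon>2"
        "\<forall>M\<in>\<K>. vnorm m (\<lambda>l. y l - meas n Bs M l) \<le> \<epsilon>2 \<longrightarrow> nuc_norm n \<Sigma>h \<le> nuc_norm n M"
      then show "frob n (\<lambda>i j. \<Sigma>h i j - \<Sigma> i j) \<le> C2 * \<epsilon>2 / sqrt (real m)"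
        unfolding C2_def by (intro nuclear_rip_recovery[OF rip[OF a(1)] assms(3) m0, where y = y]) blast+
    qed
  qed
qed

end
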